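(* Let $\rho,\tau\in\mathbb{Z}_{\ge 1}$ and $r>0$ be fixed, and consider the two-color competition dynamics on $\mathbb{Z}^2$ with red neighborhood $\mathcal{R}=\{0\}\times([-\rho,\rho]\cap\mathbb{Z})$, blue neighborhood $\mathcal{B}=([-\tau,\tau]\cap\mathbb{Z})\times\{0\}$, red update interval $r$, and initial densities $p$ of blue and $q$ of red. Let $\gamma=\frac1\tau+\frac{\rho}{\rho+1}$, let $a>0$ be a constant, and suppose $q=ap^{\gamma}$. Then for every $a>0$ $$0<\liminf_{p\to0}\mathbb{P}(0\text{ is eventually blue})\le\limsup_{p\to0}\mathbb{P}(0\text{ is eventually blue})<1.$$ Moreover, the $\limsup$ (as a function of $a$) tends to $0$ as $a\to\infty$, and the $\liminf$ tends to $1$ as $a\to0$.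
   Context: Two-color competition dynamics on $\mathbb{Z}^2$. Initially each vertex of $\mathbb{Z}^2$ is independently blue with probability $p$, red with probability $q$, and empty with probability $1-p-q$. Let $\mathcal{B}\subset\mathbb{Z}\times\{0\}$ and $\mathcal{R}\subset\mathbb{Z}^2$ be finite sets and $r>0$. At times $t\in\{1,2,3,\dots\}$, every empty vertex $x$ that has a blue vertex in $x+\mathcal{B}$ becomes blue. At times $t\in\{r,2r,3r,\dots\}$, every empty vertex $x$ that has a red vertex in $x+\mathcal{R}$ becomes red. If a vertex is due to become both blue and red at the same time, its color is decided by an independent fair coin flip. Colored vertices never change color again. Hence every vertex changes state at most once and has a final state; "$0$ is eventually blue" means that the final state of the origin is blue. *)

theory Defs
  imports "HOL-Probability.Probability"
begin

datatype vstate = Empty | Blue | Red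

definition blue_times :: "real set" where
  "blue_times = {real n | n. n \<ge> 1}"

definition red_times :: "real \<Rightarrow> real set" where
  "red_times r = {real n * r | n. n \<ge> 1}"

text \<open>The dynamics is indexed by the successive instants at which at least one colour updates:
  \<open>update_time r k\<close> is the \<open>k\<close>-th such instant, and time 0 is the initial instant.\<close>

primrec update_time :: "real \<Rightarrow> nat \<Rightarrow> real" where
  "update_time r 0 = 0"
| "update_time r (Suc k) = (LEAST t. t \<in> blue_times \<union> red_times r \<and> update_time r k < t)"

text \<open>A sample point \<open>\<omega>\<close> assigns to each vertex its initial state and a coin. One coin per vertex
  suffices, because a vertex that uses its coin is coloured from then on.\<close>

primrec state_at ::
  "(int \<times> int) set \<Rightarrow> (int \<times> int) set \<Rightarrow> real \<Rightarrow> (int \<times> int \<Rightarrow> vstate \<times> bool)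
    \<Rightarrow> nat \<Rightarrow> int \<times> int \<Rightarrow> vstate"
where
  "state_at B R r \<omega> 0 x = fst (\<omega> x)"
| "state_at B R r \<omega> (Suc k) x =
    (let s = state_at B R r \<omega> k;
         t = update_time r (Suc k);
         to_blue = (t \<in> blue_times \<and> (\<exists>y\<in>B. s (x + y) = Blue));
         to_red = (t \<in> red_times r \<and> (\<exists>y\<in>R. s (x + y) = Red))
     in if s x \<noteq> Empty then s x
        else if to_blue \<and> to_red then (if snd (\<omega> x) then Blue else Red)
        else if to_blue then Blue
        else if to_red then Red
        else Empty)"

definition eventually_blue ::
  "(int \<times> int) set \<Rightarrow> (int \<times> int) set \<Rightarrow> real \<Rightarrow> (int \<times> int \<Rightarrow> vstate \<times> bool)
    \<Rightarrow> int \<times> int \<Rightarrow> bool"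
where
  "eventually_blue B R r \<omega> x \<longleftrightarrow> (\<forall>\<^sub>F k in sequentially. state_at B R r \<omega> k x = Blue)"

text \<open>Only meaningful for \<open>p, q \<ge> 0\<close> and \<open>p + q \<le> 1\<close>.\<close>

definition initial_pmf :: "real \<Rightarrow> real \<Rightarrow> vstate pmf" where
  "initial_pmf p q =
    embed_pmf (\<lambda>c. case c of Blue \<Rightarrow> p | Red \<Rightarrow> q | Empty \<Rightarrow> 1 - p - q)"

definition competition_measure :: "real \<Rightarrow> real \<Rightarrow> (int \<times> int \<Rightarrow> vstate \<times> bool) measure" where
  "competition_measure p q =
    (\<Pi>\<^sub>M x\<in>UNIV. measure_pmf (pair_pmf (initial_pmf p q) (bernoulli_pmf (1/2))))"

definition prob_origin_blue ::
  "(int \<times> int) set \<Rightarrow> (int \<times> int) set \<Rightarrow> real \<Rightarrow> real \<Rightarrow> real \<Rightarrow> real"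
where
  "prob_origin_blue B R r p q = \<P>(\<omega> in competition_measure p q. eventually_blue B R r \<omega> 0)"

definition blue_nbhd :: "nat \<Rightarrow> (int \<times> int) set" where
  "blue_nbhd \<tau> = {- int \<tau>..int \<tau>} \<times> {0}"

definition red_nbhd :: "nat \<Rightarrow> (int \<times> int) set" where
  "red_nbhd \<rho> = {0} \<times> {- int \<rho>..int \<rho>}"

definition critical_exponent :: "nat \<Rightarrow> nat \<Rightarrow> real" where
  "critical_exponent \<rho> \<tau> = 1 / real \<tau> + real \<rho> / (real \<rho> + 1)"

lemma vstate_UNIV: "UNIV = {Empty, Blue, Red}"
  using vstate.exhaust by auto

lemma pmf_initial_pmf:
  assumes "p \<ge> 0" "q \<ge> 0" "p + q \<le> 1"
  shows "pmf (initial_pmf p q) Blue = p" "pmf (initial_pmf p q) Red = q"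
    "pmf (initial_pmf p q) Empty = 1 - p - q"
proof -
  let ?f = "\<lambda>c. case c of Blue \<Rightarrow> p | Red \<Rightarrow> q | Empty \<Rightarrow> 1 - p - q"
  have "pmf (initial_pmf p q) c = ?f c" for c
    unfolding initial_pmf_def
  proof (rule pmf_embed_pmf)
    show "0 \<le> ?f c" for c using assms by (auto split: vstate.split)
    have "finite (UNIV :: vstate set)" by (simp add: vstate_UNIV)
    then have "(\<integral>\<^sup>+ c. ennreal (?f c) \<partial>count_space UNIV) = (\<Sum>c\<in>UNIV. ennreal (?f c))"
      by (rule nn_integral_count_space_finite)
    also have "\<dots> = 1"
      using assms by (simp add: vstate_UNIV flip: ennreal_plus)
    finally show "(\<integral>\<^sup>+ c. ennreal (?f c) \<partial>count_space UNIV) = 1" .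
  qed
  then show "pmf (initial_pmf p q) Blue = p" "pmf (initial_pmf p q) Red = q"
    "pmf (initial_pmf p q) Empty = 1 - p - q" by simp_all
qed

lemma update_time_Suc:
  assumes "r > 0"
  shows "update_time r (Suc k) \<in> blue_times \<union> red_times r"
    and "update_time r k < update_time r (Suc k)"
    and "\<And>t. t \<in> blue_times \<union> red_times r \<Longrightarrow> update_time r k < t \<Longrightarrow> update_time r (Suc k) \<le> t"
proof -
  let ?T = "blue_times \<union> red_times r"
  let ?u = "update_time r k"
  obtain m :: nat where "?u < real m" using reals_Archimedean2 by blast
  then have N: "?u < real (Suc m)" "1 \<le> Suc m" by auto
  define N where "N = Suc m"
  note N = N[folded N_def]
  define S where "S = {t \<in> ?T. ?u < t \<and> t \<le> real N}"
  have "{t \<in> blue_times. t \<le> real N} \<subseteq> real ` {..N}"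
    by (auto simp: blue_times_def)
  moreover have "{t \<in> red_times r. t \<le> real N} \<subseteq> (\<lambda>n. real n * r) ` {..nat \<lfloor>real N / r\<rfloor>}"
  proof
    fix t assume "t \<in> {t \<in> red_times r. t \<le> real N}"
    then obtain n where n: "t = real n * r" "real n * r \<le> real N"
      by (auto simp: red_times_def)
    then have "real n \<le> real N / r" using assms by (simp add: field_simps)
    then have "n \<le> nat \<lfloor>real N / r\<rfloor>" by (simp add: le_nat_floor)
    then show "t \<in> (\<lambda>n. real n * r) ` {..nat \<lfloor>real N / r\<rfloor>}" using n by auto
  qed
  ultimately have "finite ({t \<in> blue_times. t \<le> real N} \<union> {t \<in> red_times r. t \<le> real N})"
    by (meson finite_UnI finite_atMost finite_imageI finite_subset)
  then have fin: "finite S" by (rule rev_finite_subset) (auto simp: S_def)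
  have "real N \<in> blue_times" using N by (auto simp: blue_times_def)
  then have NS: "real N \<in> S" using N by (auto simp: S_def)
  have Min_in: "Min S \<in> S" using fin NS by (intro Min_in) auto
  have Min_le: "Min S \<le> t" if "t \<in> ?T" "?u < t" for t
  proof (cases "t \<le> real N")
    case True then show ?thesis using that fin by (intro Min_le) (auto simp: S_def)
  next
    case False then show ?thesis using Min_in by (auto simp: S_def)
  qed
  have "update_time r (Suc k) = Min S"
    unfolding update_time.simps
    by (rule Least_equality) (use Min_in Min_le in \<open>auto simp: S_def\<close>)
  then show "update_time r (Suc k) \<in> ?T" "?u < update_time r (Suc k)"
    "\<And>t. t \<in> ?T \<Longrightarrow> ?u < t \<Longrightarrow> update_time r (Suc k) \<le> t"
    using Min_in Min_le by (auto simp: S_def)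
qed

end

theory Submission
  imports Defs "HOL-Real_Asymp.Real_Asymp"
begin

text \<open>Put \<open>L = p powr (- \<rho> / (\<rho> + 1))\<close>. By time of order \<open>t\<close> blue occupies a site with probability about \<open>p t\<close>, so a red
  column growing over a distance \<open>L\<close> meets about \<open>L (p L)\<^sup>\<rho> = 1\<close> blocking runs of \<open>\<rho>\<close> blue sites:
  red spreads over distances of order \<open>L\<close>. Hence \<open>\<tau>\<close> consecutive sites of row 0 become red, and form
  a wall for blue, with probability of order \<open>(q L)\<^sup>\<tau> = a\<^sup>\<tau> p\<close>, while the blue seed closest to the
  origin in its row is at distance of order \<open>1 / p\<close>. So the number of walls that this seed meets is of
  order \<open>a\<^sup>\<tau>\<close>.

  That walls exist follows from a second moment estimate for walls seeded within distance \<open>\<epsilon> L\<close>.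
  That they are rare needs a bound on the probability that red travels much farther than \<open>L\<close>. It
  has to get past rows in which blue has no seed nearby, which is exponentially unlikely in the
  distance, or in which blue itself is stopped by a red wall; the latter costs only a power of
  \<open>p\<close> per layer of rows, and therefore the remote seeds are handled with many disjoint layers.\<close>

section \<open>Update times and growth along lines\<close>

text \<open>The dynamics enters the probabilistic part only through deterministic facts about growth
  on a line. Every event to be estimated concerns initial colours in a bounded box, and independence
  means disjoint boxes. This dictates the geometry: the right wall is fed from above and the left
  one from below, and layers of rows avoid row 0 and the columns of the run whose red colour they
  have to explain. Both bounds use a window of length \<epsilon> / p, with \<epsilon> independent of
  p. In the lower bound a blue seed is present with probability of order \<epsilon> for small
  \<epsilon>, while the expected number of pairs of a blue seed and a wall before it is of order
  \<epsilon>^2 a^\<tau>. A small \<epsilon> gives a positive liminf for each a; a large \<epsilon>,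
  followed by a to 0, gives the limit 1. Walls seeded up to distance 2^k L carry a weight 2^(k
  \<tau>), which the factor exp (- c 2^k) for a layer with too few blue seeds compensates. The bound
  for a layer in which red stops blue has no such decay in k, so the sum over scales must stop, at L
  times a small negative power of p.\<close>

lemma blue_times_eq: "blue_times = red_times 1"
  by (simp add: blue_times_def red_times_def)

lemma update_time_nonneg:
  assumes "r > 0"
  shows "update_time r k \<ge> 0"
proof (induction k)
  case (Suc k)
  then show ?case using update_time_Suc(2)[OF assms, of k] by linarith
qed simp

text \<open>Every positive multiple of \<open>d\<close> is an update instant, so none lies strictly
  between two consecutive instants. Hence the floor counts the ticks of the colour with period
  \<open>d\<close>.\<close>

lemma nat_floor_update_time_Suc:
  assumes "r > 0" "d > 0" and sub: "red_times d \<subseteq> blue_times \<union> red_times r"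
  shows "nat \<lfloor>update_time r (Suc k) / d\<rfloor> =
    nat \<lfloor>update_time r k / d\<rfloor> + (if update_time r (Suc k) \<in> red_times d then 1 else 0)"
proof -
  let ?u = "update_time r k" and ?v = "update_time r (Suc k)"
  have u0: "?u \<ge> 0" and uv: "?u < ?v"
    using update_time_nonneg[OF assms(1)] update_time_Suc(2)[OF assms(1)] by auto
  have hit: "real m * d \<le> ?u" if "real m * d < ?v" for m
  proof (cases "m = 0")
    case False
    then have "real m * d \<in> red_times d" by (auto simp: red_times_def)
    then have "real m * d \<in> blue_times \<union> red_times r"
      using sub by blast
    then show ?thesis
      using update_time_Suc(3)[OF assms(1), of "real m * d" k] that by linarith
  qed (use u0 in simp)
  show ?thesis
  proof (cases "?v \<in> red_times d")
    case True
    then obtain m where m: "?v = real m * d" "m \<ge> 1" by (auto simp: red_times_def)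
    have "real (m - 1) * d < ?v" using m assms(2) by (simp add: of_nat_diff)
    then have "real (m - 1) * d \<le> ?u" by (rule hit)
    then have "\<lfloor>?u / d\<rfloor> = int m - 1"
      using m uv assms(2) by (intro floor_unique) (auto simp: field_simps of_nat_diff)
    moreover have "\<lfloor>?v / d\<rfloor> = int m" using m assms(2) by simp
    ultimately show ?thesis using True m by simp
  next
    case False
    define m where "m = nat \<lfloor>?v / d\<rfloor>"
    have vd: "0 \<le> ?v / d" using u0 uv assms(2) by simp
    then have fl: "\<lfloor>?v / d\<rfloor> = int m" by (simp add: m_def)
    have le: "real m * d \<le> ?v"
      using assms(2) fl vd by (metis of_int_floor_le of_int_of_nat_eq pos_le_divide_eq)
    have "real m * d \<noteq> ?v"
    proof
      assume eq: "real m * d = ?v"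
      then have "m \<ge> 1" using u0 uv by (cases m) auto
      then show False using False eq by (auto simp: red_times_def)
    qed
    with le hit have "real m * d \<le> ?u" by simp
    then have "int m \<le> \<lfloor>?u / d\<rfloor>" using assms(2) by (simp add: le_floor_iff field_simps)
    moreover have "\<lfloor>?u / d\<rfloor> \<le> \<lfloor>?v / d\<rfloor>" using uv assms(2) by (intro floor_mono) (simp add: divide_right_mono)
    ultimately show ?thesis using False fl by simp
  qed
qed

text \<open>Each instant is a tick of at least one colour, so the two tick counts add up to at least
  \<open>k\<close>. This drives the instants to infinity, and the first one that reaches
  \<open>t\<close> cannot jump over it.\<close>

lemma update_time_hits:
  assumes "r > 0" and t: "t \<in> blue_times \<union> red_times r"
  shows "\<exists>k. update_time r k = t"
proof -
  let ?u = "update_time r"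
  have "k \<le> nat \<lfloor>?u k\<rfloor> + nat \<lfloor>?u k / r\<rfloor>" for k
  proof (induction k)
    case (Suc k)
    then show ?case
      using nat_floor_update_time_Suc[OF assms(1), of 1 k] nat_floor_update_time_Suc[OF assms(1,1), of k]
        update_time_Suc(1)[OF assms(1), of k]
      by (auto simp: blue_times_eq simp del: update_time.simps split: if_splits)
  qed simp
  then have *: "real k \<le> ?u k + ?u k / r" for k
  proof -
    assume "\<And>k. k \<le> nat \<lfloor>?u k\<rfloor> + nat \<lfloor>?u k / r\<rfloor>"
    then have "real k \<le> real (nat \<lfloor>?u k\<rfloor>) + real (nat \<lfloor>?u k / r\<rfloor>)" by (metis of_nat_add of_nat_le_iff)
    moreover have "0 \<le> ?u k" using update_time_nonneg[OF assms(1)] .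
    moreover have "0 \<le> ?u k / r" using update_time_nonneg[OF assms(1)] assms(1) by simp
    ultimately show ?thesis by (smt (verit) of_nat_floor)
  qed
  obtain N :: nat where N: "t + t / r < real N" using reals_Archimedean2 by blast
  have ex: "\<exists>k. t \<le> ?u k"
  proof (rule ccontr)
    assume "\<nexists>k. t \<le> ?u k"
    then have "?u N < t" by (simp add: not_le)
    then have "?u N + ?u N / r < t + t / r" using assms(1) by (simp add: add_strict_mono divide_strict_right_mono)
    then show False using *[of N] N by linarith
  qed
  define k where "k = (LEAST k. t \<le> ?u k)"
  have k: "t \<le> ?u k" unfolding k_def using ex by (rule LeastI_ex)
  have "t > 0" using t assms(1) by (auto simp: blue_times_def red_times_def)
  then obtain j where j: "k = Suc j" using k by (cases k) auto
  have "?u j < t" using not_less_Least[of j "\<lambda>k. t \<le> ?u k"] j by (simp add: k_def)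
  then have "?u k \<le> t" using update_time_Suc(3)[OF assms(1) t, of j] j by simp
  with k show ?thesis by (intro exI[of _ k]) simp
qed

text \<open>Along the direction in which it spreads, each colour performs a growth process on the integers:
  on every tick, \<open>C\<close> conquers all empty sites within distance \<open>w\<close>, up to competition with
  \<open>D\<close>. Rows carry such a process for blue, columns for red.\<close>

locale line_growth =
  fixes f :: "nat \<Rightarrow> int \<Rightarrow> vstate" and C D :: vstate and w :: nat
    and tick :: "nat \<Rightarrow> bool" and clock :: "nat \<Rightarrow> nat"
  assumes colour: "c \<noteq> Empty \<Longrightarrow> c \<noteq> D \<Longrightarrow> c = C"
    and CD: "C \<noteq> D" "C \<noteq> Empty" "D \<noteq> Empty"
    and permanent: "f k i \<noteq> Empty \<Longrightarrow> f (Suc k) i = f k i"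
    and spread: "f (Suc k) i = C \<Longrightarrow> f k i \<noteq> C \<Longrightarrow> tick k \<and> (\<exists>j. \<bar>j - i\<bar> \<le> int w \<and> f k j = C)"
    and grow: "tick k \<Longrightarrow> f k j = C \<Longrightarrow> \<bar>j - i\<bar> \<le> int w \<Longrightarrow> f (Suc k) i \<noteq> Empty"
    and clock_0: "clock 0 = 0"
    and clock_Suc: "clock (Suc k) = clock k + (if tick k then 1 else 0)"
begin

lemma permanent_le:
  assumes "k \<le> k'" "f k i \<noteq> Empty"
  shows "f k' i = f k i"
  using assms by (induction k' rule: dec_induct) (auto simp: permanent)

text \<open>Traced back in time, the colour moves by at most \<open>w\<close> per tick. This turns
  statements about a later state into statements about the initial colours.\<close>

lemma speed_limit:
  "f k i = C \<Longrightarrow> \<exists>j. \<bar>j - i\<bar> \<le> int (w * clock k) \<and> f 0 j = C"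
proof (induction k arbitrary: i)
  case 0
  then show ?case by (intro exI[of _ i]) simp
next
  case (Suc k)
  show ?case
  proof (cases "f k i = C")
    case True
    from Suc.IH[OF this] obtain j where j: "\<bar>j - i\<bar> \<le> int (w * clock k)" "f 0 j = C" by blast
    then show ?thesis
      by (intro exI[of _ j]) (auto simp: clock_Suc algebra_simps)
  next
    case False
    then obtain j where t: "tick k" and j: "\<bar>j - i\<bar> \<le> int w" "f k j = C"
      using spread Suc.prems by blast
    from Suc.IH[OF j(2)] obtain l where l: "\<bar>l - j\<bar> \<le> int (w * clock k)" "f 0 l = C" by blast
    have "\<bar>l - i\<bar> \<le> int (w * clock k) + int w" using l j by linarith
    then show ?thesis using t l by (intro exI[of _ l]) (simp add: clock_Suc algebra_simps)
  qed
qed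

text \<open>A tick fills the \<open>w\<close> sites below a conquered site, and one of them is not
  \<open>D\<close> at time \<open>K\<close>; colours being permanent, it never was \<open>D\<close>,
  so it is \<open>C\<close>. Thus \<open>C\<close> gains at least one site per tick, a crude speed
  but of the right order. Asking for the gaps at the final time \<open>K\<close> avoids following
  \<open>D\<close> in between.\<close>

lemma advance:
  assumes w: "w \<ge> 1" and j: "f 0 j = C" and ij: "i \<le> j" "j - i \<le> int (clock K)"
    and i: "f K i \<noteq> D"
    and gap: "\<And>a. i \<le> a \<Longrightarrow> a + int w \<le> j \<Longrightarrow> \<exists>b. a \<le> b \<and> b < a + int w \<and> f K b \<noteq> D"
  shows "f K i = C"
proof -
  have later: "f k b = C" if "f k b \<noteq> Empty" "f K b \<noteq> D" "k \<le> K" for k b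
    using permanent_le[OF that(3,1)] that colour by metis
  \<comment> \<open>The conquered site \<open>z\<close> descends with the clock; the
    \<open>max\<close> stops it at \<open>i\<close> instead of letting it overshoot.\<close>
  have "k \<le> K \<Longrightarrow> \<exists>z. i \<le> z \<and> z \<le> max i (j - int (clock k)) \<and> f k z = C" for k
  proof (induction k)
    case 0
    then show ?case using j ij by (intro exI[of _ j]) (simp add: clock_0)
  next
    case (Suc k)
    then obtain z where z: "i \<le> z" "z \<le> max i (j - int (clock k))" "f k z = C" by auto
    have keep: "f (Suc k) z = C" using z permanent[of k z] CD by simp
    show ?case
    proof (cases "tick k \<and> z > i")
      case False
      then show ?thesis using z keep by (intro exI[of _ z]) (auto simp: clock_Suc)
    next
      case True
      then have zj: "z \<le> j - int (clock k)" and cl: "clock (Suc k) = Suc (clock k)"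
        using z by (auto simp: clock_Suc)
      have near: "f (Suc k) b \<noteq> Empty" if "z - int w \<le> b" "b < z" for b
        using grow[of k z b] True z that by simp
      show ?thesis
      proof (cases "z - int w \<ge> i")
        case True
        have "\<exists>b. z - int w \<le> b \<and> b < z - int w + int w \<and> f K b \<noteq> D"
          by (rule gap) (use True zj in auto)
        then obtain b where b: "z - int w \<le> b" "b < z" "f K b \<noteq> D" by auto
        have "f (Suc k) b = C" using later[of "Suc k" b] near b Suc.prems by simp
        then show ?thesis using b True zj cl by (intro exI[of _ b]) auto
      next
        case False
        have "f (Suc k) i = C"
          using later[of "Suc k" i] near[of i] False True i Suc.prems by simp
        then show ?thesis by (intro exI[of _ i]) auto
      qed
    qed
  qed
  from this[of K] obtain z where "i \<le> z" "z \<le> max i (j - int (clock K))" "f K z = C" by auto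
  moreover have "max i (j - int (clock K)) = i" using ij by simp
  ultimately show ?thesis by simp
qed

text \<open>A tick carries \<open>C\<close> over at most \<open>w\<close> sites, so it never crosses
  \<open>w\<close> consecutive sites of the permanent colour \<open>D\<close>.\<close>

lemma wall:
  assumes left: "\<And>b. l - int w \<le> b \<Longrightarrow> b < l \<Longrightarrow> f K b = D"
    and right: "\<And>b. u < b \<Longrightarrow> b \<le> u + int w \<Longrightarrow> f K b = D"
    and mid: "\<And>b. l \<le> b \<Longrightarrow> b \<le> u \<Longrightarrow> f K b \<noteq> C"
    and "K \<le> k" "l \<le> i" "i \<le> u"
  shows "f k i \<noteq> C"
  using assms(4-)
proof (induction k arbitrary: i rule: dec_induct)
  case base
  then show ?case using mid by simp
next
  case (step n)
  show ?case
  proof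
    assume "f (Suc n) i = C"
    then obtain j where j: "\<bar>j - i\<bar> \<le> int w" "f n j = C"
      using spread[of n i] step by blast
    consider "l \<le> j \<and> j \<le> u" | "l - int w \<le> j \<and> j < l" | "u < j \<and> j \<le> u + int w"
      using j step by linarith
    then show False
      using left[of j] right[of j] permanent_le[of K n j] step.IH[of j] step.hyps j(2) CD
      by cases auto
  qed
qed

text \<open>\<open>advance\<close> moves towards smaller positions only; reflection supplies the
  other direction.\<close>

lemma reflect:
  "line_growth (\<lambda>k i. f k (- i)) C D w tick clock"
proof
  fix k i
  assume "f (Suc k) (- i) = C" "f k (- i) \<noteq> C"
  then obtain j where "tick k" "\<bar>j - (- i)\<bar> \<le> int w" "f k j = C" using spread by blast
  then show "tick k \<and> (\<exists>j. \<bar>j - i\<bar> \<le> int w \<and> f k (- j) = C)"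
    by (intro conjI exI[of _ "- j"]) auto
next
  fix k j i
  assume "tick k" "f k (- j) = C" "\<bar>j - i\<bar> \<le> int w"
  then show "f (Suc k) (- i) \<noteq> Empty" using grow[of k "- j" "- i"] by simp
qed (use colour in \<open>simp_all add: CD permanent clock_0 clock_Suc\<close>)

end

section \<open>Rows and columns of the competition as growth on a line\<close>

lemma state_at_permanent:
  "state_at B R r \<omega> k x \<noteq> Empty \<Longrightarrow> state_at B R r \<omega> (Suc k) x = state_at B R r \<omega> k x"
  by (simp add: Let_def del: update_time.simps)

lemma state_at_becomes_Blue:
  "state_at B R r \<omega> (Suc k) x = Blue \<Longrightarrow> state_at B R r \<omega> k x \<noteq> Blue \<Longrightarrow>
    update_time r (Suc k) \<in> blue_times \<and> (\<exists>y\<in>B. state_at B R r \<omega> k (x + y) = Blue)"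
  by (auto simp: Let_def simp del: update_time.simps split: if_splits)

lemma state_at_becomes_Red:
  "state_at B R r \<omega> (Suc k) x = Red \<Longrightarrow> state_at B R r \<omega> k x \<noteq> Red \<Longrightarrow>
    update_time r (Suc k) \<in> red_times r \<and> (\<exists>y\<in>R. state_at B R r \<omega> k (x + y) = Red)"
  by (auto simp: Let_def simp del: update_time.simps split: if_splits)

lemma state_at_Suc_nonempty_blue:
  "update_time r (Suc k) \<in> blue_times \<Longrightarrow> y \<in> B \<Longrightarrow> state_at B R r \<omega> k (x + y) = Blue \<Longrightarrow>
    state_at B R r \<omega> (Suc k) x \<noteq> Empty"
  by (auto simp: Let_def simp del: update_time.simps)

lemma state_at_Suc_nonempty_red:
  "update_time r (Suc k) \<in> red_times r \<Longrightarrow> y \<in> R \<Longrightarrow> state_at B R r \<omega> k (x + y) = Red \<Longrightarrow>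
    state_at B R r \<omega> (Suc k) x \<noteq> Empty"
  by (auto simp: Let_def simp del: update_time.simps)

locale competition =
  fixes \<rho> \<tau> :: nat and r :: real
  assumes rho: "\<rho> \<ge> 1" and tau: "\<tau> \<ge> 1" and r: "r > 0"
begin

abbreviation st :: "(int \<times> int \<Rightarrow> vstate \<times> bool) \<Rightarrow> nat \<Rightarrow> int \<times> int \<Rightarrow> vstate" where
  "st \<equiv> state_at (blue_nbhd \<tau>) (red_nbhd \<rho>) r"

abbreviation blue_clock :: "nat \<Rightarrow> nat" where
  "blue_clock k \<equiv> nat \<lfloor>update_time r k\<rfloor>"

abbreviation red_clock :: "nat \<Rightarrow> nat" where
  "red_clock k \<equiv> nat \<lfloor>update_time r k / r\<rfloor>"

lemma row_growth:
  "line_growth (\<lambda>k i. st \<omega> k (i, y)) Blue Red \<tau> (\<lambda>k. update_time r (Suc k) \<in> blue_times) blue_clock"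
proof
  show "c = Blue" if "c \<noteq> Empty" "c \<noteq> Red" for c using that by (cases c) auto
  fix k i
  assume "st \<omega> (Suc k) (i, y) = Blue" "st \<omega> k (i, y) \<noteq> Blue"
  from state_at_becomes_Blue[OF this] obtain d where
    "update_time r (Suc k) \<in> blue_times" "d \<in> blue_nbhd \<tau>" "st \<omega> k ((i, y) + d) = Blue" by blast
  then show "update_time r (Suc k) \<in> blue_times \<and> (\<exists>j. \<bar>j - i\<bar> \<le> int \<tau> \<and> st \<omega> k (j, y) = Blue)"
    by (intro conjI exI[of _ "i + fst d"]) (auto simp: blue_nbhd_def simp del: update_time.simps)
next
  fix k i j
  assume "update_time r (Suc k) \<in> blue_times" "st \<omega> k (j, y) = Blue" "\<bar>j - i\<bar> \<le> int \<tau>"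
  then show "st \<omega> (Suc k) (i, y) \<noteq> Empty"
    by (intro state_at_Suc_nonempty_blue[where y = "(j - i, 0)"])
      (auto simp: blue_nbhd_def simp del: update_time.simps)
next
  show "blue_clock (Suc k) = blue_clock k + (if update_time r (Suc k) \<in> blue_times then 1 else 0)" for k
    using nat_floor_update_time_Suc[OF r, of 1 k] by (simp add: blue_times_eq del: update_time.simps)
qed (auto simp: state_at_permanent simp del: state_at.simps(2))

lemma column_growth:
  "line_growth (\<lambda>k i. st \<omega> k (c, i)) Red Blue \<rho> (\<lambda>k. update_time r (Suc k) \<in> red_times r) red_clock"
proof
  show "c = Red" if "c \<noteq> Empty" "c \<noteq> Blue" for c using that by (cases c) auto
  fix k i
  assume "st \<omega> (Suc k) (c, i) = Red" "st \<omega> k (c, i) \<noteq> Red"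
  from state_at_becomes_Red[OF this] obtain d where
    "update_time r (Suc k) \<in> red_times r" "d \<in> red_nbhd \<rho>" "st \<omega> k ((c, i) + d) = Red" by blast
  then show "update_time r (Suc k) \<in> red_times r \<and> (\<exists>j. \<bar>j - i\<bar> \<le> int \<rho> \<and> st \<omega> k (c, j) = Red)"
    by (intro conjI exI[of _ "i + snd d"]) (auto simp: red_nbhd_def simp del: update_time.simps)
next
  fix k i j
  assume "update_time r (Suc k) \<in> red_times r" "st \<omega> k (c, j) = Red" "\<bar>j - i\<bar> \<le> int \<rho>"
  then show "st \<omega> (Suc k) (c, i) \<noteq> Empty"
    by (intro state_at_Suc_nonempty_red[where y = "(0, j - i)"])
      (auto simp: red_nbhd_def simp del: update_time.simps)
next
  show "red_clock (Suc k) = red_clock k + (if update_time r (Suc k) \<in> red_times r then 1 else 0)" for k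
    using nat_floor_update_time_Suc[OF r r, of k] by (simp del: update_time.simps)
qed (auto simp: state_at_permanent simp del: state_at.simps(2))

lemma st_permanent_le: "k \<le> k' \<Longrightarrow> st \<omega> k x \<noteq> Empty \<Longrightarrow> st \<omega> k' x = st \<omega> k x"
  using line_growth.permanent_le[OF row_growth, of k k' \<omega> "fst x" "snd x"] by simp

lemma blue_step: "\<exists>k. update_time r k = real n"
proof (cases "n = 0")
  case True
  then show ?thesis by (intro exI[of _ 0]) simp
next
  case False
  then show ?thesis by (intro update_time_hits[OF r]) (auto simp: blue_times_def)
qed

lemma red_step: "\<exists>k. update_time r k = real n * r"
proof (cases "n = 0")
  case True
  then show ?thesis by (intro exI[of _ 0]) simp
next
  case False
  then show ?thesis by (intro update_time_hits[OF r]) (auto simp: red_times_def)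
qed

end

section \<open>Finitely many coordinates of an i.i.d. field\<close>

text \<open>One implication suffices since the premise is symmetric. For a finite alphabet, finite
  index sets give measurability (\<open>sets_field\<close>) and disjoint ones independence
  (\<open>prob_Int\<close>).\<close>

definition depends_on :: "'i set \<Rightarrow> ('i \<Rightarrow> 'a) set \<Rightarrow> bool" where
  "depends_on K E \<longleftrightarrow> (\<forall>\<omega> \<omega>'. (\<forall>x\<in>K. \<omega> x = \<omega>' x) \<longrightarrow> \<omega> \<in> E \<longrightarrow> \<omega>' \<in> E)"

lemma depends_onI:
  "(\<And>\<omega> \<omega>'. (\<And>x. x \<in> K \<Longrightarrow> \<omega> x = \<omega>' x) \<Longrightarrow> \<omega> \<in> E \<Longrightarrow> \<omega>' \<in> E) \<Longrightarrow> depends_on K E"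
  by (auto simp: depends_on_def)

lemma depends_onD:
  "depends_on K E \<Longrightarrow> (\<And>x. x \<in> K \<Longrightarrow> \<omega> x = \<omega>' x) \<Longrightarrow> \<omega> \<in> E \<longleftrightarrow> \<omega>' \<in> E"
  unfolding depends_on_def by metis

lemma depends_on_mono: "depends_on K E \<Longrightarrow> K \<subseteq> K' \<Longrightarrow> depends_on K' E"
  unfolding depends_on_def by blast

lemma depends_on_Compl: "depends_on K E \<Longrightarrow> depends_on K (- E)"
  by (intro depends_onI) (use depends_onD in blast)

lemma depends_on_Int: "depends_on K E \<Longrightarrow> depends_on K F \<Longrightarrow> depends_on K (E \<inter> F)"
  unfolding depends_on_def by blast

lemma depends_on_Un: "depends_on K E \<Longrightarrow> depends_on K F \<Longrightarrow> depends_on K (E \<union> F)"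
  unfolding depends_on_def by blast

lemma depends_on_UN:
  assumes "\<And>i. i \<in> I \<Longrightarrow> depends_on (K i) (E i)"
  shows "depends_on (\<Union>i\<in>I. K i) (\<Union>i\<in>I. E i)"
proof (rule depends_onI)
  fix \<omega> \<omega>' assume eq: "\<And>x. x \<in> (\<Union>i\<in>I. K i) \<Longrightarrow> \<omega> x = \<omega>' x" and "\<omega> \<in> (\<Union>i\<in>I. E i)"
  then obtain i where i: "i \<in> I" "\<omega> \<in> E i" by blast
  then have "\<omega>' \<in> E i" using depends_onD[OF assms[OF i(1)], of \<omega> \<omega>'] eq by blast
  with i show "\<omega>' \<in> (\<Union>i\<in>I. E i)" by blast
qed

lemma depends_on_INT:
  assumes "\<And>i. i \<in> I \<Longrightarrow> depends_on (K i) (E i)"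
  shows "depends_on (\<Union>i\<in>I. K i) (\<Inter>i\<in>I. E i)"
proof (intro depends_onI INT_I)
  fix \<omega> \<omega>' i
  assume eq: "\<And>x. x \<in> (\<Union>i\<in>I. K i) \<Longrightarrow> \<omega> x = \<omega>' x" and "\<omega> \<in> (\<Inter>i\<in>I. E i)" and i: "i \<in> I"
  then show "\<omega>' \<in> E i" using depends_onD[OF assms[OF i], of \<omega> \<omega>'] by blast
qed

locale finite_iid =
  fixes \<mu> :: "'a pmf" and I :: "'i itself"
  assumes fin: "finite (UNIV :: 'a set)"
begin

definition field :: "('i \<Rightarrow> 'a) measure" where
  "field = (\<Pi>\<^sub>M x\<in>UNIV. measure_pmf \<mu>)"

sublocale product_prob_space "\<lambda>_. measure_pmf \<mu>" "UNIV :: 'i set"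
  by unfold_locales

sublocale F: prob_space field
  unfolding field_def by unfold_locales

lemma space_field [simp]: "space field = UNIV"
  by (simp add: field_def space_PiM)

text \<open>A finite index set carries only finitely many configurations, so each set of them is a
  finite union of one-point boxes.\<close>

lemma sets_PiM_finite_index:
  assumes "finite K" "S \<subseteq> (\<Pi>\<^sub>E x\<in>K. UNIV)"
  shows "S \<in> sets (\<Pi>\<^sub>M x\<in>K. measure_pmf \<mu>)"
proof -
  have "S = (\<Union>f\<in>S. \<Pi>\<^sub>E x\<in>K. {f x})"
  proof (intro equalityI subsetI)
    fix g assume "g \<in> S"
    then show "g \<in> (\<Union>f\<in>S. \<Pi>\<^sub>E x\<in>K. {f x})" using assms(2) by (intro UN_I[of g]) auto
  next
    fix g assume "g \<in> (\<Union>f\<in>S. \<Pi>\<^sub>E x\<in>K. {f x})"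
    then obtain f where f: "f \<in> S" "g \<in> (\<Pi>\<^sub>E x\<in>K. {f x})" by blast
    moreover have "f \<in> (\<Pi>\<^sub>E x\<in>K. {f x})" using assms(2) f by auto
    ultimately have "g = f" by (intro PiE_ext) auto
    then show "g \<in> S" using f by simp
  qed
  moreover have "finite S"
    using finite_subset[OF assms(2)] finite_PiE[of K "\<lambda>_. UNIV :: 'a set"] assms(1) fin by blast
  ultimately show ?thesis
    using assms(1) by (metis (no_types, lifting) sets.finite_UN sets_PiM_I_finite UNIV_I sets_measure_pmf)
qed

lemma depends_on_vimage:
  assumes "depends_on K E"
  shows "E = (\<lambda>\<omega>. restrict \<omega> K) -` (E \<inter> (\<Pi>\<^sub>E x\<in>K. UNIV)) \<inter> space field"
proof -
  have "\<omega> \<in> E \<longleftrightarrow> restrict \<omega> K \<in> E" for \<omega>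
    by (rule depends_onD[OF assms]) simp
  then show ?thesis by auto
qed

lemma restrict_measurable: "(\<lambda>\<omega>. restrict \<omega> K) \<in> measurable field (\<Pi>\<^sub>M x\<in>K. measure_pmf \<mu>)"
  unfolding field_def by (rule measurable_restrict_subset) simp

lemma sets_field:
  assumes "finite K" "depends_on K E"
  shows "E \<in> sets field"
  by (subst depends_on_vimage[OF assms(2)], rule measurable_sets[OF restrict_measurable])
    (rule sets_PiM_finite_index[OF assms(1)], simp)

lemma indep_coordinates: "F.indep_vars (\<lambda>_. measure_pmf \<mu>) (\<lambda>x \<omega>. \<omega> x) (UNIV :: 'i set)"
proof -
  have rv: "(\<lambda>\<omega>. \<omega> x) \<in> measurable field (measure_pmf \<mu>)" for x
    unfolding field_def by (rule measurable_component_singleton) simp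
  have "distr field (measure_pmf \<mu>) (\<lambda>\<omega>. \<omega> x) = measure_pmf \<mu>" for x
    unfolding field_def by (rule PiM_component) simp
  moreover have "distr field (\<Pi>\<^sub>M i\<in>UNIV. measure_pmf \<mu>) (\<lambda>x. \<lambda>i\<in>UNIV. x i) = field"
    unfolding field_def by (simp add: distr_id2 restrict_def)
  ultimately show ?thesis
    by (subst F.indep_vars_iff_distr_eq_PiM) (use rv in \<open>auto simp: field_def\<close>)
qed

lemma prob_Int:
  assumes K: "finite K" "finite L" "K \<inter> L = {}" and E: "depends_on K E" and G: "depends_on L G"
  shows "F.prob (E \<inter> G) = F.prob E * F.prob G"
proof -
  let ?r = "\<lambda>K \<omega>. restrict \<omega> K"
  let ?E = "E \<inter> (\<Pi>\<^sub>E x\<in>K. UNIV)" and ?G = "G \<inter> (\<Pi>\<^sub>E x\<in>L. UNIV)"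
  have "F.indep_var (PiM K (\<lambda>_. measure_pmf \<mu>)) (?r K) (PiM L (\<lambda>_. measure_pmf \<mu>)) (?r L)"
    by (rule F.indep_var_restrict[OF indep_coordinates K(3)]) auto
  from F.indep_varD[OF this, of ?E ?G]
  have "F.prob ((\<lambda>\<omega>. (?r K \<omega>, ?r L \<omega>)) -` (?E \<times> ?G) \<inter> space field) =
      F.prob (?r K -` ?E \<inter> space field) * F.prob (?r L -` ?G \<inter> space field)"
    using sets_PiM_finite_index[OF K(1), of ?E] sets_PiM_finite_index[OF K(2), of ?G] by simp
  moreover have "(\<lambda>\<omega>. (?r K \<omega>, ?r L \<omega>)) -` (?E \<times> ?G) \<inter> space field =
      (?r K -` ?E \<inter> space field) \<inter> (?r L -` ?G \<inter> space field)" by auto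
  ultimately show ?thesis
    using depends_on_vimage[OF E] depends_on_vimage[OF G] by simp
qed

lemma prob_INT:
  assumes "finite J" "\<And>j. j \<in> J \<Longrightarrow> finite (K j)" "disjoint_family_on K J"
    and "\<And>j. j \<in> J \<Longrightarrow> depends_on (K j) (E j)"
  shows "F.prob (\<Inter>j\<in>J. E j) = (\<Prod>j\<in>J. F.prob (E j))"
  using assms
proof (induction J rule: finite_induct)
  case empty
  then show ?case using F.prob_space by simp
next
  case (insert j J)
  have *: "F.prob (E j \<inter> (\<Inter>j\<in>J. E j)) = F.prob (E j) * F.prob (\<Inter>j\<in>J. E j)"
  proof (rule prob_Int)
    show "depends_on (\<Union>j\<in>J. K j) (\<Inter>j\<in>J. E j)"
      by (rule depends_on_INT) (rule insert.prems(3), simp)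
    show "K j \<inter> (\<Union>j\<in>J. K j) = {}"
      using insert.prems(2) insert.hyps(2) by (auto simp: disjoint_family_on_def)
    show "depends_on (K j) (E j)" by (rule insert.prems(3)) simp
  qed (use insert.hyps insert.prems(1) in auto)
  moreover have "disjoint_family_on K J" using insert.prems(2) by (auto simp: disjoint_family_on_def)
  ultimately have "F.prob (\<Inter>j\<in>J. E j) = (\<Prod>j\<in>J. F.prob (E j))"
    using insert.IH insert.prems by simp
  with * show ?case using insert.hyps by simp
qed

lemma prob_coordinate: "F.prob {\<omega>. P (\<omega> x)} = measure_pmf.prob \<mu> {a. P a}"
proof -
  have rv: "(\<lambda>\<omega>. \<omega> x) \<in> measurable field (measure_pmf \<mu>)"
    unfolding field_def by (rule measurable_component_singleton) simp
  have "distr field (measure_pmf \<mu>) (\<lambda>\<omega>. \<omega> x) = measure_pmf \<mu>"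
    unfolding field_def by (rule PiM_component) simp
  then have "measure_pmf.prob \<mu> {a. P a} = measure (distr field (measure_pmf \<mu>) (\<lambda>\<omega>. \<omega> x)) {a. P a}"
    by simp
  also have "\<dots> = F.prob {\<omega>. P (\<omega> x)}"
    using rv by (subst measure_distr) (auto simp: vimage_def)
  finally show ?thesis by simp
qed

end

text \<open>Pointwise \<open>1{Z > 0} \<ge> 2 t Z - t\<^sup>2 Z\<^sup>2\<close> for \<open>Z\<close> the number of events that occur, with \<open>t\<close> the optimal
  ratio of the two moments.\<close>

lemma (in prob_space) second_moment:
  assumes "finite I" and G: "\<And>i. i \<in> I \<Longrightarrow> G i \<in> events"
    and m: "m \<le> (\<Sum>i\<in>I. prob (G i))" "m \<ge> 0"
    and s: "(\<Sum>i\<in>I. \<Sum>j\<in>I. prob (G i \<inter> G j)) \<le> s" "s > 0"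
  shows "prob (\<Union>i\<in>I. G i) \<ge> m\<^sup>2 / s"
proof -
  define t where "t = m / s"
  define Z where "Z \<omega> = (\<Sum>i\<in>I. indicator (G i) \<omega> :: real)" for \<omega>
  have Z2: "(Z \<omega>)\<^sup>2 = (\<Sum>i\<in>I. \<Sum>j\<in>I. indicator (G i \<inter> G j) \<omega>)" for \<omega>
    unfolding Z_def power2_eq_square sum_product by (simp add: indicator_inter_arith)
  have int: "integrable M (\<lambda>\<omega>. 2 * t * Z \<omega> - t\<^sup>2 * (Z \<omega>)\<^sup>2)"
    unfolding Z2 unfolding Z_def
    by (intro Bochner_Integration.integrable_diff Bochner_Integration.integrable_mult_right
        Bochner_Integration.integrable_sum integrable_real_indicator)
      (use G in \<open>auto simp: emeasure_eq_measure\<close>)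
  have EZ: "expectation Z = (\<Sum>i\<in>I. prob (G i))"
    unfolding Z_def using G by (subst Bochner_Integration.integral_sum) (auto simp: emeasure_eq_measure)
  have EZ2: "expectation (\<lambda>\<omega>. (Z \<omega>)\<^sup>2) = (\<Sum>i\<in>I. \<Sum>j\<in>I. prob (G i \<inter> G j))"
  proof -
    have GG: "integrable M (indicat_real (G i \<inter> G j))" if "i \<in> I" "j \<in> I" for i j
      using G that by (intro integrable_real_indicator) (auto simp: emeasure_eq_measure)
    have "expectation (\<lambda>\<omega>. (Z \<omega>)\<^sup>2) = (\<Sum>i\<in>I. \<Sum>j\<in>I. expectation (indicat_real (G i \<inter> G j)))"
      unfolding Z2 using GG by (simp add: Bochner_Integration.integral_sum)
    then show ?thesis using G by simp
  qed
  have i1: "integrable M Z" unfolding Z_def using G by (auto simp: emeasure_eq_measure)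
  have i2: "integrable M (\<lambda>\<omega>. (Z \<omega>)\<^sup>2)" unfolding Z2
    by (intro Bochner_Integration.integrable_sum integrable_real_indicator)
      (use G in \<open>auto simp: emeasure_eq_measure\<close>)
  have "expectation (\<lambda>\<omega>. 2 * t * Z \<omega> - t\<^sup>2 * (Z \<omega>)\<^sup>2) \<le> expectation (indicator (\<Union>i\<in>I. G i))"
  proof (intro integral_mono int)
    show "integrable M (indicator (\<Union>i\<in>I. G i) :: 'a \<Rightarrow> real)"
      using assms(1) G by (intro integrable_real_indicator sets.finite_UN) (auto simp: emeasure_eq_measure)
    fix \<omega>
    show "2 * t * Z \<omega> - t\<^sup>2 * (Z \<omega>)\<^sup>2 \<le> indicator (\<Union>i\<in>I. G i) \<omega>"
    proof (cases "\<omega> \<in> (\<Union>i\<in>I. G i)")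
      case True
      then show ?thesis
        using zero_le_power2[of "1 - t * Z \<omega>"] by (simp add: power2_diff power_mult_distrib)
    next
      case False
      then have "Z \<omega> = 0" unfolding Z_def by (intro sum.neutral) auto
      then show ?thesis by simp
    qed
  qed
  also have "expectation (\<lambda>\<omega>. 2 * t * Z \<omega> - t\<^sup>2 * (Z \<omega>)\<^sup>2) =
      2 * t * (\<Sum>i\<in>I. prob (G i)) - t\<^sup>2 * (\<Sum>i\<in>I. \<Sum>j\<in>I. prob (G i \<inter> G j))"
    using i1 i2 by (simp add: EZ EZ2)
  finally have "2 * t * (\<Sum>i\<in>I. prob (G i)) - t\<^sup>2 * (\<Sum>i\<in>I. \<Sum>j\<in>I. prob (G i \<inter> G j)) \<le> prob (\<Union>i\<in>I. G i)"
    using assms(1) G sets.sets_into_space[OF sets.finite_UN[OF assms(1) G]]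
    by (simp add: Int_absorb2)
  moreover have "2 * t * m \<le> 2 * t * (\<Sum>i\<in>I. prob (G i))"
    using m s by (intro mult_left_mono) (auto simp: t_def)
  moreover have "t\<^sup>2 * (\<Sum>i\<in>I. \<Sum>j\<in>I. prob (G i \<inter> G j)) \<le> t\<^sup>2 * s"
    using s by (intro mult_left_mono) auto
  moreover have "2 * t * m - t\<^sup>2 * s = m\<^sup>2 / s"
    using s by (simp add: t_def field_simps power2_eq_square)
  ultimately show ?thesis by linarith
qed

section \<open>The initial configuration\<close>

lemma (in finite_iid) prob_coordinates:
  assumes "finite S"
  shows "F.prob {\<omega>. \<forall>x\<in>S. Q x (\<omega> x)} = (\<Prod>x\<in>S. measure_pmf.prob \<mu> {a. Q x a})"
proof -
  have "{\<omega>. \<forall>x\<in>S. Q x (\<omega> x)} = (\<Inter>x\<in>S. {\<omega>. Q x (\<omega> x)})" by auto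
  also have "F.prob \<dots> = (\<Prod>x\<in>S. F.prob {\<omega>. Q x (\<omega> x)})"
    by (rule prob_INT[OF assms, of "\<lambda>x. {x}"])
      (auto simp: disjoint_family_on_def intro!: depends_onI)
  finally show ?thesis by (simp add: prob_coordinate)
qed

lemma depends_on_coordinates: "depends_on S {\<omega>. \<forall>x\<in>S. Q x (\<omega> x)}"
  by (intro depends_onI) auto

lemma depends_on_some_coordinate: "depends_on S {\<omega>. \<exists>x\<in>S. Q x (\<omega> x)}"
  by (intro depends_onI) auto

locale competition_field = competition +
  fixes p q :: real
  assumes p: "p \<ge> 0" and q: "q \<ge> 0" and pq: "p + q \<le> 1"
begin

sublocale finite_iid "pair_pmf (initial_pmf p q) (bernoulli_pmf (1/2))" "TYPE(int \<times> int)"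
proof
  have "finite (UNIV :: vstate set)" by (simp add: vstate_UNIV)
  then show "finite (UNIV :: (vstate \<times> bool) set)" by (simp add: finite_prod)
qed

lemma field_eq: "field = competition_measure p q"
  by (simp add: field_def competition_measure_def)

abbreviation \<nu> :: "(vstate \<times> bool) pmf" where
  "\<nu> \<equiv> pair_pmf (initial_pmf p q) (bernoulli_pmf (1/2))"

lemma measure_colour: "measure_pmf.prob \<nu> {a. fst a = c} = pmf (initial_pmf p q) c"
proof -
  have "measure_pmf.prob \<nu> {a. fst a = c} = measure_pmf.prob (map_pmf fst \<nu>) {c}"
    by (subst measure_map_pmf) (auto simp: vimage_def)
  then show ?thesis by (simp add: map_fst_pair_pmf measure_pmf_single)
qed

lemma measure_not_colour: "measure_pmf.prob \<nu> {a. fst a \<noteq> c} = 1 - pmf (initial_pmf p q) c"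
proof -
  have "{a. fst a \<noteq> c} = space (measure_pmf \<nu>) - {a. fst a = c}" by auto
  then show ?thesis
    using measure_pmf.prob_compl[of "{a. fst a = c}" \<nu>] measure_colour[of c] by simp
qed

lemma prob_all_Blue: "finite S \<Longrightarrow> F.prob {\<omega>. \<forall>x\<in>S. fst (\<omega> x) = Blue} = p ^ card S"
  by (subst prob_coordinates) (simp_all add: measure_colour pmf_initial_pmf p q pq)

lemma prob_Blue: "F.prob {\<omega>. fst (\<omega> x) = Blue} = p"
  using prob_all_Blue[of "{x}"] by simp

lemma prob_no_Blue: "finite S \<Longrightarrow> F.prob {\<omega>. \<forall>x\<in>S. fst (\<omega> x) \<noteq> Blue} = (1 - p) ^ card S"
  by (subst prob_coordinates) (simp_all add: measure_not_colour pmf_initial_pmf p q pq)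

lemma prob_no_Red: "finite S \<Longrightarrow> F.prob {\<omega>. \<forall>x\<in>S. fst (\<omega> x) \<noteq> Red} = (1 - q) ^ card S"
  by (subst prob_coordinates) (simp_all add: measure_not_colour pmf_initial_pmf p q pq)

lemma prob_Compl: "finite K \<Longrightarrow> depends_on K E \<Longrightarrow> F.prob (- E) = 1 - F.prob E"
  using F.prob_compl[OF sets_field] by (simp add: Compl_eq_Diff_UNIV)

lemma prob_some_Red:
  "finite S \<Longrightarrow> F.prob {\<omega>. \<exists>x\<in>S. fst (\<omega> x) = Red} = 1 - (1 - q) ^ card S"
  using prob_Compl[OF _ depends_on_coordinates, of S "\<lambda>x a. fst a \<noteq> Red"] prob_no_Red[of S]
  by (simp add: Compl_eq)

lemma prob_some_Blue:
  "finite S \<Longrightarrow> F.prob {\<omega>. \<exists>x\<in>S. fst (\<omega> x) = Blue} = 1 - (1 - p) ^ card S"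
  using prob_Compl[OF _ depends_on_coordinates, of S "\<lambda>x a. fst a \<noteq> Blue"] prob_no_Blue[of S]
  by (simp add: Compl_eq)

text \<open>This serves measurability only, so the size of \<open>K\<close> is not recorded.\<close>

lemma st_local: "\<exists>K. finite K \<and> (\<forall>\<omega> \<omega>'. (\<forall>z\<in>K. \<omega> z = \<omega>' z) \<longrightarrow> st \<omega> k x = st \<omega>' k x)"
proof (induction k arbitrary: x)
  case 0
  show ?case by (intro exI[of _ "{x}"]) simp
next
  case (Suc k)
  then obtain K where K: "\<And>x. finite (K x)"
    "\<And>x \<omega> \<omega>'. (\<forall>z\<in>K x. \<omega> z = \<omega>' z) \<Longrightarrow> st \<omega> k x = st \<omega>' k x" by metis
  let ?N = "blue_nbhd \<tau> \<union> red_nbhd \<rho>"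
  let ?K = "insert x (K x \<union> (\<Union>y\<in>?N. K (x + y)))"
  have "finite ?K" by (auto simp: K(1) blue_nbhd_def red_nbhd_def)
  moreover have "st \<omega> (Suc k) x = st \<omega>' (Suc k) x" if "\<forall>z\<in>?K. \<omega> z = \<omega>' z" for \<omega> \<omega>'
  proof -
    have "st \<omega> k x = st \<omega>' k x" "\<omega> x = \<omega>' x" using that K(2)[of x \<omega> \<omega>'] by auto
    moreover have "st \<omega> k (x + y) = st \<omega>' k (x + y)" if "y \<in> ?N" for y
      using \<open>\<forall>z\<in>?K. \<omega> z = \<omega>' z\<close> that by (intro K(2)) auto
    ultimately have "(\<exists>y\<in>blue_nbhd \<tau>. st \<omega> k (x + y) = Blue) = (\<exists>y\<in>blue_nbhd \<tau>. st \<omega>' k (x + y) = Blue)"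
      "(\<exists>y\<in>red_nbhd \<rho>. st \<omega> k (x + y) = Red) = (\<exists>y\<in>red_nbhd \<rho>. st \<omega>' k (x + y) = Red)"
      "st \<omega> k x = st \<omega>' k x" "\<omega> x = \<omega>' x" by auto
    then show ?thesis by (simp only: state_at.simps Let_def)
  qed
  ultimately show ?case by blast
qed

lemma st_event: "{\<omega>. st \<omega> k x = c} \<in> F.events"
proof -
  from st_local[of k x] obtain K where "finite K"
    and K: "\<And>\<omega> \<omega>'. (\<forall>z\<in>K. \<omega> z = \<omega>' z) \<Longrightarrow> st \<omega> k x = st \<omega>' k x" by blast
  have "depends_on K {\<omega>. st \<omega> k x = c}" using K by (intro depends_onI) (metis mem_Collect_eq)
  then show ?thesis using sets_field[OF \<open>finite K\<close>] by blast
qed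

lemma eventually_blue_iff:
  "eventually_blue (blue_nbhd \<tau>) (red_nbhd \<rho>) r \<omega> x \<longleftrightarrow> (\<exists>k. st \<omega> k x = Blue)"
proof
  assume "eventually_blue (blue_nbhd \<tau>) (red_nbhd \<rho>) r \<omega> x"
  then show "\<exists>k. st \<omega> k x = Blue"
    unfolding eventually_blue_def eventually_sequentially by blast
next
  assume "\<exists>k. st \<omega> k x = Blue"
  then obtain k where "st \<omega> k x = Blue" by blast
  then have "\<forall>k'\<ge>k. st \<omega> k' x = Blue" using st_permanent_le[of k _ \<omega> x] by simp
  then show "eventually_blue (blue_nbhd \<tau>) (red_nbhd \<rho>) r \<omega> x"
    unfolding eventually_blue_def eventually_sequentially by blast
qed

definition eventually_set :: "vstate \<Rightarrow> int \<times> int \<Rightarrow> (int \<times> int \<Rightarrow> vstate \<times> bool) set" where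
  "eventually_set c x = {\<omega>. \<exists>k. st \<omega> k x = c}"

lemma eventually_set_event: "eventually_set c x \<in> F.events"
proof -
  have "eventually_set c x = (\<Union>k. {\<omega>. st \<omega> k x = c})" by (auto simp: eventually_set_def)
  then show ?thesis using st_event by auto
qed

lemma prob_origin_blue_eq:
  "prob_origin_blue (blue_nbhd \<tau>) (red_nbhd \<rho>) r p q = F.prob (eventually_set Blue 0)"
proof -
  have "{\<omega> \<in> space (competition_measure p q). eventually_blue (blue_nbhd \<tau>) (red_nbhd \<rho>) r \<omega> 0} =
      eventually_set Blue 0"
    using space_field unfolding field_eq by (auto simp: eventually_blue_iff eventually_set_def)
  then show ?thesis by (simp add: prob_origin_blue_def field_eq)
qed

end

section \<open>Walls and obstructions in terms of the initial colours\<close>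

context competition
begin

text \<open>An upper bound, by initial colours alone, for being blue while blue has moved by at most
  \<open>n\<close>; see \<open>near_blue_if_blue\<close>.\<close>

definition near_blue :: "nat \<Rightarrow> (int \<times> int \<Rightarrow> vstate \<times> bool) \<Rightarrow> int \<times> int \<Rightarrow> bool" where
  "near_blue n \<omega> z \<longleftrightarrow> (\<exists>d. \<bar>d\<bar> \<le> int n \<and> fst (\<omega> (fst z + d, snd z)) = Blue)"

text \<open>Only \<open>\<rho>\<close> consecutive blue sites stop red in a column, and
  \<open>near_blue\<close> overestimates them. The sign \<open>s\<close> selects the half-plane; the
  runs start at row 1 or beyond, which keeps the event independent of row 0.\<close>

definition obstructed :: "int \<Rightarrow> nat \<Rightarrow> nat \<Rightarrow> (int \<times> int \<Rightarrow> vstate \<times> bool) \<Rightarrow> int \<Rightarrow> bool" where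
  "obstructed s H n \<omega> c \<longleftrightarrow>
    (\<exists>y\<in>{1..int H}. \<forall>i<\<rho>. near_blue n \<omega> (c, s * (y + int i)))"

lemma near_blue_if_blue:
  assumes "st \<omega> K (x, y) = Blue"
  shows "near_blue (\<tau> * blue_clock K) \<omega> (x, y)"
proof -
  from line_growth.speed_limit[OF row_growth, where i = x and k = K, OF assms]
  obtain j where "\<bar>j - x\<bar> \<le> int (\<tau> * blue_clock K)" "st \<omega> 0 (j, y) = Blue" by blast
  then show ?thesis unfolding near_blue_def by (intro exI[of _ "j - x"]) simp
qed

lemma column_growth_sgn:
  assumes "s \<in> {1, - 1}"
  shows "line_growth (\<lambda>k i. st \<omega> k (c, s * i)) Red Blue \<rho> (\<lambda>k. update_time r (Suc k) \<in> red_times r) red_clock"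
  using assms column_growth[of \<omega> c] line_growth.reflect[OF column_growth[of \<omega> c]] by auto

text \<open>\<open>H\<close> red ticks suffice to come from a seed at distance at most
  \<open>H\<close>, since \<open>advance\<close> yields one row per tick. The run that starts in row
  0 is not covered by \<open>obstructed\<close>; there the site in row 0 is itself the gap, by the
  last hypothesis.\<close>

lemma column_turns_red:
  assumes s: "s \<in> {1, - 1}" and K: "update_time r K = real H * r"
    and h: "1 \<le> h" "h \<le> int H" "fst (\<omega> (c, s * h)) = Red"
    and open_: "\<not> obstructed s H (\<tau> * blue_clock K) \<omega> c" and z: "st \<omega> K (c, 0) \<noteq> Blue"
  shows "st \<omega> K (c, 0) = Red"
proof -
  interpret line_growth "\<lambda>k i. st \<omega> k (c, s * i)" Red Blue \<rho>
    "\<lambda>k. update_time r (Suc k) \<in> red_times r" red_clock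
    by (rule column_growth_sgn[OF s])
  have "red_clock K = H" using K r by simp
  have "st \<omega> K (c, s * 0) = Red"
  proof (rule advance[OF rho, of h])
    fix a :: int assume a: "0 \<le> a" "a + int \<rho> \<le> h"
    show "\<exists>b\<ge>a. b < a + int \<rho> \<and> st \<omega> K (c, s * b) \<noteq> Blue"
    proof (cases "a = 0")
      case True
      then show ?thesis using z rho by (intro exI[of _ 0]) auto
    next
      case False
      then have "\<not> (\<forall>i<\<rho>. near_blue (\<tau> * blue_clock K) \<omega> (c, s * (a + int i)))"
        using open_ a h rho by (auto simp: obstructed_def)
      then obtain i where "i < \<rho>" "\<not> near_blue (\<tau> * blue_clock K) \<omega> (c, s * (a + int i))" by blast
      then show ?thesis using near_blue_if_blue by (intro exI[of _ "a + int i"]) auto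
    qed
  qed (use h z \<open>red_clock K = H\<close> in auto)
  then show ?thesis by simp
qed

text \<open>For \<open>s = - 1\<close> both coordinates are reflected: the wall right of the origin
  is fed from the rows above and the wall left of it from the rows below, so the two are
  independent.\<close>

definition red_wall :: "int \<Rightarrow> nat \<Rightarrow> nat \<Rightarrow> int \<Rightarrow> (int \<times> int \<Rightarrow> vstate \<times> bool) set" where
  "red_wall s H n x = {\<omega>. \<forall>i<\<tau>. (\<exists>h\<in>{1..int H}. fst (\<omega> (s * (x + int i), s * h)) = Red) \<and>
    \<not> obstructed s H n \<omega> (s * (x + int i))}"

text \<open>Everything is decided at time \<open>H * r\<close>. Until then blue moves by at most
  \<open>n\<close>, so without blue seeds up to distance \<open>M\<close> in row 0 the walls and the
  sites between them are free of blue, and the columns of the walls have turned red. From then on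
  \<open>wall\<close> applies.\<close>

lemma origin_shielded:
  fixes H M :: nat
  defines "n \<equiv> \<tau> * nat \<lfloor>real H * r\<rfloor>"
  assumes row: "\<And>i. \<bar>i\<bar> \<le> int M \<Longrightarrow> fst (\<omega> (i, 0)) \<noteq> Blue"
    and right: "\<omega> \<in> red_wall 1 H n x" "1 \<le> x" "x + int \<tau> + int n \<le> int M"
    and left: "\<omega> \<in> red_wall (- 1) H n x'" "1 \<le> x'" "x' + int \<tau> + int n \<le> int M"
  shows "st \<omega> k 0 \<noteq> Blue"
proof -
  from red_step[of H] obtain K where K: "update_time r K = real H * r" by blast
  have n: "n = \<tau> * blue_clock K" by (simp add: n_def K)
  have not_blue: "st \<omega> K (i, 0) \<noteq> Blue" if "\<bar>i\<bar> + int n \<le> int M" for i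
  proof
    assume "st \<omega> K (i, 0) = Blue"
    from near_blue_if_blue[OF this] obtain d where
      "\<bar>d\<bar> \<le> int n" "fst (\<omega> (i + d, 0)) = Blue" by (auto simp: near_blue_def n)
    then show False using row[of "i + d"] that by linarith
  qed
  have red: "st \<omega> K (s * (x + int i), 0) = Red"
    if "\<omega> \<in> red_wall s H n x" "1 \<le> x" "x + int \<tau> + int n \<le> int M" "s \<in> {1, - 1}" "i < \<tau>" for s x i
  proof -
    from that obtain h where h: "h \<in> {1..int H}" "fst (\<omega> (s * (x + int i), s * h)) = Red"
      "\<not> obstructed s H n \<omega> (s * (x + int i))" unfolding red_wall_def by blast
    have "st \<omega> K (s * (x + int i), 0) \<noteq> Blue"
      using that by (intro not_blue) (auto simp: abs_mult)
    then show ?thesis using h that K by (intro column_turns_red[of s K H h]) (auto simp: n)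
  qed
  interpret line_growth "\<lambda>k i. st \<omega> k (i, 0)" Blue Red \<tau>
    "\<lambda>k. update_time r (Suc k) \<in> blue_times" blue_clock
    by (rule row_growth)
  have late: "st \<omega> k (0, 0) \<noteq> Blue" if "K \<le> k" for k
  proof (rule wall[of "1 - x'" K "x - 1", OF _ _ _ that])
    fix b :: int
    assume "1 - x' - int \<tau> \<le> b" "b < 1 - x'"
    then show "st \<omega> K (b, 0) = Red"
      using red[OF left, of "nat (- b - x')"] by simp
  next
    fix b :: int
    assume "x - 1 < b" "b \<le> x - 1 + int \<tau>"
    then show "st \<omega> K (b, 0) = Red"
      using red[OF right, of "nat (b - x)"] by simp
  next
    fix b :: int
    assume "1 - x' \<le> b" "b \<le> x - 1"
    then show "st \<omega> K (b, 0) \<noteq> Blue" using left right by (intro not_blue) auto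
  qed (use left right in auto)
  show ?thesis
  proof
    assume "st \<omega> k 0 = Blue"
    then have "st \<omega> (max k K) (0, 0) = Blue"
      using st_permanent_le[of k "max k K" \<omega> 0] by (simp add: zero_prod_def)
    then show False using late[of "max k K"] by simp
  qed
qed

end

section \<open>Red walls around the origin\<close>

context competition_field
begin

text \<open>A negative correlation inequality. Recolouring \<open>S\<close> blue turns
  \<open>E\<close> into an event that ignores \<open>S\<close>. Nothing is lost if \<open>S\<close>
  is blue already, and since recolouring only removes red sites, the new event is contained in
  \<open>E\<close>.\<close>

lemma prob_red_increasing_Int_all_Blue:
  assumes K: "finite K" "depends_on K E"
    and mono: "\<And>\<omega> \<omega>'. \<omega> \<in> E \<Longrightarrow> (\<And>x. fst (\<omega> x) = Red \<Longrightarrow> fst (\<omega>' x) = Red) \<Longrightarrow> \<omega>' \<in> E"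
    and S: "finite S"
  shows "F.prob (E \<inter> {\<omega>. \<forall>z\<in>S. fst (\<omega> z) = Blue}) \<le> F.prob E * p ^ card S"
proof -
  let ?B = "{\<omega>. \<forall>z\<in>S. fst (\<omega> z) = Blue}"
  define E' where "E' = {\<omega>. (\<lambda>x. if x \<in> S then (Blue, False) else \<omega> x) \<in> E}"
  have dE': "depends_on (K - S) E'"
  proof (rule depends_onI)
    fix \<omega> \<omega>' assume eq: "\<And>x. x \<in> K - S \<Longrightarrow> \<omega> x = \<omega>' x" and "\<omega> \<in> E'"
    then show "\<omega>' \<in> E'"
      unfolding E'_def mem_Collect_eq by (subst (asm) depends_onD[OF K(2)]) auto
  qed
  have E: "E \<in> F.events" "E' \<in> F.events" "?B \<in> F.events"
    using sets_field[OF K] sets_field[OF _ dE'] K(1) sets_field[OF S depends_on_coordinates] by auto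
  have "E \<inter> ?B \<subseteq> E' \<inter> ?B"
    unfolding E'_def by (auto elim!: mono)
  then have "F.prob (E \<inter> ?B) \<le> F.prob (E' \<inter> ?B)"
    using E by (intro F.finite_measure_mono) auto
  also have "\<dots> = F.prob E' * F.prob ?B"
    using K S by (intro prob_Int[OF _ _ _ dE' depends_on_coordinates]) auto
  also have "\<dots> \<le> F.prob E * p ^ card S"
  proof -
    have "E' \<subseteq> E" unfolding E'_def by (auto elim!: mono split: if_splits)
    then have "F.prob E' \<le> F.prob E" using E by (intro F.finite_measure_mono)
    then show ?thesis using prob_all_Blue[OF S] p by (simp add: mult_right_mono)
  qed
  finally show ?thesis .
qed

definition seeded :: "int \<Rightarrow> nat \<Rightarrow> int set \<Rightarrow> (int \<times> int \<Rightarrow> vstate \<times> bool) set" where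
  "seeded s H A = {\<omega>. \<forall>c\<in>A. \<exists>h\<in>{1..int H}. fst (\<omega> (s * c, s * h)) = Red}"

lemma depends_on_seeded: "depends_on ((\<lambda>(c, h). (s * c, s * h)) ` (A \<times> {1..int H})) (seeded s H A)"
  unfolding seeded_def
proof (intro depends_onI CollectI ballI)
  fix \<omega> \<omega>' c
  assume eq: "\<And>x. x \<in> (\<lambda>(c, h). (s * c, s * h)) ` (A \<times> {1..int H}) \<Longrightarrow> \<omega> x = \<omega>' x"
    and "\<omega> \<in> {\<omega>. \<forall>c\<in>A. \<exists>h\<in>{1..int H}. fst (\<omega> (s * c, s * h)) = Red}" and c: "c \<in> A"
  then obtain h where h: "h \<in> {1..int H}" "fst (\<omega> (s * c, s * h)) = Red" by blast
  moreover have "\<omega> (s * c, s * h) = \<omega>' (s * c, s * h)" using c h by (intro eq) auto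
  ultimately show "\<exists>h\<in>{1..int H}. fst (\<omega>' (s * c, s * h)) = Red" by auto
qed

lemma prob_seeded:
  assumes "finite A" and s: "s \<in> {1, - 1}"
  shows "F.prob (seeded s H A) = (1 - (1 - q) ^ H) ^ card A"
proof -
  let ?K = "\<lambda>c. (\<lambda>(c, h). (s * c, s * h)) ` ({c} \<times> {1..int H})"
  have "seeded s H A = (\<Inter>c\<in>A. seeded s H {c})" by (auto simp: seeded_def)
  also have "F.prob \<dots> = (\<Prod>c\<in>A. F.prob (seeded s H {c}))"
    by (rule prob_INT[OF assms(1), of ?K])
      (use s depends_on_seeded in \<open>auto simp: disjoint_family_on_def\<close>)
  also have "\<dots> = (\<Prod>c\<in>A. 1 - (1 - q) ^ H)"
  proof (rule prod.cong)
    fix c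
    have "seeded s H {c} = {\<omega>. \<exists>x\<in>?K c. fst (\<omega> x) = Red}" by (auto simp: seeded_def)
    moreover have "card (?K c) = H"
      using s by (subst card_image) (auto simp: inj_on_def card_cartesian_product)
    ultimately show "F.prob (seeded s H {c}) = 1 - (1 - q) ^ H"
      using prob_some_Red[of "?K c"] by (simp del: bex_simps)
  qed simp
  finally show ?thesis by simp
qed

text \<open>An event increasing in red minus conditions on blue: the form to which the correlation
  inequality applies.\<close>

lemma red_wall_eq:
  "red_wall s H n x = seeded s H {x..<x + int \<tau>} - (\<Union>c\<in>{x..<x + int \<tau>}. {\<omega>. obstructed s H n \<omega> (s * c)})"
proof -
  have "(\<forall>i<\<tau>. P (x + int i)) \<longleftrightarrow> (\<forall>c\<in>{x..<x + int \<tau>}. P c)" for P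
  proof
    assume *: "\<forall>i<\<tau>. P (x + int i)"
    show "\<forall>c\<in>{x..<x + int \<tau>}. P c"
    proof
      fix c assume "c \<in> {x..<x + int \<tau>}"
      then show "P c" using *[rule_format, of "nat (c - x)"] by (simp add: nat_less_iff)
    qed
  qed simp
  from this[of "\<lambda>c. (\<exists>h\<in>{1..int H}. fst (_ (s * c, s * h)) = Red) \<and> \<not> obstructed s H n _ (s * c)"]
  show ?thesis unfolding red_wall_def seeded_def by auto
qed

lemma depends_on_obstructed:
  "depends_on ({c - int n..c + int n} \<times> (\<lambda>h. s * h) ` {1..int (H + \<rho>)}) {\<omega>. obstructed s H n \<omega> c}"
proof (intro depends_onI)
  fix \<omega> \<omega>'
  assume eq: "\<And>x. x \<in> {c - int n..c + int n} \<times> (\<lambda>h. s * h) ` {1..int (H + \<rho>)} \<Longrightarrow> \<omega> x = \<omega>' x"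
    and "\<omega> \<in> {\<omega>. obstructed s H n \<omega> c}"
  then obtain y where y: "y \<in> {1..int H}" "\<And>i. i < \<rho> \<Longrightarrow> near_blue n \<omega> (c, s * (y + int i))"
    by (auto simp: obstructed_def)
  have "near_blue n \<omega>' (c, s * (y + int i))" if i: "i < \<rho>" for i
  proof -
    from y(2)[OF i] obtain d where d: "\<bar>d\<bar> \<le> int n" "fst (\<omega> (c + d, s * (y + int i))) = Blue"
      by (auto simp: near_blue_def)
    moreover have "\<omega> (c + d, s * (y + int i)) = \<omega>' (c + d, s * (y + int i))"
      using d y(1) i by (intro eq) auto
    ultimately show ?thesis by (auto simp: near_blue_def)
  qed
  then show "\<omega>' \<in> {\<omega>. obstructed s H n \<omega> c}"
    using y(1) unfolding obstructed_def mem_Collect_eq by blast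
qed

lemma obstructed_event: "{\<omega>. obstructed s H n \<omega> c} \<in> F.events"
  by (rule sets_field[OF _ depends_on_obstructed]) simp

lemma seeded_event: "finite A \<Longrightarrow> seeded s H A \<in> F.events"
  by (rule sets_field[OF _ depends_on_seeded]) simp

lemma red_wall_event: "red_wall s H n x \<in> F.events"
  unfolding red_wall_eq using obstructed_event seeded_event by (intro sets.Diff sets.finite_UN) auto

text \<open>Union bound over the first row of the run and the horizontal offsets of its
  \<open>\<rho>\<close> blue seeds, each choice costing \<open>p ^ \<rho>\<close>. The factor in
  front must be the small probability of the red seeds. Red and blue seeds may compete for the same
  sites, so it comes from negative correlation and not from independence.\<close>

lemma prob_seeded_obstructed:
  assumes A: "finite A" and s: "s \<in> {1, - 1}"
  shows "F.prob (seeded s H A \<inter> {\<omega>. obstructed s H n \<omega> c}) \<le>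
    F.prob (seeded s H A) * (real H * (real (2 * n + 1) * p) ^ \<rho>)"
proof -
  let ?D = "{..<\<rho>} \<rightarrow>\<^sub>E {- int n..int n}"
  let ?S = "\<lambda>y d. (\<lambda>i. (c + d i, s * (y + int i))) ` {..<\<rho>}"
  let ?B = "\<lambda>y d. {\<omega>. \<forall>z\<in>?S y d. fst (\<omega> z) = Blue}"
  have fD: "finite ?D" by (intro finite_PiE) auto
  have cD: "real (card ?D) = real (2 * n + 1) ^ \<rho>"
    by (simp add: card_PiE nat_add_distrib algebra_simps)
  have sub: "{\<omega>. obstructed s H n \<omega> c} \<subseteq> (\<Union>y\<in>{1..int H}. \<Union>d\<in>?D. ?B y d)"
  proof
    fix \<omega> assume "\<omega> \<in> {\<omega>. obstructed s H n \<omega> c}"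
    then obtain y where y: "y \<in> {1..int H}" "\<forall>i<\<rho>. near_blue n \<omega> (c, s * (y + int i))"
      by (auto simp: obstructed_def)
    then have "\<forall>i. \<exists>d. i < \<rho> \<longrightarrow> \<bar>d\<bar> \<le> int n \<and> fst (\<omega> (c + d, s * (y + int i))) = Blue"
      by (simp add: near_blue_def)
    then obtain d where d: "\<And>i. i < \<rho> \<Longrightarrow> \<bar>d i\<bar> \<le> int n \<and> fst (\<omega> (c + d i, s * (y + int i))) = Blue"
      by metis
    have "restrict d {..<\<rho>} \<in> ?D" using d by (auto simp: abs_le_iff minus_le_iff)
    moreover have "\<omega> \<in> ?B y (restrict d {..<\<rho>})" using d by auto
    ultimately show "\<omega> \<in> (\<Union>y\<in>{1..int H}. \<Union>d\<in>?D. ?B y d)" using y(1) by blast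
  qed
  have B: "?B y d \<in> F.events" for y d by (rule sets_field[OF _ depends_on_coordinates]) simp
  have S: "seeded s H A \<in> F.events" by (rule seeded_event[OF A])
  have each: "F.prob (seeded s H A \<inter> ?B y d) \<le> F.prob (seeded s H A) * p ^ \<rho>" for y d
  proof -
    have "card (?S y d) = \<rho>" using s by (subst card_image) (auto simp: inj_on_def)
    moreover have "F.prob (seeded s H A \<inter> ?B y d) \<le> F.prob (seeded s H A) * p ^ card (?S y d)"
    proof (rule prob_red_increasing_Int_all_Blue[OF _ depends_on_seeded])
      fix \<omega> \<omega>' :: "int \<times> int \<Rightarrow> vstate \<times> bool"
      assume "\<omega> \<in> seeded s H A" and "\<And>x. fst (\<omega> x) = Red \<Longrightarrow> fst (\<omega>' x) = Red"
      then show "\<omega>' \<in> seeded s H A" unfolding seeded_def by blast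
    qed (use A in auto)
    ultimately show ?thesis by simp
  qed
  have "F.prob (seeded s H A \<inter> {\<omega>. obstructed s H n \<omega> c}) \<le>
      F.prob (\<Union>y\<in>{1..int H}. \<Union>d\<in>?D. seeded s H A \<inter> ?B y d)"
    using sub S B fD by (intro F.finite_measure_mono sets.finite_UN) auto
  also have "\<dots> \<le> (\<Sum>y\<in>{1..int H}. F.prob (\<Union>d\<in>?D. seeded s H A \<inter> ?B y d))"
    using S B fD by (intro F.finite_measure_subadditive_finite) (auto intro!: sets.finite_UN)
  also have "\<dots> \<le> (\<Sum>y\<in>{1..int H}. \<Sum>d\<in>?D. F.prob (seeded s H A \<inter> ?B y d))"
    using S B fD by (intro sum_mono F.finite_measure_subadditive_finite) auto
  also have "\<dots> \<le> (\<Sum>y\<in>{1..int H}. \<Sum>d\<in>?D. F.prob (seeded s H A) * p ^ \<rho>)"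
    by (intro sum_mono each)
  also have "\<dots> = F.prob (seeded s H A) * (real H * (real (2 * n + 1) * p) ^ \<rho>)"
    by (simp only: sum_constant cD) (simp add: power_mult_distrib)
  finally show ?thesis .
qed

lemma prob_red_wall:
  assumes s: "s \<in> {1, - 1}"
  shows "F.prob (red_wall s H n x) \<ge>
    (1 - (1 - q) ^ H) ^ \<tau> * (1 - real \<tau> * real H * (real (2 * n + 1) * p) ^ \<rho>)"
proof -
  let ?A = "{x..<x + int \<tau>}"
  let ?I = "seeded s H ?A"
  let ?O = "\<Union>c\<in>?A. ?I \<inter> {\<omega>. obstructed s H n \<omega> (s * c)}"
  have I: "F.prob ?I = (1 - (1 - q) ^ H) ^ \<tau>" by (simp add: prob_seeded[OF _ s])
  have ev: "?I \<in> F.events" "\<And>c. ?I \<inter> {\<omega>. obstructed s H n \<omega> (s * c)} \<in> F.events"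
    using seeded_event obstructed_event by auto
  then have evO: "?O \<in> F.events" by (intro sets.finite_UN) auto
  have "F.prob ?O \<le> (\<Sum>c\<in>?A. F.prob (?I \<inter> {\<omega>. obstructed s H n \<omega> (s * c)}))"
    using ev by (intro F.finite_measure_subadditive_finite) auto
  also have "\<dots> \<le> (\<Sum>c\<in>?A. F.prob ?I * (real H * (real (2 * n + 1) * p) ^ \<rho>))"
    by (intro sum_mono prob_seeded_obstructed[OF _ s]) simp
  also have "\<dots> = F.prob ?I * (real \<tau> * real H * (real (2 * n + 1) * p) ^ \<rho>)" by simp
  finally have "F.prob ?O \<le> \<dots>" .
  moreover have "F.prob (red_wall s H n x) = F.prob ?I - F.prob ?O"
  proof -
    have "red_wall s H n x = ?I - ?O" unfolding red_wall_eq by auto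
    then show ?thesis using ev(1) evO F.finite_measure_Diff[of ?I ?O] by auto
  qed
  ultimately show ?thesis by (simp add: I algebra_simps)
qed

text \<open>The walls of the columns \<open>1 + \<tau> j, \<dots>, \<tau> + \<tau> j\<close> need disjoint sets of seeds, so the
  seeds alone already control the second moment.\<close>

lemma prob_some_red_wall:
  fixes X H n :: nat
  defines "\<sigma> \<equiv> 1 - (1 - q) ^ H" and "\<kappa> \<equiv> real \<tau> * real H * (real (2 * n + 1) * p) ^ \<rho>"
  defines "e \<equiv> real X * \<sigma> ^ \<tau>"
  assumes s: "s \<in> {1, - 1}" and k: "\<kappa> \<le> 1" and e: "e > 0"
  shows "F.prob (\<Union>j<X. red_wall s H n (1 + int \<tau> * int j)) \<ge> (1 - \<kappa>)\<^sup>2 * (e / (1 + e))"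
proof -
  let ?x = "\<lambda>j. 1 + int \<tau> * int j"
  let ?A = "\<lambda>j. {?x j..<?x j + int \<tau>}"
  have disj: "?A i \<inter> ?A j = {}" if "i \<noteq> j" for i j
  proof -
    have aux: "?x i + int \<tau> \<le> ?x j" if "i < j" for i j
    proof -
      have "int \<tau> * int (Suc i) \<le> int \<tau> * int j" using that by (intro mult_left_mono) auto
      then show ?thesis by (simp add: algebra_simps)
    qed
    from that have "i < j \<or> j < i" by auto
    then show ?thesis using aux[of i j] aux[of j i] by auto
  qed
  have pair: "F.prob (red_wall s H n (?x i) \<inter> red_wall s H n (?x j)) \<le> (if i = j then \<sigma> ^ \<tau> else (\<sigma> ^ \<tau>)\<^sup>2)" for i j
  proof -
    have "red_wall s H n (?x i) \<inter> red_wall s H n (?x j) \<subseteq> seeded s H (?A i \<union> ?A j)"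
      unfolding red_wall_eq by (auto simp: seeded_def)
    then have "F.prob (red_wall s H n (?x i) \<inter> red_wall s H n (?x j)) \<le> F.prob (seeded s H (?A i \<union> ?A j))"
      using seeded_event by (intro F.finite_measure_mono) auto
    also have "\<dots> = \<sigma> ^ card (?A i \<union> ?A j)" unfolding \<sigma>_def by (rule prob_seeded[OF _ s]) simp
    also have "\<dots> = (if i = j then \<sigma> ^ \<tau> else (\<sigma> ^ \<tau>)\<^sup>2)"
      using disj[of i j] by (simp add: card_Un_disjoint power2_eq_square power_add)
    finally show ?thesis .
  qed
  have st: "\<sigma> ^ \<tau> \<ge> 0" using q pq p by (simp add: \<sigma>_def power_le_one)
  have sum: "(\<Sum>i<X. \<Sum>j<X. F.prob (red_wall s H n (?x i) \<inter> red_wall s H n (?x j))) \<le> e + e\<^sup>2"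
  proof -
    have "(\<Sum>i<X. \<Sum>j<X. F.prob (red_wall s H n (?x i) \<inter> red_wall s H n (?x j))) \<le>
        (\<Sum>i<X. \<Sum>j<X. (if i = j then \<sigma> ^ \<tau> else 0) + (\<sigma> ^ \<tau>)\<^sup>2)"
      using st by (intro sum_mono order.trans[OF pair]) auto
    also have "\<dots> = e + e\<^sup>2"
      by (simp add: sum.distrib e_def power2_eq_square algebra_simps)
    finally show ?thesis .
  qed
  have "F.prob (\<Union>j<X. red_wall s H n (?x j)) \<ge> (e * (1 - \<kappa>))\<^sup>2 / (e + e\<^sup>2)"
  proof (rule F.second_moment)
    have "(\<Sum>j<X. \<sigma> ^ \<tau> * (1 - \<kappa>)) \<le> (\<Sum>j<X. F.prob (red_wall s H n (?x j)))"
      unfolding \<sigma>_def \<kappa>_def by (intro sum_mono prob_red_wall s)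
    then show "e * (1 - \<kappa>) \<le> (\<Sum>j<X. F.prob (red_wall s H n (?x j)))" by (simp add: e_def)
  qed (use sum k e red_wall_event in \<open>auto intro: add_pos_nonneg\<close>)
  also have "(e * (1 - \<kappa>))\<^sup>2 / (e + e\<^sup>2) = (1 - \<kappa>)\<^sup>2 * (e / (1 + e))"
  proof -
    have "e + e\<^sup>2 = e * (1 + e)" by (simp add: power2_eq_square algebra_simps)
    then show ?thesis using e by (simp add: power_mult_distrib power2_eq_square)
  qed
  finally show ?thesis .
qed

lemma depends_on_red_wall:
  assumes s: "s \<in> {1, - 1}" and x: "1 \<le> x" "x + int \<tau> + int n \<le> int M"
  shows "depends_on ({- int M..int M} \<times> (\<lambda>h. s * h) ` {1..int (H + \<rho>)}) (red_wall s H n x)"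
    (is "depends_on ?K _")
proof -
  let ?A = "{x..<x + int \<tau>}"
  have "depends_on ?K (seeded s H ?A)"
    by (rule depends_on_mono[OF depends_on_seeded]) (use s x in auto)
  moreover have "depends_on ?K (\<Union>c\<in>?A. {\<omega>. obstructed s H n \<omega> (s * c)})"
  proof (rule depends_on_mono[OF depends_on_UN[OF depends_on_obstructed]])
    show "(\<Union>c\<in>?A. {s * c - int n..s * c + int n} \<times> (\<lambda>h. s * h) ` {1..int (H + \<rho>)}) \<subseteq> ?K"
      using s x by auto
  qed
  ultimately show ?thesis
    unfolding red_wall_eq Diff_eq by (intro depends_on_Int depends_on_Compl)
qed

text \<open>A row without blue seeds, a wall on the right and a wall on the left depend on row 0, on
  the rows above it and on the rows below it, so their probabilities multiply. The condition on
  \<open>M\<close> makes room for the \<open>X\<close> candidate walls and for the distance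
  \<open>n\<close> that blue may cover before they are complete.\<close>

lemma prob_origin_not_blue:
  fixes X H M :: nat
  defines "n \<equiv> \<tau> * nat \<lfloor>real H * r\<rfloor>"
  defines "\<kappa> \<equiv> real \<tau> * real H * (real (2 * n + 1) * p) ^ \<rho>"
    and "e \<equiv> real X * (1 - (1 - q) ^ H) ^ \<tau>"
  assumes k: "\<kappa> \<le> 1" and e: "e > 0" and M: "1 + \<tau> * X + n \<le> M"
  shows "F.prob (eventually_set Blue 0) \<le> 1 - (1 - p) ^ (2 * M + 1) * ((1 - \<kappa>)\<^sup>2 * (e / (1 + e)))\<^sup>2"
proof -
  define R where "R = {\<omega> :: int \<times> int \<Rightarrow> vstate \<times> bool. \<forall>z\<in>{- int M..int M} \<times> {0}. fst (\<omega> z) \<noteq> Blue}"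
  define W where "W s = (\<Union>j<X. red_wall s H n (1 + int \<tau> * int j))" for s
  let ?K = "\<lambda>s. {- int M..int M} \<times> (\<lambda>h. s * h) ` {1..int (H + \<rho>)}"
  have x: "1 + int \<tau> * int j + int \<tau> + int n \<le> int M" if "j < X" for j
  proof -
    have "\<tau> * Suc j \<le> \<tau> * X" using that by (intro mult_left_mono) auto
    then have "1 + \<tau> * j + \<tau> + n \<le> M" using M by simp
    then show ?thesis by (simp flip: of_nat_mult of_nat_add of_nat_Suc)
  qed
  have dW: "depends_on (?K s) (W s)" if "s \<in> {1, - 1}" for s
  proof -
    have "depends_on (\<Union>j\<in>{..<X}. ?K s) (W s)"
      unfolding W_def by (intro depends_on_UN depends_on_red_wall that) (use x in auto)
    then show ?thesis by (rule depends_on_mono) auto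
  qed
  have dR: "depends_on ({- int M..int M} \<times> {0}) R"
    unfolding R_def by (rule depends_on_coordinates)
  have lower: "F.prob (W s) \<ge> (1 - \<kappa>)\<^sup>2 * (e / (1 + e))" if "s \<in> {1, - 1}" for s
    unfolding W_def \<kappa>_def e_def
    by (rule prob_some_red_wall) (use that k e in \<open>simp_all add: \<kappa>_def e_def\<close>)
  have PR: "F.prob R = (1 - p) ^ (2 * M + 1)"
    unfolding R_def by (subst prob_no_Blue) (auto simp: card_cartesian_product nat_add_distrib nat_mult_distrib)
  have evs: "R \<in> F.events" "W s \<in> F.events" for s
    using sets_field[OF _ dR] red_wall_event unfolding W_def by (auto intro!: sets.finite_UN)
  have "F.prob (R \<inter> (W 1 \<inter> W (- 1))) = F.prob R * F.prob (W 1 \<inter> W (- 1))"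
  proof (rule prob_Int[OF _ _ _ dR])
    show "depends_on (?K 1 \<union> ?K (- 1)) (W 1 \<inter> W (- 1))"
      by (intro depends_on_Int depends_on_mono[OF dW[of 1]] depends_on_mono[OF dW[of "- 1"]]) auto
  qed auto
  also have "F.prob (W 1 \<inter> W (- 1)) = F.prob (W 1) * F.prob (W (- 1))"
    by (rule prob_Int[OF _ _ _ dW dW]) auto
  also have "F.prob R * (F.prob (W 1) * F.prob (W (- 1))) \<ge>
      (1 - p) ^ (2 * M + 1) * ((1 - \<kappa>)\<^sup>2 * (e / (1 + e)))\<^sup>2"
    unfolding PR power2_eq_square[of "(1 - \<kappa>)\<^sup>2 * (e / (1 + e))"]
    using lower[of 1] lower[of "- 1"] p q pq e
    by (intro mult_left_mono mult_mono) auto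
  finally have *: "(1 - p) ^ (2 * M + 1) * ((1 - \<kappa>)\<^sup>2 * (e / (1 + e)))\<^sup>2 \<le> F.prob (R \<inter> (W 1 \<inter> W (- 1)))" .
  have "eventually_set Blue 0 \<inter> (R \<inter> (W 1 \<inter> W (- 1))) = {}"
  proof -
    have "st \<omega> k 0 \<noteq> Blue" if R: "\<omega> \<in> R" and W: "\<omega> \<in> W 1" "\<omega> \<in> W (- 1)" for \<omega> k
    proof -
      from W obtain i j where ij: "i < X" "\<omega> \<in> red_wall 1 H n (1 + int \<tau> * int i)"
        "j < X" "\<omega> \<in> red_wall (- 1) H n (1 + int \<tau> * int j)" by (auto simp: W_def)
      show ?thesis
        by (rule origin_shielded[OF _ ij(2)[unfolded n_def] _ _ ij(4)[unfolded n_def], of M])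
          (use R x ij in \<open>auto simp: R_def n_def abs_le_iff\<close>)
    qed
    then show ?thesis by (auto simp: eventually_set_def)
  qed
  then have "F.prob (eventually_set Blue 0) + F.prob (R \<inter> (W 1 \<inter> W (- 1))) =
      F.prob (eventually_set Blue 0 \<union> (R \<inter> (W 1 \<inter> W (- 1))))"
    using evs eventually_set_event by (intro F.finite_measure_Union[symmetric]) auto
  also have "\<dots> \<le> 1" by (rule F.prob_le_1)
  finally show ?thesis using * by simp
qed

end

section \<open>Red from remote seeds\<close>

context competition
begin

definition red_seed :: "(int \<times> int \<Rightarrow> vstate \<times> bool) \<Rightarrow> int set \<Rightarrow> int \<Rightarrow> bool" where
  "red_seed \<omega> I c \<longleftrightarrow> (\<exists>h\<in>I. fst (\<omega> (c, h)) = Red)"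

text \<open>The \<open>H\<close> rows from \<open>y\<close> on are cut into disjoint, hence
  independent, blocks of \<open>\<rho>\<close> rows. Outside this event some block has a blue seed
  in each of its rows, which is what a barrier for red needs.\<close>

definition porous :: "int \<Rightarrow> nat \<Rightarrow> nat \<Rightarrow> int \<Rightarrow> (int \<times> int \<Rightarrow> vstate \<times> bool) set" where
  "porous e D H y = {\<omega>. \<forall>j<H div \<rho>. \<exists>i<\<rho>. \<forall>d\<in>{0..int D}. fst (\<omega> (e + d, y + int (\<rho> * j + i))) \<noteq> Blue}"

text \<open>Red seeds within \<open>H\<close> rows of the layer can matter. A run of
  \<open>\<tau>\<close> columns that stops blue is either listed, if it starts beyond
  \<open>e\<close>, or contains column \<open>e\<close>, and then only the seed of that column is
  kept. So no column left of \<open>e\<close> enters, and the event is independent of the seeds in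
  the \<open>\<tau>\<close> columns before \<open>e\<close>.\<close>

definition choked :: "int \<Rightarrow> nat \<Rightarrow> nat \<Rightarrow> int \<Rightarrow> (int \<times> int \<Rightarrow> vstate \<times> bool) set" where
  "choked e D H y = {\<omega>. red_seed \<omega> {y - int H..<y + 2 * int H} e \<or>
    (\<exists>x\<in>{e<..e + int D}. \<forall>c\<in>{x..<x + int \<tau>}. red_seed \<omega> {y - int H..<y + 2 * int H} c)}"

text \<open>A layer without a blue barrier is porous, if blue has too few seeds in it, or choked, if red
  seeds may stop blue on its way to the barrier. The \<open>J\<close> layers on either side of row 0 depend on
  disjoint sets of rows, none of which is row 0.\<close>

definition breached :: "nat \<Rightarrow> int \<Rightarrow> nat \<Rightarrow> nat \<Rightarrow> (int \<times> int \<Rightarrow> vstate \<times> bool) set" where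
  "breached J e D H =
    (\<Inter>j<J. porous e D H (int H + 1 + 3 * int j * int H) \<union> choked e D H (int H + 1 + 3 * int j * int H)) \<union>
    (\<Inter>j<J. porous e D H (- 2 * int H - 3 * int j * int H) \<union> choked e D H (- 2 * int H - 3 * int j * int H))"

text \<open>The second hypothesis says that in time \<open>D + \<tau>\<close> red, with its
  \<open>\<rho>\<close> sites per time \<open>r\<close>, moves by at most \<open>H\<close>.\<close>

lemma red_needs_seed:
  assumes K: "update_time r K = real (D + \<tau>)" and D: "real (D + \<tau>) \<le> real H * r / real \<rho>"
    and "st \<omega> K (c, y) = Red"
  shows "\<exists>h. \<bar>h - y\<bar> \<le> int H \<and> fst (\<omega> (c, h)) = Red"
proof -
  from line_growth.speed_limit[OF column_growth, where i = y and k = K, OF assms(3)]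
  obtain h where h: "\<bar>h - y\<bar> \<le> int (\<rho> * red_clock K)" "fst (\<omega> (c, h)) = Red" by auto
  have "real (D + \<tau>) / r \<le> real H / real \<rho>"
    using D r rho by (simp add: field_simps)
  then have "real (red_clock K) \<le> real H / real \<rho>"
    unfolding K using r by (intro order.trans[OF of_nat_floor]) auto
  then have "real (\<rho> * red_clock K) \<le> real H" using rho by (simp add: field_simps)
  then have "\<rho> * red_clock K \<le> H" by (simp only: of_nat_le_iff)
  then have "int (\<rho> * red_clock K) \<le> int H" by (simp only: of_nat_le_iff)
  then show ?thesis using h by (intro exI[of _ h]) auto
qed

text \<open>A seed in the columns \<open>e\<close> to \<open>e + D\<close> is at most
  \<open>D + \<tau>\<close> away from column \<open>c\<close>, and blue gains one site per unit of
  time unless \<open>\<tau>\<close> consecutive sites of its row are red. Such a run would need a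
  seed in each of its columns, which the last hypothesis excludes; column \<open>c\<close> has none
  either.\<close>

lemma blue_barrier:
  assumes K: "update_time r K = real (D + \<tau>)" and D: "real (D + \<tau>) \<le> real H * r / real \<rho>"
    and e: "c < e" "e \<le> c + int \<tau>"
    and c: "\<not> red_seed \<omega> {y - int H..<y + 2 * int H} c"
    and tight: "\<omega> \<notin> porous e D H y" and clear: "\<omega> \<notin> choked e D H y"
  shows "\<exists>z\<ge>y. z + int \<rho> \<le> y + int H \<and> (\<forall>b\<in>{z..<z + int \<rho>}. st \<omega> K (c, b) = Blue)"
proof -
  let ?I = "{y - int H..<y + 2 * int H}"
  have seed: "red_seed \<omega> ?I c'" if "st \<omega> K (c', b) = Red" "y \<le> b" "b < y + int H" for c' b
    using red_needs_seed[OF K D that(1)] that unfolding red_seed_def by force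
  have blue: "st \<omega> K (c, b) = Blue"
    if b: "y \<le> b" "b < y + int H" and d: "d \<in> {0..int D}" "fst (\<omega> (e + d, b)) = Blue" for b d
  proof -
    interpret line_growth "\<lambda>k i. st \<omega> k (i, b)" Blue Red \<tau>
      "\<lambda>k. update_time r (Suc k) \<in> blue_times" blue_clock
      by (rule row_growth)
    show ?thesis
    proof (rule advance[OF tau, of "e + d"])
      have "blue_clock K = D + \<tau>" unfolding K by simp
      then show "e + d - c \<le> int (blue_clock K)" using e d by simp
      show "st \<omega> K (c, b) \<noteq> Red" using seed b c by blast
      fix a assume a: "c \<le> a" "a + int \<tau> \<le> e + d"
      show "\<exists>i\<ge>a. i < a + int \<tau> \<and> st \<omega> K (i, b) \<noteq> Red"
      proof (rule ccontr)
        assume "\<not> ?thesis"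
        then have all: "st \<omega> K (i, b) = Red" if "i \<in> {a..<a + int \<tau>}" for i using that by auto
        then have run: "red_seed \<omega> ?I i" if "i \<in> {a..<a + int \<tau>}" for i using seed b that by blast
        \<comment> \<open>So the run starts right of \<open>c\<close>; as
          \<open>e \<le> c + \<tau>\<close>, it contains \<open>e\<close> or starts beyond
          it.\<close>
        then have "a \<noteq> c" using c tau by auto
        then have "\<omega> \<in> choked e D H y"
          using run a e d unfolding choked_def by (cases "a \<le> e") (auto intro!: bexI[of _ a])
        then show False using clear by blast
      qed
    qed (use d e in auto)
  qed
  from tight obtain j where j: "j < H div \<rho>"
    and row: "\<And>i. i < \<rho> \<Longrightarrow> \<exists>d\<in>{0..int D}. fst (\<omega> (e + d, y + int (\<rho> * j + i))) = Blue"
    unfolding porous_def by auto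
  have "\<rho> * Suc j \<le> \<rho> * (H div \<rho>)" using j by (intro mult_left_mono) auto
  also have "\<dots> \<le> H" by simp
  finally have jH: "int (\<rho> * j) + int \<rho> \<le> int H" by (simp flip: of_nat_mult of_nat_add)
  show ?thesis
  proof (intro exI[of _ "y + int (\<rho> * j)"] conjI ballI)
    fix b assume b: "b \<in> {y + int (\<rho> * j)..<y + int (\<rho> * j) + int \<rho>}"
    define i where "i = nat (b - (y + int (\<rho> * j)))"
    have i: "i < \<rho>" "b = y + int (\<rho> * j + i)" using b by (auto simp: i_def)
    from row[OF i(1)] obtain d where "d \<in> {0..int D}" "fst (\<omega> (e + d, b)) = Blue" unfolding i(2) by blast
    moreover have "y \<le> b" "b < y + int H"
      using b jH of_nat_0_le_iff[of "\<rho> * j", where 'a = int] unfolding atLeastLessThan_iff by linarith+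
    ultimately show "st \<omega> K (c, b) = Blue" by (intro blue)
  qed (use jH of_nat_0_le_iff[of "\<rho> * j", where 'a = int] in linarith)+
qed

text \<open>If the event fails, a layer above row 0 and one below it carry complete barriers at time
  \<open>D + \<tau>\<close>. The red seeds of column \<open>c\<close> are too far away to have come
  between them by then, and later they cannot cross. The event does not mention \<open>c\<close>, so
  it serves all columns from \<open>e - \<tau>\<close> to \<open>e - 1\<close> at once.\<close>

lemma breached_if_red:
  assumes D: "real (D + \<tau>) \<le> real H * r / real \<rho>" and e: "c < e" "e \<le> c + int \<tau>"
    and c: "\<not> red_seed \<omega> {- int (3 * J * H)..int (3 * J * H)} c" and red: "st \<omega> k (c, 0) = Red"
  shows "\<omega> \<in> breached J e D H"
proof (rule ccontr)
  assume "\<omega> \<notin> breached J e D H"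
  then obtain j1 j2 where j: "j1 < J" "j2 < J"
    and up: "\<omega> \<notin> porous e D H (int H + 1 + 3 * int j1 * int H)"
      "\<omega> \<notin> choked e D H (int H + 1 + 3 * int j1 * int H)"
    and down: "\<omega> \<notin> porous e D H (- 2 * int H - 3 * int j2 * int H)"
      "\<omega> \<notin> choked e D H (- 2 * int H - 3 * int j2 * int H)"
    unfolding breached_def by blast
  from blue_step[of "D + \<tau>"] obtain K where K: "update_time r K = real (D + \<tau>)" by blast
  have J: "3 * int j * int H + 3 * int H \<le> 3 * int J * int H" if "j < J" for j
  proof -
    have "3 * int (Suc j) * int H \<le> 3 * int J * int H" using that by (intro mult_right_mono) auto
    then show ?thesis by (simp add: algebra_simps)
  qed
  have pos: "0 \<le> 3 * int j * int H" for j by simp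
  have no: "\<not> red_seed \<omega> {y - int H..<y + 2 * int H} c"
    if "- (3 * int J * int H) \<le> y - int H" "y + 2 * int H \<le> 3 * int J * int H + 1" for y
    using c that unfolding red_seed_def by auto
  obtain z1 where z1: "z1 \<ge> int H + 1 + 3 * int j1 * int H"
    "z1 + int \<rho> \<le> int H + 1 + 3 * int j1 * int H + int H" "\<forall>b\<in>{z1..<z1 + int \<rho>}. st \<omega> K (c, b) = Blue"
    using blue_barrier[OF K D e no up] J[OF j(1)] pos[of j1] pos[of J] by auto
  obtain z2 where z2: "z2 \<ge> - 2 * int H - 3 * int j2 * int H"
    "z2 + int \<rho> \<le> - 2 * int H - 3 * int j2 * int H + int H" "\<forall>b\<in>{z2..<z2 + int \<rho>}. st \<omega> K (c, b) = Blue"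
    using blue_barrier[OF K D e no down] J[OF j(2)] pos[of j2] pos[of J] by auto
  have mid: "st \<omega> K (c, b) \<noteq> Red" if "z2 + int \<rho> \<le> b" "b \<le> z1 - 1" for b
  proof
    assume "st \<omega> K (c, b) = Red"
    from red_needs_seed[OF K D this] obtain h where h: "\<bar>h - b\<bar> \<le> int H" "fst (\<omega> (c, h)) = Red" by blast
    have "h \<in> {- int (3 * J * H)..int (3 * J * H)}"
      using h(1) that z1(2) z2(1) J[OF j(1)] J[OF j(2)] by auto
    then show False using c h(2) unfolding red_seed_def by blast
  qed
  interpret line_growth "\<lambda>k i. st \<omega> k (c, i)" Red Blue \<rho>
    "\<lambda>k. update_time r (Suc k) \<in> red_times r" red_clock
    by (rule column_growth)
  have "st \<omega> (max k K) (c, 0) \<noteq> Red"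
  proof (rule wall[of "z2 + int \<rho>" K "z1 - 1"])
    show "st \<omega> K (c, b) = Blue" if "z2 + int \<rho> - int \<rho> \<le> b" "b < z2 + int \<rho>" for b
      using that z2(3) by auto
    show "st \<omega> K (c, b) = Blue" if "z1 - 1 < b" "b \<le> z1 - 1 + int \<rho>" for b
      using that z1(3) by auto
    show "z2 + int \<rho> \<le> 0" "0 \<le> z1 - 1"
      using z1(1) z2(2) pos[of j1] pos[of j2] by linarith+
  qed (use mid in auto)
  moreover have "st \<omega> (max k K) (c, 0) = Red"
    using permanent_le[of k "max k K" 0] red by simp
  ultimately show False by simp
qed

text \<open>Decomposition by the distance of the seeds. Where all columns of the run become seeded,
  some column had no seed at the scale before and yet turned red, so the layer of that scale is
  breached. If even scale \<open>m\<close> is not enough, its height has room for \<open>J\<close>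
  layers of height \<open>H\<close>.\<close>

lemma red_near_or_breached:
  fixes G D :: "nat \<Rightarrow> nat"
  assumes D: "\<And>k. k < m \<Longrightarrow> real (D k + \<tau>) \<le> real (G k) * r / real \<rho>"
    and D': "real (D' + \<tau>) \<le> real H * r / real \<rho>" and J: "J * H = G m"
    and red: "\<And>c. c \<in> {x..<x + int \<tau>} \<Longrightarrow> \<exists>k. st \<omega> k (c, 0) = Red"
  defines "S \<equiv> \<lambda>k. \<forall>c\<in>{x..<x + int \<tau>}. red_seed \<omega> {- int (3 * G k)..int (3 * G k)} c"
  shows "S 0 \<or> (\<exists>k<m. S (Suc k) \<and> \<omega> \<in> breached 1 (x + int \<tau>) (D k) (G k)) \<or>
    \<omega> \<in> breached J (x + int \<tau>) D' H"
proof (cases "S m")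
  case False
  then obtain c where c: "c \<in> {x..<x + int \<tau>}" "\<not> red_seed \<omega> {- int (3 * G m)..int (3 * G m)} c"
    unfolding S_def by blast
  moreover obtain k where "st \<omega> k (c, 0) = Red" using red[OF c(1)] by blast
  moreover have eq: "3 * J * H = 3 * G m" using J by simp
  have "\<not> red_seed \<omega> {- int (3 * J * H)..int (3 * J * H)} c" unfolding eq by (rule c(2))
  ultimately have "\<omega> \<in> breached J (x + int \<tau>) D' H"
    by (intro breached_if_red[OF D', of c]) (simp_all del: of_nat_mult)
  then show ?thesis by blast
next
  case True
  show ?thesis
  proof (cases "S 0")
    case False
    have "S n \<Longrightarrow> \<exists>k<n. \<not> S k \<and> S (Suc k)" for n
      using False by (induction n) (auto intro: less_SucI)
    then obtain k where k: "k < m" "\<not> S k" "S (Suc k)" using True by blast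
    from k(2) obtain c where c: "c \<in> {x..<x + int \<tau>}" "\<not> red_seed \<omega> {- int (3 * G k)..int (3 * G k)} c"
      unfolding S_def by blast
    moreover obtain i where "st \<omega> i (c, 0) = Red" using red[OF c(1)] by blast
    ultimately have "\<omega> \<in> breached 1 (x + int \<tau>) (D k) (G k)"
      by (intro breached_if_red[OF D[OF k(1)], of c]) auto
    then show ?thesis using k by blast
  qed blast
qed

text \<open>Otherwise \<open>advance\<close> brings blue from the seed to the origin by time
  \<open>m\<close>. A red origin is treated separately, through the seeds of its own column.\<close>

lemma blue_or_red_run:
  assumes m: "1 \<le> m" "fst (\<omega> (int m, 0)) = Blue"
    and "\<And>k. st \<omega> k 0 \<noteq> Blue" "\<And>k. st \<omega> k 0 \<noteq> Red"
  shows "\<exists>x\<in>{0..int m - int \<tau>}. \<forall>c\<in>{x..<x + int \<tau>}. \<exists>k. st \<omega> k (c, 0) = Red"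
proof (rule ccontr)
  assume no: "\<not> ?thesis"
  interpret line_growth "\<lambda>k i. st \<omega> k (i, 0)" Blue Red \<tau>
    "\<lambda>k. update_time r (Suc k) \<in> blue_times" blue_clock
    by (rule row_growth)
  from blue_step[of m] obtain K where K: "update_time r K = real m" by blast
  have "st \<omega> K (0, 0) = Blue"
  proof (rule advance[OF tau, of "int m"])
    fix a assume a: "0 \<le> a" "a + int \<tau> \<le> int m"
    show "\<exists>b\<ge>a. b < a + int \<tau> \<and> st \<omega> K (b, 0) \<noteq> Red"
    proof (rule ccontr)
      assume "\<not> ?thesis"
      then have "\<forall>c\<in>{a..<a + int \<tau>}. \<exists>k. st \<omega> k (c, 0) = Red" by auto
      moreover have "a \<in> {0..int m - int \<tau>}" using a by simp
      ultimately show False using no by blast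
    qed
  qed (use m K assms(4) in \<open>auto simp: zero_prod_def\<close>)
  then show False using assms(3) by (simp add: zero_prod_def)
qed

end

section \<open>Probability of a breach, and the lower bound for a blue origin\<close>

context competition_field
begin

definition columns_seeded :: "int set \<Rightarrow> int set \<Rightarrow> (int \<times> int \<Rightarrow> vstate \<times> bool) set" where
  "columns_seeded I A = {\<omega>. \<forall>c\<in>A. red_seed \<omega> I c}"

lemma depends_on_columns_seeded: "depends_on (A \<times> I) (columns_seeded I A)"
proof (rule depends_onI)
  fix \<omega> \<omega>' assume eq: "\<And>x. x \<in> A \<times> I \<Longrightarrow> \<omega> x = \<omega>' x" and "\<omega> \<in> columns_seeded I A"
  then have w: "\<forall>c\<in>A. \<exists>h\<in>I. fst (\<omega> (c, h)) = Red" by (simp add: columns_seeded_def red_seed_def)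
  have "\<exists>h\<in>I. fst (\<omega>' (c, h)) = Red" if c: "c \<in> A" for c
  proof -
    from w c obtain h where "h \<in> I" "fst (\<omega> (c, h)) = Red" by blast
    then show ?thesis using eq[of "(c, h)"] c by (intro bexI[of _ h]) simp_all
  qed
  then show "\<omega>' \<in> columns_seeded I A" by (simp add: columns_seeded_def red_seed_def)
qed

lemma prob_columns_seeded:
  assumes "finite A" "finite I"
  shows "F.prob (columns_seeded I A) \<le> (real (card I) * q) ^ card A"
proof -
  have "columns_seeded I A = (\<Inter>c\<in>A. columns_seeded I {c})" by (auto simp: columns_seeded_def)
  also have "F.prob \<dots> = (\<Prod>c\<in>A. F.prob (columns_seeded I {c}))"
    by (rule prob_INT[OF assms(1), of "\<lambda>c. {c} \<times> I"])
      (use assms(2) depends_on_columns_seeded in \<open>auto simp: disjoint_family_on_def\<close>)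
  also have "\<dots> \<le> (\<Prod>c\<in>A. real (card I) * q)"
  proof (intro prod_mono conjI)
    fix c
    have "columns_seeded I {c} = {\<omega>. \<exists>x\<in>{c} \<times> I. fst (\<omega> x) = Red}"
      by (auto simp: columns_seeded_def red_seed_def)
    then have "F.prob (columns_seeded I {c}) = 1 - (1 - q) ^ card ({c} \<times> I)"
      using prob_some_Red[of "{c} \<times> I"] assms(2) by simp
    also have "\<dots> \<le> real (card I) * q"
      using Bernoulli_inequality[of "- q" "card I"] p pq by (simp add: card_cartesian_product)
    finally show "F.prob (columns_seeded I {c}) \<le> real (card I) * q" .
  qed simp
  finally show ?thesis by simp
qed

lemma depends_on_porous: "depends_on ({e..e + int D} \<times> {y..<y + int H}) (porous e D H y)"
proof (rule depends_onI)
  fix \<omega> \<omega>' assume eq: "\<And>x. x \<in> {e..e + int D} \<times> {y..<y + int H} \<Longrightarrow> \<omega> x = \<omega>' x" and w: "\<omega> \<in> porous e D H y"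
  have "\<omega> (e + d, y + int (\<rho> * j + i)) = \<omega>' (e + d, y + int (\<rho> * j + i))"
    if "j < H div \<rho>" "i < \<rho>" "d \<in> {0..int D}" for i j d
  proof -
    have "\<rho> * Suc j \<le> \<rho> * (H div \<rho>)" using that by (intro mult_left_mono) auto
    also have "\<dots> \<le> H" by simp
    finally have "\<rho> * j + i < H" using that by simp
    then have "int (\<rho> * j + i) < int H" by (simp only: of_nat_less_iff)
    then show ?thesis using that by (intro eq) auto
  qed
  then show "\<omega>' \<in> porous e D H y" using w unfolding porous_def mem_Collect_eq by metis
qed

lemma prob_porous:
  "F.prob (porous e D H y) = (1 - (1 - (1 - p) ^ (D + 1)) ^ \<rho>) ^ (H div \<rho>)"
proof -
  define E where "E b = {\<omega> :: int \<times> int \<Rightarrow> vstate \<times> bool. \<exists>x\<in>{e..e + int D} \<times> {y + int b}. fst (\<omega> x) = Blue}" for b :: nat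
  let ?K = "\<lambda>b::nat. {e..e + int D} \<times> {y + int b}"
  have dE: "depends_on (?K b) (E b)" for b unfolding E_def by (rule depends_on_some_coordinate)
  have "F.prob (E b) = 1 - (1 - p) ^ (D + 1)" for b
    unfolding E_def by (subst prob_some_Blue) (auto simp: card_cartesian_product nat_add_distrib)
  moreover have "F.prob (\<Inter>i<\<rho>. E (\<rho> * j + i)) = (\<Prod>i<\<rho>. F.prob (E (\<rho> * j + i)))" for j
    by (rule prob_INT[of _ "\<lambda>i. ?K (\<rho> * j + i)"], simp, simp, force simp: disjoint_family_on_def, rule dE)
  ultimately have PI: "F.prob (\<Inter>i<\<rho>. E (\<rho> * j + i)) = (1 - (1 - p) ^ (D + 1)) ^ \<rho>" for j
    by simp
  let ?L = "\<lambda>j. \<Union>i<\<rho>. ?K (\<rho> * j + i)"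
  have dI: "depends_on (?L j) (\<Inter>i<\<rho>. E (\<rho> * j + i))" for j by (intro depends_on_INT dE)
  have "porous e D H y = (\<Inter>j<H div \<rho>. - (\<Inter>i<\<rho>. E (\<rho> * j + i)))"
  proof -
    have "(\<forall>d\<in>{0..int D}. fst (\<omega> (e + d, y + int b)) \<noteq> Blue) \<longleftrightarrow> \<omega> \<notin> E b" for \<omega> b
    proof
      assume *: "\<forall>d\<in>{0..int D}. fst (\<omega> (e + d, y + int b)) \<noteq> Blue"
      have "fst (\<omega> x) \<noteq> Blue" if "x \<in> {e..e + int D} \<times> {y + int b}" for x
        using *[rule_format, of "fst x - e"] that by auto
      then show "\<omega> \<notin> E b" by (auto simp: E_def)
    qed (auto simp: E_def)
    then have "porous e D H y = {\<omega>. \<forall>j<H div \<rho>. \<exists>i<\<rho>. \<omega> \<notin> E (\<rho> * j + i)}"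
      by (simp only: porous_def)
    then show ?thesis by auto
  qed
  also have "F.prob \<dots> = (\<Prod>j<H div \<rho>. F.prob (- (\<Inter>i<\<rho>. E (\<rho> * j + i))))"
  proof (rule prob_INT[of _ ?L])
    \<comment> \<open>Uniqueness of division with remainder: distinct blocks share no row.\<close>
    have "(\<rho> * i + a) div \<rho> = i" if "a < \<rho>" for i a
      using that by simp
    then have "i = i'" if "\<rho> * i + a = \<rho> * i' + a'" "a < \<rho>" "a' < \<rho>" for i i' a a'
      using that by metis
    then show "disjoint_family_on ?L {..<H div \<rho>}"
      by (auto simp: disjoint_family_on_def simp flip: of_nat_mult of_nat_add)
    show "depends_on (?L j) (- (\<Inter>i<\<rho>. E (\<rho> * j + i)))" for j
      by (intro depends_on_Compl dI)
  qed simp_all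
  also have "\<dots> = (\<Prod>j<H div \<rho>. 1 - (1 - (1 - p) ^ (D + 1)) ^ \<rho>)"
  proof (rule prod.cong)
    fix j
    have "F.prob (- (\<Inter>i<\<rho>. E (\<rho> * j + i))) = 1 - F.prob (\<Inter>i<\<rho>. E (\<rho> * j + i))"
      by (rule prob_Compl[OF _ dI]) simp
    then show "F.prob (- (\<Inter>i<\<rho>. E (\<rho> * j + i))) = 1 - (1 - (1 - p) ^ (D + 1)) ^ \<rho>" by (simp only: PI)
  qed simp
  finally show ?thesis by simp
qed

lemma choked_eq:
  "choked e D H y = columns_seeded {y - int H..<y + 2 * int H} {e} \<union>
    (\<Union>x\<in>{e<..e + int D}. columns_seeded {y - int H..<y + 2 * int H} {x..<x + int \<tau>})"
  by (auto simp: choked_def columns_seeded_def)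

lemma depends_on_choked:
  "depends_on ({e..e + int D + int \<tau>} \<times> {y - int H..<y + 2 * int H}) (choked e D H y)"
  unfolding choked_eq
proof (intro depends_on_Un)
  let ?I = "{y - int H..<y + 2 * int H}"
  show "depends_on ({e..e + int D + int \<tau>} \<times> ?I) (columns_seeded ?I {e})"
    by (rule depends_on_mono[OF depends_on_columns_seeded]) auto
  show "depends_on ({e..e + int D + int \<tau>} \<times> ?I)
      (\<Union>x\<in>{e<..e + int D}. columns_seeded ?I {x..<x + int \<tau>})"
    by (rule depends_on_mono[OF depends_on_UN[OF depends_on_columns_seeded]]) auto
qed

lemma columns_seeded_event: "finite A \<Longrightarrow> finite I \<Longrightarrow> columns_seeded I A \<in> F.events"
  by (rule sets_field[OF _ depends_on_columns_seeded]) simp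

lemma porous_event: "porous e D H y \<in> F.events"
  by (rule sets_field[OF _ depends_on_porous]) simp

lemma choked_event: "choked e D H y \<in> F.events"
  by (rule sets_field[OF _ depends_on_choked]) simp

lemma prob_choked:
  "F.prob (choked e D H y) \<le> 3 * real H * q + real D * (3 * real H * q) ^ \<tau>"
proof -
  let ?I = "{y - int H..<y + 2 * int H}"
  have "F.prob (choked e D H y) \<le> F.prob (columns_seeded ?I {e}) +
      F.prob (\<Union>x\<in>{e<..e + int D}. columns_seeded ?I {x..<x + int \<tau>})"
    unfolding choked_eq using columns_seeded_event
    by (intro measure_Un_le sets.finite_UN) auto
  also have "\<dots> \<le> F.prob (columns_seeded ?I {e}) +
      (\<Sum>x\<in>{e<..e + int D}. F.prob (columns_seeded ?I {x..<x + int \<tau>}))"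
    using columns_seeded_event by (intro add_left_mono F.finite_measure_subadditive_finite) auto
  also have "\<dots> \<le> 3 * real H * q + (\<Sum>x\<in>{e<..e + int D}. (3 * real H * q) ^ \<tau>)"
  proof (intro add_mono sum_mono)
    show "F.prob (columns_seeded ?I {e}) \<le> 3 * real H * q"
      using prob_columns_seeded[of "{e}" ?I] by simp
    show "F.prob (columns_seeded ?I {x..<x + int \<tau>}) \<le> (3 * real H * q) ^ \<tau>" for x
      using prob_columns_seeded[of "{x..<x + int \<tau>}" ?I] by simp
  qed
  finally show ?thesis by simp
qed

lemma INT_event:
  assumes "\<And>j. E j \<in> F.events"
  shows "(\<Inter>j<J::nat. E j) \<in> F.events"
proof (cases "J = 0")
  case True
  then show ?thesis using sets.top[of field] by simp
next
  case False
  then show ?thesis using assms by (intro sets.finite_INT) auto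
qed

definition porous_bound :: "nat \<Rightarrow> nat \<Rightarrow> real" where
  "porous_bound D H = (1 - (1 - (1 - p) ^ (D + 1)) ^ \<rho>) ^ (H div \<rho>)"

definition choked_bound :: "nat \<Rightarrow> nat \<Rightarrow> real" where
  "choked_bound D H = 3 * real H * q + real D * (3 * real H * q) ^ \<tau>"

lemma porous_bound_nonneg: "porous_bound D H \<ge> 0"
  unfolding porous_bound_def by (subst prob_porous[symmetric]) simp

lemma choked_bound_nonneg: "choked_bound D H \<ge> 0"
  unfolding choked_bound_def using q by simp

text \<open>If every layer is porous or choked, then some layer is porous or all are choked. Porous
  layers are so rare that a union bound is harmless, whereas choking costs only a power of
  \<open>p\<close> and has to be raised to the power \<open>J\<close>; this is where disjointness of
  the rows enters.\<close>

lemma prob_layers: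
  assumes y: "\<And>i j. i < J \<Longrightarrow> j < J \<Longrightarrow> i \<noteq> j \<Longrightarrow>
    {y i - int H..<y i + 2 * int H} \<inter> {y j - int H..<y j + 2 * int H} = {}"
  shows "F.prob (\<Inter>j<J. porous e D H (y j) \<union> choked e D H (y j)) \<le>
    real J * porous_bound D H + choked_bound D H ^ J"
proof -
  have "F.prob (\<Inter>j<J. porous e D H (y j) \<union> choked e D H (y j)) \<le>
      F.prob ((\<Union>j<J. porous e D H (y j)) \<union> (\<Inter>j<J. choked e D H (y j)))"
    using porous_event choked_event
    by (intro F.finite_measure_mono sets.Un sets.finite_UN) (auto intro!: INT_event)
  also have "\<dots> \<le> F.prob (\<Union>j<J. porous e D H (y j)) + F.prob (\<Inter>j<J. choked e D H (y j))"
    using porous_event choked_event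
    by (intro measure_Un_le sets.finite_UN) (auto intro!: INT_event)
  also have "F.prob (\<Union>j<J. porous e D H (y j)) \<le> (\<Sum>j<J. F.prob (porous e D H (y j)))"
    using porous_event by (intro F.finite_measure_subadditive_finite) auto
  also have "\<dots> = real J * porous_bound D H" by (simp add: prob_porous porous_bound_def)
  also have "F.prob (\<Inter>j<J. choked e D H (y j)) = (\<Prod>j<J. F.prob (choked e D H (y j)))"
  proof (rule prob_INT[of _ "\<lambda>j. {e..e + int D + int \<tau>} \<times> {y j - int H..<y j + 2 * int H}"])
    show "disjoint_family_on (\<lambda>j. {e..e + int D + int \<tau>} \<times> {y j - int H..<y j + 2 * int H}) {..<J}"
      unfolding disjoint_family_on_def using y by blast
  qed (auto intro: depends_on_choked)
  also have "\<dots> \<le> (\<Prod>j<J. choked_bound D H)"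
    using prob_choked by (intro prod_mono) (auto simp: choked_bound_def)
  finally show ?thesis by simp
qed

lemma layers_disjoint:
  assumes "i \<noteq> j"
  shows "{c + 3 * int i * int H..<c + 3 * int i * int H + 3 * int H} \<inter>
    {c + 3 * int j * int H..<c + 3 * int j * int H + 3 * int H} = {}"
proof -
  have aux: "3 * int i * int H + 3 * int H \<le> 3 * int j * int H" if "i < j" for i j
  proof -
    have "3 * int (Suc i) * int H \<le> 3 * int j * int H" using that by (intro mult_right_mono) auto
    then show ?thesis by (simp add: algebra_simps)
  qed
  from assms have "i < j \<or> j < i" by auto
  then show ?thesis using aux[of i j] aux[of j i] by auto
qed

lemma prob_breached:
  "F.prob (breached J e D H) \<le> 2 * (real J * porous_bound D H + choked_bound D H ^ J)"
proof -
  let ?E = "\<lambda>y. \<Inter>j<J. porous e D H (y j) \<union> choked e D H (y j)"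
  let ?y = "\<lambda>j. int H + 1 + 3 * int j * int H" and ?z = "\<lambda>j. - 2 * int H - 3 * int j * int H"
  have ev: "?E y \<in> F.events" for y
    using porous_event choked_event by (auto intro!: INT_event)
  have "F.prob (breached J e D H) \<le> F.prob (?E ?y) + F.prob (?E ?z)"
    unfolding breached_def by (intro measure_Un_le ev)
  also have "F.prob (?E ?y) \<le> real J * porous_bound D H + choked_bound D H ^ J"
  proof (rule prob_layers)
    show "{?y i - int H..<?y i + 2 * int H} \<inter> {?y j - int H..<?y j + 2 * int H} = {}" if "i \<noteq> j" for i j
      using layers_disjoint[OF that, of 1 H] by (auto simp: algebra_simps)
  qed
  also have "F.prob (?E ?z) \<le> real J * porous_bound D H + choked_bound D H ^ J"
  proof (rule prob_layers)
    show "{?z i - int H..<?z i + 2 * int H} \<inter> {?z j - int H..<?z j + 2 * int H} = {}" if "i \<noteq> j" for i j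
    proof (rule ccontr)
      assume "\<not> ?thesis"
      then obtain b where "b \<in> {?z i - int H..<?z i + 2 * int H}" "b \<in> {?z j - int H..<?z j + 2 * int H}" by blast
      then have "- b \<in> {1 + 3 * int i * int H..<1 + 3 * int i * int H + 3 * int H}"
        "- b \<in> {1 + 3 * int j * int H..<1 + 3 * int j * int H + 3 * int H}" by auto
      then show False using layers_disjoint[OF that, of 1 H] by blast
    qed
  qed
  finally show ?thesis by simp
qed

text \<open>Row 0 is left out so that a blue seed in it is independent of the breach even if its
  column meets the layers.\<close>

lemma depends_on_breached:
  "depends_on ({e..e + int D + int \<tau>} \<times> ({- int (3 * J * H)..int (3 * J * H)} - {0})) (breached J e D H)"
    (is "depends_on ?K _")
proof -
  have J: "3 * int j * int H + 3 * int H \<le> 3 * int J * int H" "0 \<le> 3 * int j * int H" if "j < J" for j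
  proof -
    have "3 * int (Suc j) * int H \<le> 3 * int J * int H" using that by (intro mult_right_mono) auto
    then show "3 * int j * int H + 3 * int H \<le> 3 * int J * int H" by (simp add: algebra_simps)
  qed simp
  have "depends_on ?K (\<Inter>j<J. porous e D H (y j) \<union> choked e D H (y j))"
    if y: "\<And>j. j < J \<Longrightarrow> {y j - int H..<y j + 2 * int H} \<subseteq> {- int (3 * J * H)..int (3 * J * H)} - {0}" for y
  proof -
    have "depends_on (\<Union>j\<in>{..<J}. ?K) (\<Inter>j<J. porous e D H (y j) \<union> choked e D H (y j))"
    proof (intro depends_on_INT depends_on_Un)
      fix j assume "j \<in> {..<J}"
      then have sub: "{y j - int H..<y j + 2 * int H} \<subseteq> {- int (3 * J * H)..int (3 * J * H)} - {0}" using y by simp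
      show "depends_on ?K (porous e D H (y j))"
        by (rule depends_on_mono[OF depends_on_porous], rule Sigma_mono, force, rule order.trans[OF _ sub]) auto
      show "depends_on ?K (choked e D H (y j))"
        by (rule depends_on_mono[OF depends_on_choked], rule Sigma_mono, force, rule sub)
    qed
    then show ?thesis by (rule depends_on_mono) auto
  qed
  note layers = this
  show ?thesis
    unfolding breached_def
  proof (intro depends_on_Un; rule layers; rule subsetI)
    fix j b
    assume j: "j < J"
      and "b \<in> {int H + 1 + 3 * int j * int H - int H..<int H + 1 + 3 * int j * int H + 2 * int H}"
    then have "1 + 3 * int j * int H \<le> b" "b \<le> 3 * int j * int H + 3 * int H" by auto
    then have "0 < b" "b \<le> 3 * int J * int H" using J[OF j] by linarith+
    then show "b \<in> {- int (3 * J * H)..int (3 * J * H)} - {0}" by auto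
  next
    fix j b
    assume j: "j < J"
      and "b \<in> {- 2 * int H - 3 * int j * int H - int H..<- 2 * int H - 3 * int j * int H + 2 * int H}"
    then have "- (3 * int j * int H + 3 * int H) \<le> b" "b \<le> - (3 * int j * int H) - 1" by auto
    then have "b < 0" "- (3 * int J * int H) \<le> b" using J[OF j] by linarith+
    then show "b \<in> {- int (3 * J * H)..int (3 * J * H)} - {0}" by auto
  qed
qed

lemma breached_event: "breached J e D H \<in> F.events"
  by (rule sets_field[OF _ depends_on_breached]) simp

text \<open>Three independent events: the blue seed lies in row 0 off the columns of the run, the
  red seeds in the columns of the run, and the breach in later columns off row 0.\<close>

lemma prob_Blue_seeded_breached:
  assumes m: "m < x \<or> x + int \<tau> \<le> m"
  shows "F.prob ({\<omega>. fst (\<omega> (m, 0)) = Blue} \<inter>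
      (columns_seeded {- int G..int G} {x..<x + int \<tau>} \<inter> breached J (x + int \<tau>) D H)) \<le>
    p * (real (2 * G + 1) * q) ^ \<tau> * (2 * (real J * porous_bound D H + choked_bound D H ^ J))"
proof -
  let ?B = "{\<omega> :: int \<times> int \<Rightarrow> vstate \<times> bool. fst (\<omega> (m, 0)) = Blue}"
  let ?S = "columns_seeded {- int G..int G} {x..<x + int \<tau>}"
  let ?F = "breached J (x + int \<tau>) D H"
  let ?K = "{x + int \<tau>..x + int \<tau> + int D + int \<tau>} \<times> ({- int (3 * J * H)..int (3 * J * H)} - {0})"
  have dB: "depends_on {(m, 0)} ?B" by (intro depends_onI) auto
  have dS: "depends_on ({x..<x + int \<tau>} \<times> {- int G..int G}) ?S" by (rule depends_on_columns_seeded)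
  have "F.prob (?B \<inter> (?S \<inter> ?F)) = F.prob ?B * F.prob (?S \<inter> ?F)"
  proof (rule prob_Int[OF _ _ _ dB])
    show "depends_on ({x..<x + int \<tau>} \<times> {- int G..int G} \<union> ?K) (?S \<inter> ?F)"
      by (intro depends_on_Int depends_on_mono[OF dS] depends_on_mono[OF depends_on_breached]) auto
  qed (use m in auto)
  also have "F.prob (?S \<inter> ?F) = F.prob ?S * F.prob ?F"
    by (rule prob_Int[OF _ _ _ dS depends_on_breached]) auto
  also have "F.prob ?B * (F.prob ?S * F.prob ?F) \<le>
      p * ((real (2 * G + 1) * q) ^ \<tau> * (2 * (real J * porous_bound D H + choked_bound D H ^ J)))"
  proof (intro mult_mono)
    have "card {- int G..int G} = 2 * G + 1" by (simp add: nat_add_distrib)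
    then show "F.prob ?S \<le> (real (2 * G + 1) * q) ^ \<tau>"
      using prob_columns_seeded[of "{x..<x + int \<tau>}" "{- int G..int G}"] by simp
  qed (use prob_Blue[of "(m, 0)"] prob_breached p q in auto)
  finally show ?thesis by (simp add: mult.assoc)
qed

lemma prob_Blue_seeded:
  assumes m: "m < x \<or> x + int \<tau> \<le> m"
  shows "F.prob ({\<omega>. fst (\<omega> (m, 0)) = Blue} \<inter> columns_seeded {- int G..int G} {x..<x + int \<tau>}) \<le>
    p * (real (2 * G + 1) * q) ^ \<tau>"
proof -
  let ?B = "{\<omega> :: int \<times> int \<Rightarrow> vstate \<times> bool. fst (\<omega> (m, 0)) = Blue}"
  let ?S = "columns_seeded {- int G..int G} {x..<x + int \<tau>}"
  have dB: "depends_on {(m, 0)} ?B" by (intro depends_onI) auto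
  have "F.prob (?B \<inter> ?S) = F.prob ?B * F.prob ?S"
    by (rule prob_Int[OF _ _ _ dB depends_on_columns_seeded]) (use m in auto)
  also have "\<dots> \<le> p * (real (2 * G + 1) * q) ^ \<tau>"
  proof (intro mult_mono)
    have "card {- int G..int G} = 2 * G + 1" by (simp add: nat_add_distrib)
    then show "F.prob ?S \<le> (real (2 * G + 1) * q) ^ \<tau>"
      using prob_columns_seeded[of "{x..<x + int \<tau>}" "{- int G..int G}"] by simp
  qed (use prob_Blue[of "(m, 0)"] p in auto)
  finally show ?thesis .
qed

text \<open>Suppose that there is a blue seed at distance at most \<open>M\<close> on the right and
  the origin does not become blue. Either it turns red, which needs a seed in its own column or a
  breach, or it stays empty, and then a red run at some \<open>x\<close> precedes a seed
  \<open>b\<close>. Summing over all pairs \<open>(b, x)\<close>, at most \<open>M\<^sup>2\<close>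
  of them, avoids conditioning on the nearest seed.\<close>

lemma prob_origin_blue_ge:
  fixes G D :: "nat \<Rightarrow> nat" and m M J H D' :: nat
  assumes D: "\<And>k. k < m \<Longrightarrow> real (D k + \<tau>) \<le> real (G k) * r / real \<rho>"
    and D': "real (D' + \<tau>) \<le> real H * r / real \<rho>" and J: "J * H = G m"
  defines "far \<equiv> 2 * (real J * porous_bound D' H + choked_bound D' H ^ J)"
    and "near \<equiv> (real (6 * G 0 + 1) * q) ^ \<tau> + (\<Sum>k<m. (real (6 * G (Suc k) + 1) * q) ^ \<tau> *
      (2 * (porous_bound (D k) (G k) + choked_bound (D k) (G k))))"
  shows "F.prob (eventually_set Blue 0) \<ge>
    1 - (1 - p) ^ M - (real (6 * G m + 1) * q + far + (real M)\<^sup>2 * (p * near + far))"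
proof -
  let ?I = "\<lambda>g. {- int (3 * g)..int (3 * g)}"
  let ?S = "\<lambda>k x. columns_seeded (?I (G k)) {x..<x + int \<tau>}"
  let ?B = "\<lambda>b::nat. {\<omega> :: int \<times> int \<Rightarrow> vstate \<times> bool. fst (\<omega> (int b, 0)) = Blue}"
  let ?F = "\<lambda>k x. breached 1 (x + int \<tau>) (D k) (G k)"
  let ?Far = "\<lambda>x. breached J (x + int \<tau>) D' H"
  define Q where "Q b x = (?B b \<inter> ?S 0 x) \<union> (\<Union>k<m. ?B b \<inter> (?S (Suc k) x \<inter> ?F k x)) \<union> ?Far x" for b x
  \<comment> \<open>Column 0 is viewed as the last column of the run that starts at
    \<open>- (\<tau> - 1)\<close>, so the layers begin at column 1.\<close>
  define R where "R = columns_seeded (?I (G m)) {0} \<union> ?Far (- int (\<tau> - 1))"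
  define A where "A = {\<omega> :: int \<times> int \<Rightarrow> vstate \<times> bool. \<exists>z\<in>(\<lambda>b. (int b, 0)) ` {1..M}. fst (\<omega> z) = Blue}"
  let ?P = "Sigma {1..M} (\<lambda>b. {0..int b - int \<tau>})"
  have evB: "?B b \<in> F.events" for b
    by (rule sets_field[of "{(int b, 0)}"]) (auto intro: depends_onI)
  have evS: "columns_seeded (?I g) {x..<x'} \<in> F.events" "columns_seeded (?I g) {x} \<in> F.events" for g x x'
    by (intro columns_seeded_event; simp)+
  have evQ: "Q b x \<in> F.events" for b x
    unfolding Q_def by (intro sets.Un sets.Int sets.finite_UN evB evS breached_event) auto
  have evR: "R \<in> F.events" unfolding R_def by (intro sets.Un evS breached_event)
  have far: "F.prob (?Far x) \<le> far" for x unfolding far_def by (rule prob_breached)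
  have PQ: "F.prob (Q b x) \<le> p * near + far" if "x + int \<tau> \<le> int b" for b x
  proof -
    have "F.prob (Q b x) \<le> F.prob ((?B b \<inter> ?S 0 x) \<union> (\<Union>k<m. ?B b \<inter> (?S (Suc k) x \<inter> ?F k x))) + F.prob (?Far x)"
      unfolding Q_def
      by (intro measure_Un_le sets.Un sets.Int sets.finite_UN evB evS breached_event) auto
    also have "F.prob ((?B b \<inter> ?S 0 x) \<union> (\<Union>k<m. ?B b \<inter> (?S (Suc k) x \<inter> ?F k x))) \<le>
        F.prob (?B b \<inter> ?S 0 x) + F.prob (\<Union>k<m. ?B b \<inter> (?S (Suc k) x \<inter> ?F k x))"
      by (intro measure_Un_le sets.Int sets.finite_UN evB evS breached_event) auto
    also have "F.prob (\<Union>k<m. ?B b \<inter> (?S (Suc k) x \<inter> ?F k x)) \<le>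
        (\<Sum>k<m. F.prob (?B b \<inter> (?S (Suc k) x \<inter> ?F k x)))"
      using evB evS breached_event by (intro F.finite_measure_subadditive_finite) auto
    also have "\<dots> \<le> (\<Sum>k<m. p * (real (6 * G (Suc k) + 1) * q) ^ \<tau> *
        (2 * (porous_bound (D k) (G k) + choked_bound (D k) (G k))))"
      using prob_Blue_seeded_breached[of "int b" x "3 * G (Suc _)" 1 "D _" "G _"] that
      by (intro sum_mono) simp
    also have "F.prob (?B b \<inter> ?S 0 x) \<le> p * (real (6 * G 0 + 1) * q) ^ \<tau>"
      using prob_Blue_seeded[of "int b" x "3 * G 0"] that by simp
    finally show ?thesis using far[of x] by (simp add: near_def sum_distrib_left algebra_simps)
  qed
  \<comment> \<open>Replacing the number of pairs by \<open>M\<^sup>2\<close> needs this sign. The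
    bound dominates a probability, for instance for the pair \<open>b = \<tau>\<close>,
    \<open>x = 0\<close>.\<close>
  have near_far: "0 \<le> p * near + far"
  proof -
    have "0 \<le> F.prob (Q \<tau> 0)" by simp
    also have "\<dots> \<le> p * near + far" by (rule PQ) simp
    finally show ?thesis .
  qed
  have PR: "F.prob R \<le> real (6 * G m + 1) * q + far"
  proof -
    have "F.prob R \<le> F.prob (columns_seeded (?I (G m)) {0}) + F.prob (?Far (- int (\<tau> - 1)))"
      unfolding R_def by (intro measure_Un_le evS breached_event)
    also have "F.prob (columns_seeded (?I (G m)) {0}) \<le> real (card (?I (G m))) * q"
      using prob_columns_seeded[of "{0}" "?I (G m)"] by simp
    also have "card (?I (G m)) = 6 * G m + 1" by (simp add: nat_add_distrib nat_mult_distrib)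
    finally show ?thesis using far[of "- int (\<tau> - 1)"] by linarith
  qed
  have sub: "A \<subseteq> eventually_set Blue 0 \<union> (R \<union> (\<Union>(b, x)\<in>?P. Q b x))"
  proof
    fix \<omega> assume "\<omega> \<in> A"
    then obtain b where b: "b \<in> {1..M}" "fst (\<omega> (int b, 0)) = Blue" by (auto simp: A_def)
    show "\<omega> \<in> eventually_set Blue 0 \<union> (R \<union> (\<Union>(b, x)\<in>?P. Q b x))"
    proof (cases "(\<exists>k. st \<omega> k 0 = Blue) \<or> (\<exists>k. st \<omega> k 0 = Red)")
      case True
      then show ?thesis
      proof
        assume "\<exists>k. st \<omega> k 0 = Red"
        then obtain k where k: "st \<omega> k (0, 0) = Red" by (auto simp: zero_prod_def)
        have "\<omega> \<in> R"
        proof (cases "red_seed \<omega> (?I (G m)) 0")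
          case False
          moreover have eq: "3 * J * H = 3 * G m" using J by simp
          ultimately have "\<omega> \<in> breached J (- int (\<tau> - 1) + int \<tau>) D' H"
            using tau by (intro breached_if_red[OF D' _ _ _ k]) (auto simp only: eq)
          then show ?thesis by (simp add: R_def)
        qed (simp add: R_def columns_seeded_def)
        then show ?thesis by blast
      qed (simp add: eventually_set_def)
    next
      case False
      then obtain x where x: "x \<in> {0..int b - int \<tau>}"
        "\<And>c. c \<in> {x..<x + int \<tau>} \<Longrightarrow> \<exists>k. st \<omega> k (c, 0) = Red"
        using blue_or_red_run[of b \<omega>] b by auto
      have "\<omega> \<in> Q b x"
        using red_near_or_breached[where G = G and D = D and m = m and D' = D' and H = H and J = J, OF D D' J x(2)] b(2)
        unfolding Q_def columns_seeded_def by blast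
      then show ?thesis using x(1) b(1) by blast
    qed
  qed
  have fP: "finite ?P" by (intro finite_SigmaI) auto
  have cP: "card ?P \<le> M * M"
  proof -
    have "card ?P = (\<Sum>b\<in>{1..M}. card {0..int b - int \<tau>})" by (rule card_SigmaI) auto
    also have "\<dots> \<le> (\<Sum>b\<in>{1..M}. M)" using tau by (intro sum_mono) auto
    finally show ?thesis by simp
  qed
  have evU: "(\<Union>(b, x)\<in>?P. Q b x) \<in> F.events" using fP evQ by (intro sets.finite_UN) auto
  have "1 - (1 - p) ^ M = F.prob A"
    unfolding A_def by (subst prob_some_Blue) (auto simp: card_image inj_on_def)
  also have "\<dots> \<le> F.prob (eventually_set Blue 0 \<union> (R \<union> (\<Union>(b, x)\<in>?P. Q b x)))"
    using sub eventually_set_event evR evU by (intro F.finite_measure_mono) auto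
  also have "\<dots> \<le> F.prob (eventually_set Blue 0) + F.prob (R \<union> (\<Union>(b, x)\<in>?P. Q b x))"
    using eventually_set_event evR evU by (intro measure_Un_le) auto
  also have "F.prob (R \<union> (\<Union>(b, x)\<in>?P. Q b x)) \<le> F.prob R + F.prob (\<Union>(b, x)\<in>?P. Q b x)"
    using evR evU by (intro measure_Un_le) auto
  also have "F.prob (\<Union>(b, x)\<in>?P. Q b x) \<le> (\<Sum>(b, x)\<in>?P. F.prob (Q b x))"
    using F.finite_measure_subadditive_finite[OF fP, of "\<lambda>(b, x). Q b x"] evQ by (auto simp: case_prod_unfold)
  also have "\<dots> \<le> (\<Sum>(b, x)\<in>?P. p * near + far)"
    by (intro sum_mono) (auto intro: PQ)
  also have "\<dots> = real (card ?P) * (p * near + far)" by (simp add: case_prod_unfold)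
  also have "\<dots> \<le> (real M)\<^sup>2 * (p * near + far)"
  proof (rule mult_right_mono[OF _ near_far])
    show "real (card ?P) \<le> (real M)\<^sup>2"
      using of_nat_mono[OF cP, where 'a = real] by (simp only: of_nat_mult power2_eq_square)
  qed
  finally show ?thesis using PR by simp
qed

end

section \<open>Asymptotics\<close>

text \<open>Multiply by \<open>(1 + x) ^ n\<close>, which Bernoulli bounds below by
  \<open>1 + real n * x\<close>, and use \<open>(1 - x) * (1 + x) \<le> 1\<close>.\<close>

lemma one_minus_power_le:
  fixes x :: real
  assumes "0 \<le> x" "x \<le> 1"
  shows "(1 - x) ^ n \<le> 1 / (1 + real n * x)"
proof -
  have "(1 - x) ^ n * (1 + real n * x) \<le> (1 - x) ^ n * (1 + x) ^ n"
    using assms Bernoulli_inequality[of x n] by (intro mult_left_mono) auto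
  also have "\<dots> = (1 - x\<^sup>2) ^ n" by (simp add: power2_eq_square algebra_simps flip: power_mult_distrib)
  also have "\<dots> \<le> 1" using assms by (intro power_le_one) (auto simp: power_le_one)
  finally show ?thesis using assms by (simp add: pos_le_divide_eq add_pos_nonneg)
qed

lemma one_minus_power_ge:
  fixes x :: real
  assumes "0 \<le> x" "x \<le> 1" "real n * x \<le> 1"
  shows "real n * x / 2 \<le> 1 - (1 - x) ^ n"
proof -
  let ?t = "real n * x"
  have "?t \<ge> 0" using assms by simp
  then have "?t / 2 \<le> ?t / (1 + ?t)" using assms by (intro divide_left_mono mult_pos_pos add_pos_nonneg) auto
  also have "\<dots> = 1 - 1 / (1 + ?t)" using \<open>?t \<ge> 0\<close> by (simp add: field_simps)
  finally have "?t / 2 \<le> 1 - 1 / (1 + ?t)" .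
  then show ?thesis using one_minus_power_le[OF assms(1,2), of n] by linarith
qed

lemma half_le_nat_floor:
  assumes "1 \<le> x"
  shows "x / 2 \<le> real (nat \<lfloor>x\<rfloor>)"
proof -
  have "1 \<le> \<lfloor>x\<rfloor>" using assms by simp
  then have "1 \<le> real_of_int \<lfloor>x\<rfloor>" "real (nat \<lfloor>x\<rfloor>) = real_of_int \<lfloor>x\<rfloor>" by simp_all
  moreover have "x < real_of_int \<lfloor>x\<rfloor> + 1" by linarith
  ultimately show ?thesis by linarith
qed

context competition
begin

definition scale :: "real \<Rightarrow> real" where
  "scale p = p powr - (real \<rho> / (real \<rho> + 1))"

abbreviation density :: "real \<Rightarrow> real \<Rightarrow> real" where
  "density a p \<equiv> a * p powr critical_exponent \<rho> \<tau>"

text \<open>The critical exponent is made for this: the \<open>\<tau>\<close>-th power of the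
  right-hand side is \<open>a ^ \<tau> * p\<close>, so walls have the same order of density as blue
  seeds.\<close>

lemma density_scale: "density a p * scale p = a * p powr (1 / real \<tau>)"
  by (simp add: scale_def critical_exponent_def flip: powr_add)

lemma root_power: "p > 0 \<Longrightarrow> (p powr (1 / real \<tau>)) ^ \<tau> = p"
  using tau by (simp add: powr_power)

lemma rho_frac: "0 < real \<rho> / (real \<rho> + 1)" "real \<rho> / (real \<rho> + 1) < 1"
  using rho by simp_all

text \<open>The left-hand side is the order of the number of obstructions in a column of height
  \<open>scale p\<close> when blue has moved by that order too; the scale is the length at which it
  equals 1.\<close>

lemma scale_power: "p > 0 \<Longrightarrow> p ^ \<rho> * scale p ^ (\<rho> + 1) = 1"
proof -
  assume p: "p > 0"
  have "scale p ^ (\<rho> + 1) = p powr - real \<rho>"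
  proof -
    have "real (\<rho> + 1) * - (real \<rho> / (real \<rho> + 1)) = - real \<rho>"
    proof -
      have "real \<rho> + 1 \<noteq> 0" by (simp add: add_eq_0_iff)
      then have "(real \<rho> + 1) * (real \<rho> / (real \<rho> + 1)) = real \<rho>" by simp
      moreover have "real (\<rho> + 1) = real \<rho> + 1" by simp
      ultimately show ?thesis by (simp only: mult_minus_right)
    qed
    then show ?thesis using p by (simp only: scale_def powr_power)
  qed
  then show ?thesis using p by (simp add: powr_minus powr_realpow field_simps)
qed

lemma scale_pos: "p > 0 \<Longrightarrow> scale p > 0"
  by (simp add: scale_def)

lemma crit_pos: "critical_exponent \<rho> \<tau> > 0"
  using rho tau by (simp add: critical_exponent_def add_pos_pos)

lemma competition_field_eventually:
  assumes "a > 0"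
  shows "\<forall>\<^sub>F p in at_right 0. competition_field \<rho> \<tau> r p (density a p)"
proof -
  have "((\<lambda>p::real. p + a * p powr c) \<longlongrightarrow> 0 + 0) (at_right 0)" if "c > 0" for c
    using assms that by (intro tendsto_add; real_asymp)
  from this[OF crit_pos] have "\<forall>\<^sub>F p in at_right 0. p + density a p < 1"
    by (rule order_tendstoD) simp
  moreover have "\<forall>\<^sub>F p in at_right (0::real). 0 < p" by (rule eventually_at_right_less)
  ultimately show ?thesis
  proof eventually_elim
    case (elim p)
    then show ?case by unfold_locales (use assms in auto)
  qed
qed

text \<open>Seeds are taken within \<open>\<epsilon> * scale p\<close> of row 0, walls within
  \<open>\<epsilon> / p\<close> of the origin. Then \<open>\<kappa>\<close> bounds the obstruction
  of a wall uniformly in \<open>p\<close>, \<open>e\<close> bounds the expected number of seeded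
  runs from below, and \<open>1 - 3 * \<epsilon>\<close> the probability that blue seeds are absent.
  Only \<open>e\<close> contains \<open>a\<close>, so for large \<open>a\<close> just the loss due
  to \<open>\<epsilon>\<close> remains.\<close>

lemma origin_blue_upper:
  fixes a \<epsilon> :: real
  defines "\<kappa> \<equiv> real \<tau> * \<epsilon> * (3 * real \<tau> * r * \<epsilon>) ^ \<rho>"
    and "e \<equiv> \<epsilon> / (4 * real \<tau>) * (a * \<epsilon> / 4) ^ \<tau>"
  assumes a: "a > 0" and \<epsilon>: "\<epsilon> > 0" "3 * \<epsilon> \<le> 1" and k: "\<kappa> \<le> 1"
  shows "\<forall>\<^sub>F p in at_right 0. prob_origin_blue (blue_nbhd \<tau>) (red_nbhd \<rho>) r p (density a p) \<le>
    1 - (1 - 3 * \<epsilon>) * ((1 - \<kappa>)\<^sup>2 * (e / (1 + e)))\<^sup>2"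
proof -
  have ev_large: "\<forall>\<^sub>F p in at_right 0. c * scale p \<ge> C" if "c > 0" for c C
  proof -
    have "filterlim (\<lambda>p::real. c * p powr - b) at_top (at_right 0)" if "b > 0" for b
      using \<open>c > 0\<close> that by real_asymp
    from this[OF rho_frac(1)] show ?thesis
      unfolding scale_def filterlim_at_top by blast
  qed
  have lin: "real \<tau> * r * \<epsilon> > 0" using tau r \<epsilon> by simp
  have ev_M: "\<forall>\<^sub>F p in at_right 0. real \<tau> * \<epsilon> * r * scale p + 2 \<le> \<epsilon> / (2 * p)"
  proof -
    have "filterlim (\<lambda>p::real. \<epsilon> / (2 * p) - real \<tau> * \<epsilon> * r * p powr - b) at_top (at_right 0)"
      if "b < 1" for b
    proof -
      have "real \<tau> * \<epsilon> * r > 0" using tau \<epsilon> r by simp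
      then show ?thesis using \<epsilon> that by real_asymp
    qed
    from this[OF rho_frac(2)] have "\<forall>\<^sub>F p in at_right 0. 2 \<le> \<epsilon> / (2 * p) - real \<tau> * \<epsilon> * r * scale p"
      unfolding scale_def filterlim_at_top by blast
    then show ?thesis by eventually_elim simp
  qed
  have ev_q: "\<forall>\<^sub>F p in at_right 0. \<epsilon> * a * p powr (1 / real \<tau>) \<le> 1"
  proof -
    have "((\<lambda>p::real. \<epsilon> * a * p powr c) \<longlongrightarrow> 0) (at_right 0)" if "c > 0" for c
      using that by real_asymp
    from order_tendstoD(2)[OF this, of "1 / real \<tau>" 1] show ?thesis
      using tau by (auto elim: eventually_mono)
  qed
  have ev_X: "\<forall>\<^sub>F p in at_right 0. 1 \<le> \<epsilon> / (2 * real \<tau> * p)"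
  proof -
    have "filterlim (\<lambda>p::real. \<epsilon> / (2 * c * p)) at_top (at_right 0)" if "c > 0" for c :: real
      using \<epsilon> that by real_asymp
    from this[of "real \<tau>"] show ?thesis using tau unfolding filterlim_at_top by simp
  qed
  have ev_p: "\<forall>\<^sub>F p in at_right (0::real). p < \<epsilon>"
    by (rule order_tendstoD[OF tendsto_ident_at \<epsilon>(1)])
  show ?thesis
    using competition_field_eventually[OF a] eventually_at_right_less[of 0] ev_M ev_q ev_X ev_p
      ev_large[of \<epsilon> 1, OF \<epsilon>(1)] ev_large[of "real \<tau> * r * \<epsilon>" 1, OF lin]
  proof (eventually_elim)
    case (elim p)
    interpret competition_field \<rho> \<tau> r p "density a p" by (rule elim(1))
    \<comment> \<open>The \<open>X\<close> walls take half of the length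
      \<open>\<epsilon> / p\<close>; the other half absorbs \<open>n\<close>, which is of the
      smaller order \<open>scale p\<close>.\<close>
    define M H X where "M = nat \<lfloor>\<epsilon> / p\<rfloor>" and "H = nat \<lfloor>\<epsilon> * scale p\<rfloor>"
      and "X = nat \<lfloor>\<epsilon> / (2 * real \<tau> * p)\<rfloor>"
    define n where "n = \<tau> * nat \<lfloor>real H * r\<rfloor>"
    define k' where "k' = real \<tau> * real H * (real (2 * n + 1) * p) ^ \<rho>"
    define e' where "e' = real X * (1 - (1 - density a p) ^ H) ^ \<tau>"
    have p0: "p > 0" by (rule elim(2))
    have H: "real H \<le> \<epsilon> * scale p" "\<epsilon> * scale p / 2 \<le> real H"
      using half_le_nat_floor elim(7) p0 \<epsilon> scale_pos[OF p0] by (auto simp: H_def)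
    have n: "real n \<le> real \<tau> * r * \<epsilon> * scale p"
    proof -
      have "real (nat \<lfloor>real H * r\<rfloor>) \<le> real H * r" using r by simp
      also have "\<dots> \<le> \<epsilon> * scale p * r" using H r by simp
      finally have "real \<tau> * real (nat \<lfloor>real H * r\<rfloor>) \<le> real \<tau> * (\<epsilon> * scale p * r)"
        by (intro mult_left_mono) auto
      then show ?thesis by (simp add: n_def algebra_simps)
    qed
    have k': "k' \<le> \<kappa>"
    proof -
      \<comment> \<open>This absorbs the 1 in \<open>2 * n + 1\<close>, whence the 3 in
        \<open>\<kappa>\<close>.\<close>
      have "1 \<le> real \<tau> * r * \<epsilon> * scale p" using elim(8) \<epsilon> r tau by simp
      then have "real (2 * n + 1) \<le> 3 * real \<tau> * r * \<epsilon> * scale p" using n by simp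
      then have "k' \<le> real \<tau> * (\<epsilon> * scale p) * (3 * real \<tau> * r * \<epsilon> * scale p * p) ^ \<rho>"
        unfolding k'_def using H p0 \<epsilon> scale_pos[OF p0]
        by (intro mult_mono power_mono mult_right_mono) auto
      also have "\<dots> = \<kappa> * (p ^ \<rho> * scale p ^ (\<rho> + 1))"
        by (simp add: \<kappa>_def power_mult_distrib algebra_simps)
      also have "\<dots> = \<kappa>" by (simp only: scale_power[OF p0] mult_1_right)
      finally show ?thesis .
    qed
    have dens: "0 \<le> density a p" "density a p \<le> 1" using q pq p0 by auto
    \<comment> \<open>The floors in \<open>X\<close> and \<open>H\<close> lose a factor 2 each and
      \<open>one_minus_power_ge\<close> another one; with the 2 in the definition of
      \<open>X\<close> this gives both 4s in \<open>e\<close>.\<close>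
    have e': "e \<le> e'"
    proof -
      have "real H * density a p \<le> \<epsilon> * scale p * density a p"
        using H dens by (intro mult_right_mono)
      also have "\<dots> = \<epsilon> * a * p powr (1 / real \<tau>)" using density_scale[of a p] by (simp add: algebra_simps)
      also have "\<dots> \<le> 1" by (rule elim(4))
      finally have "real H * density a p \<le> 1" .
      from one_minus_power_ge[OF dens this]
      have "real H * density a p / 2 \<le> 1 - (1 - density a p) ^ H" .
      moreover have "\<epsilon> * scale p / 2 * density a p \<le> real H * density a p"
        using H dens by (intro mult_right_mono)
      moreover have "a * \<epsilon> / 4 * p powr (1 / real \<tau>) = \<epsilon> * scale p / 2 * density a p / 2"
      proof -
        have "a * \<epsilon> / 4 * p powr (1 / real \<tau>) = \<epsilon> / 4 * (a * p powr (1 / real \<tau>))" by simp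
        also have "\<dots> = \<epsilon> / 4 * (density a p * scale p)" by (simp only: density_scale)
        finally show ?thesis by (simp add: mult_ac)
      qed
      ultimately have "a * \<epsilon> / 4 * p powr (1 / real \<tau>) \<le> 1 - (1 - density a p) ^ H"
        by linarith
      then have "(a * \<epsilon> / 4 * p powr (1 / real \<tau>)) ^ \<tau> \<le> (1 - (1 - density a p) ^ H) ^ \<tau>"
        using a \<epsilon> by (intro power_mono) auto
      then have "(a * \<epsilon> / 4) ^ \<tau> * p \<le> (1 - (1 - density a p) ^ H) ^ \<tau>"
        by (simp only: power_mult_distrib root_power[OF p0])
      moreover have "\<epsilon> / (4 * real \<tau> * p) \<le> real X"
        using half_le_nat_floor[OF elim(5)] by (simp add: X_def)
      ultimately have "\<epsilon> / (4 * real \<tau> * p) * ((a * \<epsilon> / 4) ^ \<tau> * p) \<le> e'"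
        unfolding e'_def using a \<epsilon> p0 by (intro mult_mono) auto
      then show ?thesis using p0 by (simp add: e_def)
    qed
    have e0: "e > 0" using a \<epsilon> tau by (simp add: e_def)
    have M: "1 + \<tau> * X + n \<le> M"
    proof -
      have "real X \<le> \<epsilon> / (2 * real \<tau> * p)" using elim(5) by (simp add: X_def)
      then have "real \<tau> * real X \<le> real \<tau> * (\<epsilon> / (2 * real \<tau> * p))" by (intro mult_left_mono) auto
      also have "\<dots> = \<epsilon> / (2 * p)" using tau by simp
      finally have "real \<tau> * real X \<le> \<epsilon> / (2 * p)" .
      moreover have "\<epsilon> / p = \<epsilon> / (2 * p) + \<epsilon> / (2 * p)" by simp
      ultimately have "real (1 + \<tau> * X + n) \<le> \<epsilon> / p"
        using n elim(3) by (simp add: algebra_simps)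
      then show ?thesis unfolding M_def by (rule le_nat_floor)
    qed
    have bound: "F.prob (eventually_set Blue 0) \<le>
        1 - (1 - p) ^ (2 * M + 1) * ((1 - k')\<^sup>2 * (e' / (1 + e')))\<^sup>2"
      unfolding k'_def e'_def n_def
      by (rule prob_origin_not_blue) (use k k' e0 e' M in \<open>simp_all add: k'_def e'_def n_def\<close>)
    have "(1 - 3 * \<epsilon>) * ((1 - \<kappa>)\<^sup>2 * (e / (1 + e)))\<^sup>2 \<le>
        (1 - p) ^ (2 * M + 1) * ((1 - k')\<^sup>2 * (e' / (1 + e')))\<^sup>2"
    proof (intro mult_mono power_mono)
      have "real M \<le> \<epsilon> / p" using p0 \<epsilon> by (simp add: M_def)
      then have "real M * p \<le> \<epsilon>" using p0 by (simp add: field_simps)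
      then have "1 - 3 * \<epsilon> \<le> 1 + real (2 * M + 1) * (- p)" using elim(6) by (simp add: algebra_simps)
      also have "\<dots> \<le> (1 + - p) ^ (2 * M + 1)"
        using p0 q pq by (intro Bernoulli_inequality) auto
      finally show "1 - 3 * \<epsilon> \<le> (1 - p) ^ (2 * M + 1)" by simp
      show "e / (1 + e) \<le> e' / (1 + e')" using e0 e' by (simp add: field_simps)
    qed (use k k' e0 e' pq q p0 \<epsilon> in auto)
    with bound show ?case unfolding prob_origin_blue_eq by linarith
  qed
qed

end

text \<open>The growing factor is the weight of walls seeded up to scale \<open>k + 1\<close>, the
  decaying one bounds a porous layer at scale \<open>k\<close>, above or below row 0.\<close>

lemma summable_geometric_exp:
  fixes c :: real
  assumes "c > 0"
  shows "summable (\<lambda>k. 2 ^ (Suc k * t) * (2 * exp (- c * 2 ^ k)))"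
proof (rule summable_comparison_test_ev)
  have "\<forall>\<^sub>F y in at_top. 2 ^ t * y powr real t * (2 * exp (- c * y)) \<le> 1 / (y::real)"
    using assms by real_asymp
  moreover have "filterlim (\<lambda>k::nat. 2 ^ k :: real) at_top sequentially" by real_asymp
  ultimately have "\<forall>\<^sub>F k in sequentially.
      2 ^ t * (2 ^ k) powr real t * (2 * exp (- c * 2 ^ k)) \<le> 1 / (2 ^ k :: real)"
    by (rule eventually_compose_filterlim)
  then show "\<forall>\<^sub>F k in sequentially.
      norm (2 ^ (Suc k * t) * (2 * exp (- c * 2 ^ k))) \<le> (1 / 2 :: real) ^ k"
  proof eventually_elim
    case (elim k)
    have "2 ^ (Suc k * t) = 2 ^ t * (2 ^ k :: real) powr real t"
      by (simp add: powr_realpow power_add power_mult mult.commute)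
    then show ?case using elim by (simp add: power_one_over)
  qed
qed (simp add: summable_geometric)

section \<open>The lower bound along dyadic scales\<close>

context competition
begin

text \<open>The choice of \<open>gain\<close> and \<open>stretch\<close> is irrelevant beyond \<open>0 < (\<tau> + 1) stretch < gain\<close> and
  \<open>gain_bounds\<close>: seeds up to distance \<open>p powr (- stretch)\<close> times \<open>scale p\<close> are treated as near, and a layer of such
  a height is choked with probability at most of order \<open>p powr gain\<close>.\<close>

definition decay :: real where
  "decay = 1 / (2 * real \<rho>) * (r / (4 * real \<rho>)) ^ \<rho>"

definition gain :: real where
  "gain = 1 / (4 * (real \<tau> + 1) * (real \<rho> + 1))"

definition stretch :: real where
  "stretch = gain / (real \<tau> + 2)"

definition total :: real where
  "total = (\<Sum>k. 2 ^ (Suc k * \<tau>) * (2 * exp (- decay * 2 ^ k)))"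

lemma decay_pos: "decay > 0"
  using rho r by (simp add: decay_def)

lemma stretch_pos: "stretch > 0"
  by (simp add: stretch_def gain_def)

lemma gain_stretch: "gain = stretch * (real \<tau> + 2)"
  by (simp add: stretch_def)

text \<open>The right-hand sides are the exponents of \<open>p\<close> in the two terms of the
  choking bound at height \<open>p powr (- stretch) * scale p\<close>: one seeded column, and one of
  \<open>D\<close> runs of \<open>\<tau>\<close> seeded columns.\<close>

lemma gain_bounds:
  "gain \<le> 1 / real \<tau> - stretch"
  "gain \<le> 1 - real \<rho> / (real \<rho> + 1) - (real \<tau> + 1) * stretch"
proof -
  have "0 \<le> real \<tau> * stretch" using stretch_pos by simp
  then have g: "stretch > 0" "gain > 0" "stretch \<le> gain" "(real \<tau> + 1) * stretch \<le> gain"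
    using stretch_pos unfolding gain_stretch distrib_left distrib_right mult.commute[of stretch] by linarith+
  have "gain \<le> 1 / (2 * real \<tau>)"
  proof -
    have "2 * real \<tau> \<le> 4 * (real \<tau> + 1) * (real \<rho> + 1)" by (simp add: algebra_simps)
    then show ?thesis unfolding gain_def using tau by (intro divide_left_mono) auto
  qed
  moreover have "1 / real \<tau> = 1 / (2 * real \<tau>) + 1 / (2 * real \<tau>)" by simp
  ultimately show "gain \<le> 1 / real \<tau> - stretch" using g by linarith
  have "gain \<le> 1 / (2 * (real \<rho> + 1))"
  proof -
    have "2 * (real \<rho> + 1) \<le> 4 * (real \<tau> + 1) * (real \<rho> + 1)" by (intro mult_right_mono) auto
    then show ?thesis unfolding gain_def by (intro divide_left_mono) auto
  qed
  moreover have "1 - real \<rho> / (real \<rho> + 1) = 1 / (2 * (real \<rho> + 1)) + 1 / (2 * (real \<rho> + 1))"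
  proof -
    have "real \<rho> + 1 > 0" by (simp add: add_nonneg_pos)
    then show ?thesis by (simp add: field_simps)
  qed
  ultimately show "gain \<le> 1 - real \<rho> / (real \<rho> + 1) - (real \<tau> + 1) * stretch" using g by linarith
qed

lemma total_summable: "summable (\<lambda>k. 2 ^ (Suc k * \<tau>) * (2 * exp (- decay * 2 ^ k)))"
  by (rule summable_geometric_exp[OF decay_pos])

lemma total_nonneg: "total \<ge> 0"
  unfolding total_def by (intro suminf_nonneg total_summable) simp

end

context competition_field
begin

text \<open>A row has a blue seed with probability \<open>V\<close> at least
  \<open>p * H * r / (4 * \<rho>)\<close>, and there are at least \<open>H / (2 * \<rho>)\<close>
  blocks. So the expected number of complete blocks is at least
  \<open>decay * p ^ \<rho> * H ^ (\<rho> + 1)\<close>, which explains \<open>decay\<close>; by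
  \<open>scale_power\<close> this is at least \<open>decay * (2 ^ k) ^ (\<rho> + 1)\<close>.\<close>

lemma porous_bound_le:
  assumes p0: "p > 0" and H: "\<rho> \<le> H" "2 ^ k * scale p \<le> real H"
    and D: "real H * r / (2 * real \<rho>) \<le> real (D + 1)" "real (D + 1) * p \<le> 1"
  shows "porous_bound D H \<le> exp (- decay * 2 ^ k)"
proof -
  define V where "V = 1 - (1 - p) ^ (D + 1)"
  define n where "n = H div \<rho>"
  have p1: "p \<le> 1" using q pq by simp
  have V1: "V \<le> 1" "0 \<le> V"
    using p0 p1 power_le_one[of "1 - p" "D + 1"] zero_le_power[of "1 - p" "D + 1"]
    unfolding V_def by linarith+
  have "p * real H * r / (4 * real \<rho>) = (real H * r / (2 * real \<rho>)) * p / 2" by simp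
  also have "\<dots> \<le> real (D + 1) * p / 2" using D(1) p0 by (intro divide_right_mono mult_right_mono) auto
  also have "\<dots> \<le> V" unfolding V_def using p0 p1 D(2) by (intro one_minus_power_ge) auto
  finally have b: "(p * real H * r / (4 * real \<rho>)) ^ \<rho> \<le> V ^ \<rho>" using p0 r by (intro power_mono) auto
  have n: "real H / (2 * real \<rho>) \<le> real n"
  proof -
    have "1 \<le> n" using H(1) rho by (simp add: n_def div_greater_zero_iff Suc_le_eq)
    have "H < \<rho> * (n + 1)" using rho by (simp add: n_def dividend_less_times_div)
    also have "\<dots> \<le> \<rho> * (2 * n)" using \<open>1 \<le> n\<close> by (intro mult_left_mono) auto
    finally have "real H \<le> real (\<rho> * (2 * n))" by (simp only: of_nat_le_iff)
    then show ?thesis using rho by (simp add: field_simps)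
  qed
  \<comment> \<open>The exponent \<open>\<rho> + 1\<close> is given up: growth linear in
    \<open>2 ^ k\<close> is all that summability needs.\<close>
  have "decay * 2 ^ k \<le> decay * (2 ^ k) ^ (\<rho> + 1)"
    using decay_pos by (intro mult_left_mono self_le_power) auto
  also have "\<dots> = decay * (2 ^ k) ^ (\<rho> + 1) * (p ^ \<rho> * scale p ^ (\<rho> + 1))"
    by (simp only: scale_power[OF p0] mult_1_right)
  also have "\<dots> = decay * p ^ \<rho> * (2 ^ k * scale p) ^ (\<rho> + 1)"
    by (simp add: power_mult_distrib algebra_simps)
  also have "\<dots> \<le> decay * p ^ \<rho> * real H ^ (\<rho> + 1)"
    using H(2) p0 decay_pos scale_pos[OF p0] by (intro mult_left_mono power_mono) auto
  also have "\<dots> = real H / (2 * real \<rho>) * (p * real H * r / (4 * real \<rho>)) ^ \<rho>"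
    by (simp add: decay_def power_mult_distrib power_divide)
  also have "\<dots> \<le> real n * V ^ \<rho>"
    using n b p0 r V1 by (intro mult_mono) auto
  finally have main: "decay * 2 ^ k \<le> real n * V ^ \<rho>" .
  have "porous_bound D H = (1 - V ^ \<rho>) ^ n" by (simp add: porous_bound_def V_def n_def)
  also have "\<dots> \<le> exp (- (V ^ \<rho>)) ^ n"
    using exp_ge_add_one_self[of "- (V ^ \<rho>)"] V1 by (intro power_mono) (auto simp: power_le_one)
  also have "\<dots> = exp (- (real n * V ^ \<rho>))" by (simp add: exp_of_nat_mult[symmetric])
  also have "\<dots> \<le> exp (- decay * 2 ^ k)" using main by simp
  finally show ?thesis .
qed

end

context competition
begin

lemma choked_bound_le:
  fixes a J :: real
  defines "C \<equiv> 6 * J * a + 2 * J * r / real \<rho> * (6 * J * a) ^ \<tau>"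
  assumes field: "competition_field \<rho> \<tau> r p (density a p)" and p0: "p > 0" and a: "a > 0" and J: "J > 0"
    and H: "real H \<le> 2 * J * p powr - stretch * scale p" and D: "real D \<le> real H * r / real \<rho>"
  shows "competition_field.choked_bound \<tau> (density a p) D H \<le> C * p powr gain"
proof -
  interpret competition_field \<rho> \<tau> r p "density a p" by (rule field)
  let ?w = "p powr - stretch"
  have p1: "p \<le> 1" using q pq by simp
  have Hq: "3 * real H * density a p \<le> 6 * J * a * p powr (1 / real \<tau> - stretch)"
  proof -
    have "3 * real H * density a p \<le> 3 * (2 * J * ?w * scale p) * density a p"
      using H a by (intro mult_right_mono mult_left_mono) auto
    also have "\<dots> = 6 * J * ?w * (density a p * scale p)" by (simp add: mult_ac)
    also have "\<dots> = 6 * J * a * (p powr - stretch * p powr (1 / real \<tau>))" by (simp only: density_scale) (simp add: mult_ac)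
    also have "p powr - stretch * p powr (1 / real \<tau>) = p powr (1 / real \<tau> - stretch)"
      by (simp flip: powr_add)
    finally show ?thesis .
  qed
  have first: "3 * real H * density a p \<le> 6 * J * a * p powr gain"
    using gain_bounds(1) p0 p1 a J
    by (intro order.trans[OF Hq] mult_left_mono powr_mono') auto
  have "real D * (3 * real H * density a p) ^ \<tau> \<le>
      (2 * J * ?w * scale p * r / real \<rho>) * (6 * J * a * p powr (1 / real \<tau> - stretch)) ^ \<tau>"
  proof (rule mult_mono[OF _ power_mono[OF Hq]])
    have "real H * r / real \<rho> \<le> (2 * J * ?w * scale p) * r / real \<rho>"
      using H r by (intro divide_right_mono mult_right_mono) auto
    then show "real D \<le> 2 * J * ?w * scale p * r / real \<rho>" using D by linarith
  qed (use a J r scale_pos[OF p0] in auto)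
  also have "\<dots> = 2 * J * r / real \<rho> * (6 * J * a) ^ \<tau> *
      (p powr - stretch * scale p * (p powr (1 / real \<tau> - stretch)) ^ \<tau>)"
    by (simp add: power_mult_distrib)
  also have "p powr - stretch * scale p * (p powr (1 / real \<tau> - stretch)) ^ \<tau> =
      p powr (1 - real \<rho> / (real \<rho> + 1) - (real \<tau> + 1) * stretch)"
  proof -
    have "real \<tau> * (1 / real \<tau> - stretch) = 1 - real \<tau> * stretch" using tau by (simp add: algebra_simps)
    then have "p powr - stretch * scale p * (p powr (1 / real \<tau> - stretch)) ^ \<tau> =
        p powr (- stretch + - (real \<rho> / (real \<rho> + 1)) + (1 - real \<tau> * stretch))"
      using p0 by (simp only: powr_power powr_add scale_def)
    then show ?thesis by (simp add: algebra_simps)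
  qed
  also have "2 * J * r / real \<rho> * (6 * J * a) ^ \<tau> * p powr (1 - real \<rho> / (real \<rho> + 1) - (real \<tau> + 1) * stretch) \<le>
      2 * J * r / real \<rho> * (6 * J * a) ^ \<tau> * p powr gain"
    using gain_bounds(2) p0 p1 a J r by (intro mult_left_mono powr_mono') auto
  finally show ?thesis using first by (simp add: choked_bound_def C_def algebra_simps)
qed

text \<open>A window of length \<open>\<epsilon> / p\<close> contains a blue seed with probability
  at least \<open>\<epsilon> / (2 + \<epsilon>)\<close>. Each of its
  \<open>(\<epsilon> / p)\<^sup>2\<close> pairs costs \<open>p\<close> for the blue seed and
  \<open>14 ^ \<tau> * (1 + total) * a ^ \<tau> * p\<close> for the wall. All other errors vanish
  with \<open>p\<close> and go into \<open>\<theta>\<close>.\<close>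

lemma origin_blue_lower:
  fixes a \<epsilon> \<theta> :: real
  assumes a: "a > 0" and \<epsilon>: "\<epsilon> > 0" and \<theta>: "\<theta> > 0"
  shows "\<forall>\<^sub>F p in at_right 0. prob_origin_blue (blue_nbhd \<tau>) (red_nbhd \<rho>) r p (density a p) \<ge>
    \<epsilon> / (2 + \<epsilon>) - \<epsilon>\<^sup>2 * (14 ^ \<tau> * (1 + total)) * a ^ \<tau> - \<theta>"
proof -
  \<comment> \<open>With \<open>J * gain \<ge> 3\<close>, choking all \<open>J\<close> layers has
    probability of order at most \<open>p ^ 3\<close>, which beats the
    \<open>(\<epsilon> / p)\<^sup>2\<close> pairs. As \<open>J\<close> is a power of 2,
    \<open>J\<close> layers at the dyadic scale \<open>k'\<close> fill exactly the height of scale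
    \<open>m = k' + s\<close>.\<close>
  obtain s :: nat where s: "3 / gain < real s" using reals_Archimedean2 by blast
  define J :: nat where "J = 2 ^ s"
  have gain_pos: "gain > 0" by (simp add: gain_def)
  have J0: "real J > 0" by (simp add: J_def)
  have J3: "3 \<le> gain * real J"
  proof -
    have "real s < real J" unfolding J_def by (simp only: of_nat_less_iff less_exp)
    then have "3 / gain \<le> real J" using s by linarith
    then show ?thesis using gain_pos by (simp add: field_simps)
  qed
  define C where "C = 6 * real J * a + 2 * real J * r / real \<rho> * (6 * real J * a) ^ \<tau>"
  have C0: "C > 0" using a J0 r rho by (auto simp: C_def intro!: add_pos_nonneg)
  \<comment> \<open>The constant for choked layers, summed over all scales up to
    \<open>m\<close>.\<close>
  define C3 where "C3 = 14 ^ \<tau> * a ^ \<tau> * (2 * C * real J ^ (\<tau> + 1))"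
  have C30: "C3 > 0" using a C0 J0 by (simp add: C3_def)
  define Far where "Far p = 2 * (real J * exp (- decay / 2 * p powr - stretch) + C ^ J * p ^ 3)" for p :: real
  define err where "err p = 14 * real J * a * p powr (1 / real \<tau> - stretch) + Far p +
    \<epsilon>\<^sup>2 * Far p / p\<^sup>2 + \<epsilon>\<^sup>2 * C3 * p powr stretch" for p :: real
  have err_0: "(err \<longlongrightarrow> 0) (at_right 0)"
  proof -
    have "((\<lambda>p. 14 * real J * a * p powr (1 / real \<tau> - stretch)) \<longlongrightarrow> 0) (at_right 0)"
    proof -
      have "((\<lambda>p::real. 14 * real J * a * p powr b) \<longlongrightarrow> 0) (at_right 0)" if "b > 0" for b
        using that by real_asymp
      from this[of "1 / real \<tau> - stretch"] show ?thesis using gain_bounds(1) gain_pos by simp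
    qed
    moreover have "((\<lambda>p. exp (- decay / 2 * p powr - stretch)) \<longlongrightarrow> 0) (at_right 0)"
      using decay_pos stretch_pos by real_asymp
    moreover have exp2: "((\<lambda>p. exp (- decay / 2 * p powr - stretch) / p\<^sup>2) \<longlongrightarrow> 0) (at_right 0)"
      using decay_pos stretch_pos by real_asymp
    moreover have "((\<lambda>p::real. p ^ 3) \<longlongrightarrow> 0) (at_right 0)" "((\<lambda>p::real. p ^ 3 / p\<^sup>2) \<longlongrightarrow> 0) (at_right 0)"
      by real_asymp+
    moreover have "((\<lambda>p. p powr stretch) \<longlongrightarrow> 0) (at_right 0)"
      using stretch_pos by real_asymp
    ultimately have "((\<lambda>p. 14 * real J * a * p powr (1 / real \<tau> - stretch) +
        2 * (real J * exp (- decay / 2 * p powr - stretch) + C ^ J * p ^ 3) +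
        \<epsilon>\<^sup>2 * (2 * (real J * (exp (- decay / 2 * p powr - stretch) / p\<^sup>2) + C ^ J * (p ^ 3 / p\<^sup>2))) +
        \<epsilon>\<^sup>2 * C3 * p powr stretch) \<longlongrightarrow>
        0 + 2 * (real J * 0 + C ^ J * 0) + \<epsilon>\<^sup>2 * (2 * (real J * 0 + C ^ J * 0)) + \<epsilon>\<^sup>2 * C3 * 0) (at_right 0)"
      by (intro tendsto_intros)
    then show ?thesis unfolding err_def Far_def by (simp add: add_divide_distrib algebra_simps)
  qed
  have ev_err: "\<forall>\<^sub>F p in at_right 0. err p < \<theta>" by (rule order_tendstoD(2)[OF err_0 \<theta>])
  have ev_large: "\<forall>\<^sub>F p in at_right 0. C \<le> scale p" for C
  proof -
    have "filterlim (\<lambda>p::real. p powr - b) at_top (at_right 0)" if "b > 0" for b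
      using that by real_asymp
    from this[OF rho_frac(1)] show ?thesis unfolding scale_def filterlim_at_top by blast
  qed
  have ev_D: "\<forall>\<^sub>F p in at_right 0. (2 * real J * p powr - stretch * scale p * r / real \<rho> + 1) * p < 1"
  proof -
    let ?b = "1 - real \<rho> / (real \<rho> + 1) - stretch"
    have b: "?b > 0"
    proof -
      have "stretch \<le> (real \<tau> + 1) * stretch" using stretch_pos by simp
      then show ?thesis using gain_bounds(2) gain_pos by linarith
    qed
    have "((\<lambda>p::real. 2 * real J * r / real \<rho> * p powr b + p) \<longlongrightarrow> 2 * real J * r / real \<rho> * 0 + 0) (at_right 0)"
      if "b > 0" for b
    proof (intro tendsto_add tendsto_mult tendsto_const)
      show "((\<lambda>p::real. p powr b) \<longlongrightarrow> 0) (at_right 0)" using that by real_asymp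
    qed real_asymp
    from order_tendstoD(2)[OF this[OF b], of 1]
    have "\<forall>\<^sub>F p in at_right 0. 2 * real J * r / real \<rho> * p powr ?b + p < 1" by simp
    with eventually_at_right_less[of 0] show ?thesis
    proof eventually_elim
      case (elim p)
      have "p powr ?b = p powr (- stretch + - (real \<rho> / (real \<rho> + 1)) + 1)" by (simp add: algebra_simps)
      also have "\<dots> = p powr - stretch * scale p * p"
        using elim(1) by (simp only: powr_add scale_def powr_one)
      finally show ?case using elim(2) by (simp add: algebra_simps)
    qed
  qed
  have ev_p: "\<forall>\<^sub>F p in at_right (0::real). p < \<epsilon>"
    by (rule order_tendstoD(2)[OF tendsto_ident_at \<epsilon>])
  show ?thesis
    using competition_field_eventually[OF a] eventually_at_right_less[of 0] ev_err ev_D ev_p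
      ev_large[of 1] ev_large[of "2 * real \<tau> * real \<rho> / r"] ev_large[of "real \<rho>"]
  proof eventually_elim
    case (elim p)
    interpret competition_field \<rho> \<tau> r p "density a p" by (rule elim(1))
    define w where "w = p powr - stretch"
    define k' where "k' = nat \<lfloor>log 2 w\<rfloor>"
    define m where "m = k' + s"
    define G where "G k = 2 ^ k * nat \<lceil>scale p\<rceil>" for k
    \<comment> \<open>The largest \<open>D\<close> for which red moves by at most \<open>G k\<close>
      in time \<open>D + \<tau>\<close>. By \<open>Gr\<close> the subtraction does not truncate, and
      \<open>D k + 1\<close> keeps at least half of \<open>G k * r / \<rho>\<close>.\<close>
    define D where "D k = nat \<lfloor>real (G k) * r / real \<rho>\<rfloor> - \<tau>" for k
    define M where "M = nat \<lfloor>\<epsilon> / p\<rfloor>"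
    define x where "x = p powr (1 / real \<tau>)"
    have p0: "p > 0" by (rule elim(2))
    have p1: "p \<le> 1" using q pq by simp
    have w1: "1 \<le> w" using p0 p1 stretch_pos powr_mono'[of "- stretch" 0 p] by (simp add: w_def)
    have w2: "2 ^ k' \<le> w" "w \<le> 2 * 2 ^ k'"
    proof -
      have l: "0 \<le> log 2 w" using w1 by simp
      have "real k' \<le> log 2 w" using l by (simp add: k'_def)
      then have "2 powr real k' \<le> 2 powr (log 2 w)" by (intro powr_mono) auto
      then show "2 ^ k' \<le> w" using w1 by (simp add: powr_realpow)
      have "log 2 w \<le> real k' + 1" using l unfolding k'_def by linarith
      then have "2 powr (log 2 w) \<le> 2 powr (real k' + 1)" by (intro powr_mono) auto
      then show "w \<le> 2 * 2 ^ k'" using w1 by (simp add: powr_realpow powr_add)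
    qed
    have m2: "(2::real) ^ m \<le> real J * w" using w2(1) by (simp add: m_def J_def power_add)
    have ceil: "scale p \<le> real (nat \<lceil>scale p\<rceil>)" "real (nat \<lceil>scale p\<rceil>) \<le> 2 * scale p"
      using elim(6) by linarith+
    have G: "2 ^ k * scale p \<le> real (G k)" "real (G k) \<le> 2 * 2 ^ k * scale p" for k
      using ceil by (simp_all add: G_def)
    have pow1: "(1::real) \<le> 2 ^ k" for k by simp
    have G_scale: "scale p \<le> real (G k)" for k
      using mult_right_mono[OF pow1[of k], of "scale p"] G(1)[of k] scale_pos[OF p0] by linarith
    have G_max: "real (G k) \<le> 2 * real J * w * scale p" if "k \<le> m" for k
    proof -
      have "(2::real) ^ k \<le> real J * w" using m2 power_increasing[OF that, of "2::real"] by linarith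
      then have "2 * 2 ^ k * scale p \<le> 2 * (real J * w) * scale p"
        using scale_pos[OF p0] by (intro mult_right_mono mult_left_mono) auto
      then show ?thesis using G(2)[of k] by (simp add: mult.assoc)
    qed
    have Gr: "2 * real \<tau> \<le> real (G k) * r / real \<rho>" for k
    proof -
      have "2 * real \<tau> \<le> scale p * r / real \<rho>" using elim(7) r rho by (simp add: field_simps)
      also have "\<dots> \<le> real (G k) * r / real \<rho>"
        using G_scale[of k] r by (intro divide_right_mono mult_right_mono) auto
      finally show ?thesis .
    qed
    have Dk: "real (D k + \<tau>) \<le> real (G k) * r / real \<rho>"
      "real (G k) * r / (2 * real \<rho>) \<le> real (D k + 1)" for k
    proof -
      let ?y = "real (G k) * r / real \<rho>"
      have y: "real (nat \<lfloor>?y\<rfloor>) \<le> ?y" "?y < real (nat \<lfloor>?y\<rfloor>) + 1"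
        using Gr[of k] by (simp, linarith)
      have "\<tau> \<le> nat \<lfloor>?y\<rfloor>" using Gr[of k] by (intro le_nat_floor) simp
      then have "real (D k) = real (nat \<lfloor>?y\<rfloor>) - real \<tau>" by (simp add: D_def of_nat_diff)
      moreover have "d + t \<le> z \<and> z / 2 \<le> d + 1" if "d = f - t" "f \<le> z" "z < f + 1" "2 * t \<le> z"
        for d f t z :: real using that by auto
      ultimately have "real (D k) + real \<tau> \<le> ?y" "?y / 2 \<le> real (D k) + 1"
        using y Gr[of k] by blast+
      then show "real (D k + \<tau>) \<le> ?y" "real (G k) * r / (2 * real \<rho>) \<le> real (D k + 1)"
        by (simp_all add: mult.commute)
    qed
    have DG: "real (D k) \<le> real (G k) * r / real \<rho>" for k using Dk(1)[of k] by simp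
    have porous: "porous_bound (D k) (G k) \<le> exp (- decay * 2 ^ k)" if "k \<le> m" for k
    proof (rule porous_bound_le[OF p0 _ G(1) Dk(2)])
      have "real \<rho> \<le> real (G k)" using elim(8) G_scale[of k] by linarith
      then show "\<rho> \<le> G k" by simp
      have "real (D k + 1) \<le> 2 * real J * w * scale p * r / real \<rho> + 1"
      proof -
        have "real (G k) * r / real \<rho> \<le> 2 * real J * w * scale p * r / real \<rho>"
          using G_max[OF that] r by (intro divide_right_mono mult_right_mono) auto
        then show ?thesis using DG[of k] by simp
      qed
      then have "real (D k + 1) * p \<le> (2 * real J * w * scale p * r / real \<rho> + 1) * p"
        using p0 by (intro mult_right_mono) auto
      then show "real (D k + 1) * p \<le> 1" using elim(4) by (simp add: w_def)
    qed
    have choked: "choked_bound (D k) (G k) \<le> C * p powr gain" if "k \<le> m" for k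
      unfolding C_def
      by (rule choked_bound_le[OF elim(1) p0 a J0 G_max[OF that, unfolded w_def] DG])
    \<comment> \<open>Here \<open>6 * G k + 1 \<le> 7 * G k\<close>, and rounding up in
      \<open>G\<close> costs a factor 2, whence 14.\<close>
    have seeds: "real (6 * G k + 1) * density a p \<le> 14 * 2 ^ k * (a * x)" for k
    proof -
      have "1 \<le> real (G k)" using elim(6) G_scale[of k] by linarith
      then have "real (6 * G k + 1) \<le> 14 * 2 ^ k * scale p" using G(2)[of k] by simp
      then have "real (6 * G k + 1) * density a p \<le> 14 * 2 ^ k * scale p * density a p"
        using q by (intro mult_right_mono)
      also have "\<dots> = 14 * 2 ^ k * (density a p * scale p)" by (simp add: mult_ac)
      finally show ?thesis by (simp only: density_scale x_def)
    qed
    have seeds_pow: "(real (6 * G k + 1) * density a p) ^ \<tau> \<le> 14 ^ \<tau> * a ^ \<tau> * p * 2 ^ (k * \<tau>)" for k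
    proof -
      have "(real (6 * G k + 1) * density a p) ^ \<tau> \<le> (14 * 2 ^ k * (a * x)) ^ \<tau>"
        using q by (intro power_mono seeds) auto
      also have "\<dots> = 14 ^ \<tau> * a ^ \<tau> * x ^ \<tau> * 2 ^ (k * \<tau>)" by (simp add: power_mult_distrib power_mult)
      finally show ?thesis by (simp only: x_def root_power[OF p0])
    qed
    define far where "far = 2 * (real J * porous_bound (D k') (G k') + choked_bound (D k') (G k') ^ J)"
    define near where "near = (real (6 * G 0 + 1) * density a p) ^ \<tau> +
      (\<Sum>k<m. (real (6 * G (Suc k) + 1) * density a p) ^ \<tau> *
        (2 * (porous_bound (D k) (G k) + choked_bound (D k) (G k))))"
    have lower: "F.prob (eventually_set Blue 0) \<ge>
        1 - (1 - p) ^ M - (real (6 * G m + 1) * density a p + far + (real M)\<^sup>2 * (p * near + far))"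
      unfolding far_def near_def
      by (rule prob_origin_blue_ge[OF Dk(1) Dk(1)]) (simp add: G_def J_def m_def power_add)
    have far: "far \<le> Far p"
    proof -
      have k'm: "k' \<le> m" by (simp add: m_def)
      have "exp (- decay * 2 ^ k') \<le> exp (- decay / 2 * w)"
      proof -
        have "decay * w \<le> decay * (2 * 2 ^ k')" using w2(2) decay_pos by (intro mult_left_mono) auto
        then show ?thesis by simp
      qed
      then have 1: "porous_bound (D k') (G k') \<le> exp (- decay / 2 * w)" using porous[OF k'm] by linarith
      have "choked_bound (D k') (G k') ^ J \<le> (C * p powr gain) ^ J"
        by (intro power_mono choked[OF k'm] choked_bound_nonneg)
      also have "\<dots> = C ^ J * p powr (real J * gain)" using p0 by (simp add: power_mult_distrib powr_power)
      also have "\<dots> \<le> C ^ J * p powr 3"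
        using J3 p0 p1 C0 by (intro mult_left_mono powr_mono') (auto simp: mult.commute)
      also have "p powr 3 = p ^ 3" using p0 by (simp add: powr_numeral)
      finally have "choked_bound (D k') (G k') ^ J \<le> C ^ J * p ^ 3" .
      then show ?thesis unfolding far_def Far_def using 1 J0
        by (intro mult_left_mono add_mono) (auto simp: w_def)
    qed
    have near: "near \<le> 14 ^ \<tau> * a ^ \<tau> * p * (1 + total) + C3 * p * p powr stretch"
    proof -
      let ?A = "14 ^ \<tau> * a ^ \<tau> * p"
      have A0: "?A \<ge> 0" using a p0 by simp
      have "(\<Sum>k<m. (real (6 * G (Suc k) + 1) * density a p) ^ \<tau> *
          (2 * (porous_bound (D k) (G k) + choked_bound (D k) (G k)))) \<le>
          (\<Sum>k<m. ?A * 2 ^ (Suc k * \<tau>) * (2 * (exp (- decay * 2 ^ k) + C * p powr gain)))"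
      proof (intro sum_mono mult_mono[OF seeds_pow])
        fix k assume "k \<in> {..<m}"
        then have k: "k \<le> m" by simp
        show "2 * (porous_bound (D k) (G k) + choked_bound (D k) (G k)) \<le> 2 * (exp (- decay * 2 ^ k) + C * p powr gain)"
          using porous[OF k] choked[OF k] by simp
        show "0 \<le> 2 * (porous_bound (D k) (G k) + choked_bound (D k) (G k))"
          using choked_bound_nonneg porous_bound_nonneg by simp
      qed (use A0 in simp)
      also have "\<dots> = ?A * (\<Sum>k<m. 2 ^ (Suc k * \<tau>) * (2 * exp (- decay * 2 ^ k))) +
          ?A * (2 * C * p powr gain) * (\<Sum>k<m. 2 ^ (Suc k * \<tau>))"
        by (simp add: sum_distrib_left sum.distrib[symmetric] algebra_simps)
      also have "\<dots> \<le> ?A * total + ?A * (2 * C * p powr gain) * (real J * w) ^ (\<tau> + 1)"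
      proof (intro add_mono mult_left_mono)
        show "(\<Sum>k<m. 2 ^ (Suc k * \<tau>) * (2 * exp (- decay * 2 ^ k))) \<le> total"
          unfolding total_def by (intro sum_le_suminf total_summable) auto
        \<comment> \<open>Each of the \<open>m\<close> terms is at most the last one, and
          \<open>m \<le> 2 ^ m\<close>. This costs one more power of \<open>w\<close>, for which
          \<open>gain = stretch * (\<tau> + 2)\<close> leaves room.\<close>
        have "(\<Sum>k<m. (2::real) ^ (Suc k * \<tau>)) \<le> (\<Sum>k<m. 2 ^ (m * \<tau>))"
          by (intro sum_mono power_increasing mult_right_mono) auto
        also have "\<dots> \<le> 2 ^ m * 2 ^ (m * \<tau>)"
          by (simp add: less_imp_le[OF of_nat_less_two_power])
        also have "\<dots> = (2 ^ m) ^ (\<tau> + 1)" by (simp add: power_mult)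
        also have "\<dots> \<le> (real J * w) ^ (\<tau> + 1)" by (intro power_mono m2) auto
        finally show "(\<Sum>k<m. (2::real) ^ (Suc k * \<tau>)) \<le> (real J * w) ^ (\<tau> + 1)" .
      qed (use A0 C0 in auto)
      also have "?A * (2 * C * p powr gain) * (real J * w) ^ (\<tau> + 1) =
          C3 * p * (p powr gain * w ^ (\<tau> + 1))"
        by (simp only: C3_def power_mult_distrib) (simp add: mult_ac)
      also have "p powr gain * w ^ (\<tau> + 1) = p powr stretch"
      proof -
        have "p powr gain * w ^ (\<tau> + 1) = p powr (gain + real (\<tau> + 1) * - stretch)"
          unfolding w_def using p0 by (simp only: powr_power powr_add)
        also have "gain + real (\<tau> + 1) * - stretch = stretch" by (simp add: gain_stretch algebra_simps)
        finally show ?thesis .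
      qed
      finally show ?thesis using seeds_pow[of 0] unfolding near_def by (simp add: algebra_simps)
    qed
    have seeds_m: "real (6 * G m + 1) * density a p \<le> 14 * real J * a * p powr (1 / real \<tau> - stretch)"
    proof -
      have "real (6 * G m + 1) * density a p \<le> 14 * (real J * w) * (a * x)"
        using m2 a by (intro order.trans[OF seeds] mult_right_mono mult_left_mono) (auto simp: x_def)
      also have "\<dots> = 14 * real J * a * (w * x)" by simp
      also have "w * x = p powr (1 / real \<tau> - stretch)" by (simp add: w_def x_def flip: powr_add)
      finally show ?thesis .
    qed
    have "1 \<le> \<epsilon> / p" using elim(5) p0 by simp
    then have M: "\<epsilon> / p / 2 \<le> real M" "real M \<le> \<epsilon> / p"
      using half_le_nat_floor[of "\<epsilon> / p"] \<epsilon> p0 by (simp_all add: M_def)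
    have some: "\<epsilon> / (2 + \<epsilon>) \<le> 1 - (1 - p) ^ M"
    proof -
      have "\<epsilon> / 2 \<le> real M * p" using M(1) p0 by (simp add: field_simps)
      then have "1 / (1 + real M * p) \<le> 1 / (1 + \<epsilon> / 2)" using \<epsilon> by (intro divide_left_mono) auto
      also have "\<dots> = 1 - \<epsilon> / (2 + \<epsilon>)" using \<epsilon> by (simp add: field_simps)
      finally show ?thesis using one_minus_power_le[of p M] p0 p1 by simp
    qed
    have Far0: "Far p \<ge> 0" using C0 p0 by (simp add: Far_def)
    have pairs: "(real M)\<^sup>2 * (p * near + far) \<le>
        \<epsilon>\<^sup>2 * (14 ^ \<tau> * (1 + total)) * a ^ \<tau> + \<epsilon>\<^sup>2 * C3 * p powr stretch + \<epsilon>\<^sup>2 * Far p / p\<^sup>2"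
    proof -
      let ?N = "14 ^ \<tau> * a ^ \<tau> * p * (1 + total) + C3 * p * p powr stretch"
      have N0: "0 \<le> ?N" using a p0 total_nonneg C30 by simp
      have "(real M)\<^sup>2 * (p * near + far) \<le> (real M)\<^sup>2 * (p * ?N + Far p)"
        using near far p0 by (intro mult_left_mono add_mono) auto
      also have "\<dots> \<le> (\<epsilon> / p)\<^sup>2 * (p * ?N + Far p)"
        using M(2) N0 Far0 p0 by (intro mult_right_mono power_mono) auto
      also have "\<dots> = \<epsilon>\<^sup>2 * (14 ^ \<tau> * (1 + total)) * a ^ \<tau> + \<epsilon>\<^sup>2 * C3 * p powr stretch + \<epsilon>\<^sup>2 * Far p / p\<^sup>2"
        using p0 by (simp add: power2_eq_square field_simps)
      finally show ?thesis .
    qed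
    show ?case unfolding prob_origin_blue_eq
      using lower some pairs seeds_m far elim(3) unfolding err_def by linarith
  qed
qed

end

theorem theorem1p1:
  fixes \<rho> \<tau> :: nat and r :: real
  assumes "\<rho> \<ge> 1" and "\<tau> \<ge> 1" and "r > 0"
  defines "P \<equiv> \<lambda>a p. ereal (prob_origin_blue (blue_nbhd \<tau>) (red_nbhd \<rho>) r p
                              (a * p powr critical_exponent \<rho> \<tau>))"
  shows "(\<forall>a>0. 0 < Liminf (at_right 0) (P a)
                \<and> Liminf (at_right 0) (P a) \<le> Limsup (at_right 0) (P a)
                \<and> Limsup (at_right 0) (P a) < 1)
       \<and> ((\<lambda>a. Limsup (at_right 0) (P a)) \<longlongrightarrow> 0) at_top
       \<and> ((\<lambda>a. Liminf (at_right 0) (P a)) \<longlongrightarrow> 1) (at_right 0)"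
proof -
  interpret competition \<rho> \<tau> r by unfold_locales (use assms in auto)
  define \<kappa> where "\<kappa> \<epsilon> = real \<tau> * \<epsilon> * (3 * real \<tau> * r * \<epsilon>) ^ \<rho>" for \<epsilon>
  define e where "e \<epsilon> a = \<epsilon> / (4 * real \<tau>) * (a * \<epsilon> / 4) ^ \<tau>" for \<epsilon> a
  define U where "U \<epsilon> a = 1 - (1 - 3 * \<epsilon>) * ((1 - \<kappa> \<epsilon>)\<^sup>2 * (e \<epsilon> a / (1 + e \<epsilon> a)))\<^sup>2" for \<epsilon> a
  define K where "K = 14 ^ \<tau> * (1 + total)"
  have K: "K > 0" using total_nonneg by (simp add: K_def)
  have upper: "Limsup (at_right 0) (P a) \<le> ereal (U \<epsilon> a)"
    if "a > 0" "\<epsilon> > 0" "3 * \<epsilon> < 1" "\<kappa> \<epsilon> < 1" for a \<epsilon>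
    using origin_blue_upper[of a \<epsilon>] that unfolding P_def U_def \<kappa>_def e_def
    by (intro Limsup_bounded) simp
  have lower: "ereal (\<epsilon> / (2 + \<epsilon>) - \<epsilon>\<^sup>2 * K * a ^ \<tau> - \<theta>) \<le> Liminf (at_right 0) (P a)"
    if "a > 0" "\<epsilon> > 0" "\<theta> > 0" for a \<epsilon> \<theta>
    using origin_blue_lower[OF that] unfolding P_def K_def
    by (intro Liminf_bounded) simp
  have \<kappa>_0: "(\<kappa> \<longlongrightarrow> 0) (at_right 0)"
  proof -
    have "(\<kappa> \<longlongrightarrow> real \<tau> * 0 * (3 * real \<tau> * r * 0) ^ \<rho>) (at_right 0)"
      unfolding \<kappa>_def by (intro tendsto_intros)
    then show ?thesis by simp
  qed
  have ev_\<epsilon>: "\<forall>\<^sub>F \<epsilon> in at_right 0. 0 < \<epsilon> \<and> 3 * \<epsilon> < 1 \<and> \<kappa> \<epsilon> < 1"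
  proof (intro eventually_conj)
    show "\<forall>\<^sub>F \<epsilon> in at_right (0::real). 3 * \<epsilon> < 1"
    proof -
      have "((\<lambda>\<epsilon>::real. 3 * \<epsilon>) \<longlongrightarrow> 3 * 0) (at_right 0)" by (intro tendsto_intros)
      then show ?thesis by (rule order_tendstoD) simp
    qed
    show "\<forall>\<^sub>F \<epsilon> in at_right 0. \<kappa> \<epsilon> < 1" by (rule order_tendstoD(2)[OF \<kappa>_0]) simp
  qed (rule eventually_at_right_less)
  have LL: "Liminf (at_right 0) (P a) \<le> Limsup (at_right 0) (P a)" for a
    by (intro Liminf_le_Limsup trivial_limit_at_right_real)
  have pos: "0 < Liminf (at_right 0) (P a)" if a: "a > 0" for a
  proof -
    \<comment> \<open>The main term
      \<open>\<epsilon> / (2 + \<epsilon>) \<ge> \<epsilon> / 3\<close> is linear and the loss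
      quadratic in \<epsilon>. This choice keeps the loss below \<open>\<epsilon> / 6\<close>, and
      \<open>\<theta> = \<epsilon> / 12\<close> takes half of what remains.\<close>
    define \<epsilon> where "\<epsilon> = min 1 (1 / (6 * (K * a ^ \<tau>)))"
    have Ka: "K * a ^ \<tau> > 0" using K a by simp
    have \<epsilon>: "0 < \<epsilon>" "\<epsilon> \<le> 1" "\<epsilon> * (K * a ^ \<tau>) \<le> 1 / 6"
    proof -
      show "0 < \<epsilon>" "\<epsilon> \<le> 1" using Ka by (simp_all add: \<epsilon>_def)
      have "\<epsilon> * (K * a ^ \<tau>) \<le> 1 / (6 * (K * a ^ \<tau>)) * (K * a ^ \<tau>)"
        using Ka by (intro mult_right_mono) (auto simp: \<epsilon>_def)
      moreover have "1 / (6 * x) * x = 1 / 6" if "x > 0" for x :: real using that by simp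
      ultimately show "\<epsilon> * (K * a ^ \<tau>) \<le> 1 / 6" using Ka by metis
    qed
    have "\<epsilon> / 3 \<le> \<epsilon> / (2 + \<epsilon>)" using \<epsilon> by (intro divide_left_mono) auto
    moreover have "\<epsilon>\<^sup>2 * K * a ^ \<tau> \<le> \<epsilon> / 6"
      using mult_left_mono[OF \<epsilon>(3), of \<epsilon>] \<epsilon>(1) by (simp add: power2_eq_square mult.assoc)
    ultimately have "0 < \<epsilon> / (2 + \<epsilon>) - \<epsilon>\<^sup>2 * K * a ^ \<tau> - \<epsilon> / 12" using \<epsilon>(1) by linarith
    then have "0 < ereal (\<epsilon> / (2 + \<epsilon>) - \<epsilon>\<^sup>2 * K * a ^ \<tau> - \<epsilon> / 12)" by simp
    also have "\<dots> \<le> Liminf (at_right 0) (P a)" using a \<epsilon>(1) by (intro lower) auto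
    finally show ?thesis .
  qed
  have less_1: "Limsup (at_right 0) (P a) < 1" if a: "a > 0" for a
  proof -
    obtain \<epsilon> where \<epsilon>: "0 < \<epsilon>" "3 * \<epsilon> < 1" "\<kappa> \<epsilon> < 1"
      using eventually_happens[OF ev_\<epsilon>] trivial_limit_at_right_real by auto
    have "e \<epsilon> a > 0" using \<epsilon> a assms by (simp add: e_def)
    then have "0 < (1 - \<kappa> \<epsilon>)\<^sup>2 * (e \<epsilon> a / (1 + e \<epsilon> a))" using \<epsilon> by (intro mult_pos_pos) auto
    then have "0 < (1 - 3 * \<epsilon>) * ((1 - \<kappa> \<epsilon>)\<^sup>2 * (e \<epsilon> a / (1 + e \<epsilon> a)))\<^sup>2"
      using \<epsilon>(2) by (intro mult_pos_pos[OF _ zero_less_power]) auto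
    then have "ereal (U \<epsilon> a) < 1" by (simp add: U_def)
    then show ?thesis using upper[OF a \<epsilon>] by (rule le_less_trans[rotated])
  qed
  have "((\<lambda>a. Limsup (at_right 0) (P a)) \<longlongrightarrow> 0) at_top"
  proof (rule order_tendstoI)
    fix l :: ereal assume l: "l < 0"
    have "l < Limsup (at_right 0) (P a)" if "0 < a" for a
      using less_trans[OF l less_le_trans[OF pos[OF that] LL]] .
    then show "\<forall>\<^sub>F a in at_top. l < Limsup (at_right 0) (P a)"
      by (rule eventually_mono[OF eventually_gt_at_top])
  next
    fix u :: ereal assume "0 < u"
    then obtain \<eta> where \<eta>: "0 < \<eta>" "ereal \<eta> < u" using ereal_dense2[of 0 u] by auto
    \<comment> \<open>This is \<open>U\<close> with \<open>e / (1 + e)\<close> replaced by its limit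
      1 for large \<open>a\<close>. First \<epsilon> is fixed to make it smaller than \<eta>, then
      \<open>a\<close> is sent to infinity.\<close>
    have lim_\<epsilon>: "((\<lambda>\<epsilon>. 1 - (1 - 3 * \<epsilon>) * ((1 - \<kappa> \<epsilon>)\<^sup>2 * 1)\<^sup>2) \<longlongrightarrow> 1 - (1 - 3 * 0) * ((1 - 0)\<^sup>2 * 1)\<^sup>2) (at_right 0)"
      by (intro tendsto_intros \<kappa>_0)
    then have "\<forall>\<^sub>F \<epsilon> in at_right 0. 1 - (1 - 3 * \<epsilon>) * ((1 - \<kappa> \<epsilon>)\<^sup>2 * 1)\<^sup>2 < \<eta>"
      by (rule order_tendstoD) (use \<eta> in simp)
    with ev_\<epsilon> have "\<forall>\<^sub>F \<epsilon> in at_right 0. (0 < \<epsilon> \<and> 3 * \<epsilon> < 1 \<and> \<kappa> \<epsilon> < 1) \<and>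
        1 - (1 - 3 * \<epsilon>) * ((1 - \<kappa> \<epsilon>)\<^sup>2 * 1)\<^sup>2 < \<eta>"
      by (rule eventually_conj)
    then obtain \<epsilon> where \<epsilon>: "0 < \<epsilon>" "3 * \<epsilon> < 1" "\<kappa> \<epsilon> < 1" "1 - (1 - 3 * \<epsilon>) * ((1 - \<kappa> \<epsilon>)\<^sup>2 * 1)\<^sup>2 < \<eta>"
      using eventually_happens trivial_limit_at_right_real by blast
    have "filterlim (\<lambda>a. e \<epsilon> a) at_top at_top"
      unfolding e_def
    proof (rule filterlim_tendsto_pos_mult_at_top[OF tendsto_const])
      have "filterlim (\<lambda>a::real. a * \<epsilon> / 4) at_top at_top" using \<epsilon>(1) by real_asymp
      then show "filterlim (\<lambda>a::real. (a * \<epsilon> / 4) ^ \<tau>) at_top at_top"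
        using assms by (intro filterlim_pow_at_top) auto
    qed (use \<epsilon> assms in simp)
    moreover have "((\<lambda>x::real. x / (1 + x)) \<longlongrightarrow> 1) at_top" by real_asymp
    ultimately have "((\<lambda>a. e \<epsilon> a / (1 + e \<epsilon> a)) \<longlongrightarrow> 1) at_top"
      by (rule filterlim_compose[rotated])
    then have "((\<lambda>a. U \<epsilon> a) \<longlongrightarrow> 1 - (1 - 3 * \<epsilon>) * ((1 - \<kappa> \<epsilon>)\<^sup>2 * 1)\<^sup>2) at_top"
      unfolding U_def by (intro tendsto_intros)
    then have "\<forall>\<^sub>F a in at_top. U \<epsilon> a < \<eta>" by (rule order_tendstoD) (rule \<epsilon>(4))
    then show "\<forall>\<^sub>F a in at_top. Limsup (at_right 0) (P a) < u"
      using eventually_gt_at_top[of 0]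
    proof eventually_elim
      case (elim a)
      have "Limsup (at_right 0) (P a) \<le> ereal (U \<epsilon> a)" using upper[OF elim(2) \<epsilon>(1-3)] .
      also have "\<dots> < ereal \<eta>" using elim(1) by simp
      finally show ?case using \<eta>(2) by (rule less_trans)
    qed
  qed
  moreover have "((\<lambda>a. Liminf (at_right 0) (P a)) \<longlongrightarrow> 1) (at_right 0)"
  proof (rule order_tendstoI)
    fix u :: ereal assume u: "1 < u"
    have "Liminf (at_right 0) (P a) < u" if "0 < a" for a
      using less_trans[OF le_less_trans[OF LL less_1[OF that]] u] .
    then show "\<forall>\<^sub>F a in at_right 0. Liminf (at_right 0) (P a) < u"
      by (rule eventually_mono[OF eventually_at_right_less])
  next
    fix l :: ereal assume "l < 1"
    then obtain z where z: "l < ereal z" "z < 1" using ereal_dense2[of l 1] by auto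
    \<comment> \<open>Here \<epsilon> is large: a window of many multiples of \<open>1 / p\<close>
      almost surely contains a blue seed, and with this window fixed a small \<open>a\<close> makes
      walls unlikely.\<close>
    have "((\<lambda>\<epsilon>::real. \<epsilon> / (2 + \<epsilon>)) \<longlongrightarrow> 1) at_top" by real_asymp
    then have "\<forall>\<^sub>F \<epsilon> in at_top. z < \<epsilon> / (2 + \<epsilon>)" by (rule order_tendstoD) (rule z(2))
    then have "\<forall>\<^sub>F \<epsilon> in at_top. z < \<epsilon> / (2 + \<epsilon>) \<and> 0 < \<epsilon>"
      by (rule eventually_conj) (rule eventually_gt_at_top)
    then obtain \<epsilon> where \<epsilon>: "z < \<epsilon> / (2 + \<epsilon>)" "0 < \<epsilon>"
      using eventually_happens trivial_limit_at_top_linorder by blast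
    define \<theta> where "\<theta> = (\<epsilon> / (2 + \<epsilon>) - z) / 2"
    have "((\<lambda>a. \<epsilon> / (2 + \<epsilon>) - \<epsilon>\<^sup>2 * K * a ^ \<tau> - \<theta>) \<longlongrightarrow> \<epsilon> / (2 + \<epsilon>) - \<epsilon>\<^sup>2 * K * 0 ^ \<tau> - \<theta>) (at_right 0)"
      by (intro tendsto_intros)
    \<comment> \<open>The wall term vanishes at \<open>a = 0\<close> because
      \<open>\<tau> \<ge> 1\<close>, and \<theta> uses up only half of the slack.\<close>
    moreover have "z < \<epsilon> / (2 + \<epsilon>) - \<epsilon>\<^sup>2 * K * 0 ^ \<tau> - \<theta>"
      using assms(2) \<epsilon>(1) by (simp add: \<theta>_def power_0_left field_simps)
    ultimately have "\<forall>\<^sub>F a in at_right 0. z < \<epsilon> / (2 + \<epsilon>) - \<epsilon>\<^sup>2 * K * a ^ \<tau> - \<theta>"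
      by (rule order_tendstoD)
    then show "\<forall>\<^sub>F a in at_right 0. l < Liminf (at_right 0) (P a)"
      using eventually_at_right_less[of 0]
    proof eventually_elim
      case (elim a)
      have "l < ereal z" by (rule z(1))
      also have "\<dots> < ereal (\<epsilon> / (2 + \<epsilon>) - \<epsilon>\<^sup>2 * K * a ^ \<tau> - \<theta>)" using elim(1) by simp
      also have "\<dots> \<le> Liminf (at_right 0) (P a)"
        using elim(2) \<epsilon> by (intro lower) (auto simp: \<theta>_def)
      finally show ?case .
    qed
  qed
  ultimately show ?thesis using pos less_1 LL by blast
qed

end
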